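(* Let $V$ be a vector space of dimension $n=8$ over a field $\mathbb K$, where $\mathbb K$ is perfect and has cohomological dimension at most $1$. Assume moreover that every homogeneous equation of degree $3$ in $8$ unknowns with coefficients in $\mathbb K$ admits non-trivial solutions in $\mathbb K^8$. Then, for every hyperplane $H$ of $\mathcal G_3(V)$, the upper radical $R^\uparrow(H)$ is not a line-spread of $\mathrm{PG}(V)$.
   Context: For $1\le k<n=\dim V$, $\mathcal G_k(V)$ is the point-line geometry whose points are the $k$-dimensional subspaces of $V$ and whose lines are the sets $\{X : Y\subset X\subset Z,\ \dim X=k\}$ with $Y\subset Z$ subspaces of $V$, $\dim Y=k-1$, $\dim Z=k+1$. A subspace of $\mathcal G_k(V)$ is a set $S$ of points containing every line that meets $S$ in at least two points; a hyperplane of $\mathcal G_k(V)$ is a proper subspace meeting every line non-trivially. It is known (Shult) that the hyperplanes of $\mathcal G_k(V)$ are exactly the sets of $k$-subspaces of $V$ on which a given non-trivial alternating $k$-linear form $\varphi$ on $V$ identically vanishes, $\varphi$ being unique up to a non-zero scalar. The upper radical $R^\uparrow(H)$ of a hyperplane $H$ of $\mathcal G_3(V)$ is the set of $2$-dimensional subspaces $A$ of $V$ such that every $3$-dimensional subspace of $V$ containing $A$ belongs to $H$. It is a (line-)spread of $\mathrm{PG}(V)$ if every $1$-dimensional subspace of $V$ is contained in exactly one member of $R^\uparrow(H)$. The cohomological dimension of a field $\mathbb K$ is the supremum over all primes $p$ of the $p$-cohomological dimension of the Galois group over $\mathbb K$ of the separable closure of $\mathbb K$. *)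

theory Defs
  imports
    "HOL-Analysis.Analysis"
    "HOL-Algebra.Group_Action"
    "HOL-Algebra.Algebraic_Closure_Type"
    "HOL-Library.Extended_Nat"
begin

section \<open>Grassmannian geometries\<close>

definition k_subspaces :: "('k::field \<Rightarrow> 'v::ab_group_add \<Rightarrow> 'v) \<Rightarrow> nat \<Rightarrow> 'v set set" where
  "k_subspaces smul k = {U. module.subspace smul U \<and> vector_space.dim smul U = k}"

text \<open>The points of the geometry are the members of \<open>k_subspaces smul k\<close>.\<close>

definition grassmann_lines ::
    "('k::field \<Rightarrow> 'v::ab_group_add \<Rightarrow> 'v) \<Rightarrow> nat \<Rightarrow> 'v set set set" where
  "grassmann_lines smul k =
     {{U \<in> k_subspaces smul k. W \<subset> U \<and> U \<subset> Z} | W Z.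
        W \<in> k_subspaces smul (k - 1) \<and> Z \<in> k_subspaces smul (k + 1) \<and> W \<subset> Z}"

definition grassmann_subspace ::
    "('k::field \<Rightarrow> 'v::ab_group_add \<Rightarrow> 'v) \<Rightarrow> nat \<Rightarrow> 'v set set \<Rightarrow> bool" where
  "grassmann_subspace smul k S \<longleftrightarrow> S \<subseteq> k_subspaces smul k \<and>
     (\<forall>l \<in> grassmann_lines smul k. (\<exists>U \<in> l \<inter> S. \<exists>W \<in> l \<inter> S. U \<noteq> W) \<longrightarrow> l \<subseteq> S)"

definition grassmann_hyperplane ::
    "('k::field \<Rightarrow> 'v::ab_group_add \<Rightarrow> 'v) \<Rightarrow> nat \<Rightarrow> 'v set set \<Rightarrow> bool" where
  "grassmann_hyperplane smul k H \<longleftrightarrow>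
     grassmann_subspace smul k H \<and> H \<noteq> k_subspaces smul k \<and>
     (\<forall>l \<in> grassmann_lines smul k. l \<inter> H \<noteq> {})"

text \<open>For a hyperplane \<open>H\<close> of the geometry of 3-dimensional subspaces.\<close>

definition upper_radical ::
    "('k::field \<Rightarrow> 'v::ab_group_add \<Rightarrow> 'v) \<Rightarrow> 'v set set \<Rightarrow> 'v set set" where
  "upper_radical smul H =
     {A \<in> k_subspaces smul 2. \<forall>U \<in> k_subspaces smul 3. A \<subseteq> U \<longrightarrow> U \<in> H}"

definition line_spread ::
    "('k::field \<Rightarrow> 'v::ab_group_add \<Rightarrow> 'v) \<Rightarrow> 'v set set \<Rightarrow> bool" where
  "line_spread smul S \<longleftrightarrow>
     S \<subseteq> k_subspaces smul 2 \<and>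
     (\<forall>P \<in> k_subspaces smul 1. \<exists>!A. A \<in> S \<and> P \<subseteq> A)"


section \<open>Cohomology of topological groups with discrete coefficients\<close>

text \<open>
  A topological group is given by a group \<open>G\<close> and a topology \<open>T\<close> on its carrier.
  Coefficient modules \<open>A\<close> are written multiplicatively, and \<open>\<phi> g\<close> is the action of \<open>g\<close>
  on \<open>A\<close>; the carrier of \<open>A\<close> has the discrete topology.
\<close>

definition discrete_torsion_module ::
    "('g, 'x) monoid_scheme \<Rightarrow> 'g topology \<Rightarrow> 'm monoid \<Rightarrow> ('g \<Rightarrow> 'm \<Rightarrow> 'm) \<Rightarrow> bool" where
  "discrete_torsion_module G T A \<phi> \<longleftrightarrow>
     comm_group A \<and>
     group_action G (carrier A) \<phi> \<and>
     (\<forall>g \<in> carrier G. \<phi> g \<in> hom A A) \<and>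
     continuous_map (prod_topology T (discrete_topology (carrier A)))
       (discrete_topology (carrier A)) (\<lambda>(g, a). \<phi> g a) \<and>
     (\<forall>a \<in> carrier A. \<exists>n > (0::nat). a [^]\<^bsub>A\<^esub> n = \<one>\<^bsub>A\<^esub>)"

text \<open>
  Continuous inhomogeneous \<open>q\<close>-cochains. A \<open>q\<close>-tuple of group elements is an extensional
  function on \<open>{..<q}\<close>.
\<close>

definition cochain_group ::
    "'g topology \<Rightarrow> 'm monoid \<Rightarrow> nat \<Rightarrow> ((nat \<Rightarrow> 'g) \<Rightarrow> 'm) monoid" where
  "cochain_group T A q =
     (let D = {..<q} \<rightarrow>\<^sub>E topspace T in
     \<lparr>carrier = {f \<in> extensional D.
        continuous_map (product_topology (\<lambda>_. T) {..<q}) (discrete_topology (carrier A)) f},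
      mult = \<lambda>f h. \<lambda>x \<in> D. f x \<otimes>\<^bsub>A\<^esub> h x,
      one = \<lambda>x \<in> D. \<one>\<^bsub>A\<^esub>\<rparr>)"

text \<open>\<open>(g\<^sub>0, \<dots>, g\<^sub>q) \<mapsto> (g\<^sub>0, \<dots>, g\<^sub>i\<^sub>-\<^sub>1 g\<^sub>i, \<dots>, g\<^sub>q)\<close> for \<open>1 \<le> i \<le> q\<close>\<close>

definition merge_at ::
    "('g, 'x) monoid_scheme \<Rightarrow> nat \<Rightarrow> nat \<Rightarrow> (nat \<Rightarrow> 'g) \<Rightarrow> nat \<Rightarrow> 'g" where
  "merge_at G q i g =
     (\<lambda>j \<in> {..<q}. if Suc j < i then g j
                  else if Suc j = i then g j \<otimes>\<^bsub>G\<^esub> g (Suc j)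
                  else g (Suc j))"

text \<open>
  In additive notation,
  \<open>(d f)(g\<^sub>0, \<dots>, g\<^sub>q) = g\<^sub>0 f(g\<^sub>1, \<dots>, g\<^sub>q)
     + (\<Sum>i = 1..q. (-1)\<^sup>i f(g\<^sub>0, \<dots>, g\<^sub>i\<^sub>-\<^sub>1 g\<^sub>i, \<dots>, g\<^sub>q)) + (-1)\<^sup>q\<^sup>+\<^sup>1 f(g\<^sub>0, \<dots>, g\<^sub>q\<^sub>-\<^sub>1)\<close>.
\<close>

definition coboundary ::
    "('g, 'x) monoid_scheme \<Rightarrow> 'g topology \<Rightarrow> 'm monoid \<Rightarrow> ('g \<Rightarrow> 'm \<Rightarrow> 'm) \<Rightarrow> nat \<Rightarrow>
     ((nat \<Rightarrow> 'g) \<Rightarrow> 'm) \<Rightarrow> (nat \<Rightarrow> 'g) \<Rightarrow> 'm" where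
  "coboundary G T A \<phi> q f =
     (\<lambda>g \<in> {..<Suc q} \<rightarrow>\<^sub>E topspace T.
        \<phi> (g 0) (f (\<lambda>j \<in> {..<q}. g (Suc j)))
        \<otimes>\<^bsub>A\<^esub> finprod A (\<lambda>i. f (merge_at G q i g) [^]\<^bsub>A\<^esub> ((-1) ^ i :: int)) {1..q}
        \<otimes>\<^bsub>A\<^esub> f (restrict g {..<q}) [^]\<^bsub>A\<^esub> ((-1) ^ Suc q :: int))"

definition cocycles where
  "cocycles G T A \<phi> q =
     {f \<in> carrier (cochain_group T A q).
        coboundary G T A \<phi> q f = \<one>\<^bsub>cochain_group T A (Suc q)\<^esub>}"

definition coboundaries where
  "coboundaries G T A \<phi> q =
     (case q of
        0 \<Rightarrow> {\<one>\<^bsub>cochain_group T A 0\<^esub>}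
      | Suc r \<Rightarrow> coboundary G T A \<phi> r ` carrier (cochain_group T A r))"

definition cohomology_group ::
    "('g, 'x) monoid_scheme \<Rightarrow> 'g topology \<Rightarrow> 'm monoid \<Rightarrow> ('g \<Rightarrow> 'm \<Rightarrow> 'm) \<Rightarrow> nat \<Rightarrow>
     ((nat \<Rightarrow> 'g) \<Rightarrow> 'm) set monoid" where
  "cohomology_group G T A \<phi> q =
     (cochain_group T A q) \<lparr>carrier := cocycles G T A \<phi> q\<rparr> Mod coboundaries G T A \<phi> q"

text \<open>
  The \<open>p\<close>-cohomological dimension: the least \<open>n\<close> such that the \<open>p\<close>-primary component of
  \<open>H\<^sup>q(G, A)\<close> vanishes for all \<open>q > n\<close> and all discrete torsion modules \<open>A\<close>, or
  \<open>\<infinity>\<close> if there is none. Since HOL cannot quantify over types inside a formula, the modules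
  range over those with carrier in an explicitly given type \<open>'m\<close>. For profinite \<open>G\<close> the value
  does not depend on \<open>'m\<close> as long as \<open>'m\<close> is infinite: a discrete torsion module is the
  directed union of its finite submodules, continuous cohomology commutes with such unions,
  and every finite module has an isomorphic copy in \<open>'m\<close>.
\<close>

definition p_cohomological_dim ::
    "'m itself \<Rightarrow> ('g, 'x) monoid_scheme \<Rightarrow> 'g topology \<Rightarrow> nat \<Rightarrow> enat" where
  "p_cohomological_dim _ G T p =
     Inf {enat n | n. \<forall>q > n. \<forall>(A :: 'm monoid) \<phi>. discrete_torsion_module G T A \<phi> \<longrightarrow>
        (\<forall>x \<in> carrier (cohomology_group G T A \<phi> q). \<forall>k :: nat.
           x [^]\<^bsub>cohomology_group G T A \<phi> q\<^esub> (p ^ k) = \<one>\<^bsub>cohomology_group G T A \<phi> q\<^esub> \<longrightarrow>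
           x = \<one>\<^bsub>cohomology_group G T A \<phi> q\<^esub>)}"


section \<open>Fields\<close>

definition perfect_field :: "'a::field itself \<Rightarrow> bool" where
  "perfect_field _ \<longleftrightarrow> CHAR('a) = 0 \<or> surj (\<lambda>x :: 'a. x ^ CHAR('a))"

definition separable_closure :: "'a::field alg_closure set" where
  "separable_closure =
     {x. \<exists>p :: 'a poly. Factorial_Ring.irreducible p \<and> coprime p (pderiv p) \<and>
           poly (map_poly to_ac p) x = 0}"

definition absolute_galois_group :: "('a::field alg_closure \<Rightarrow> 'a alg_closure) monoid" where
  "absolute_galois_group =
     (BijGroup separable_closure)
     \<lparr>carrier := {\<sigma> \<in> Bij separable_closure.
        (\<forall>x \<in> separable_closure. \<forall>y \<in> separable_closure.
           \<sigma> (x + y) = \<sigma> x + \<sigma> y \<and> \<sigma> (x * y) = \<sigma> x * \<sigma> y) \<and>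
        (\<forall>c :: 'a. \<sigma> (to_ac c) = to_ac c)}\<rparr>"

text \<open>The Krull topology is the topology of pointwise convergence on the discrete field.\<close>

definition krull_topology :: "('a::field alg_closure \<Rightarrow> 'a alg_closure) topology" where
  "krull_topology =
     subtopology (product_topology (\<lambda>_. discrete_topology separable_closure) separable_closure)
       (carrier absolute_galois_group)"

text \<open>
  The coefficient modules live on subsets of the algebraic closure, which is always infinite.
\<close>

definition cohomological_dim :: "'a::field itself \<Rightarrow> enat" where
  "cohomological_dim _ =
     (SUP p \<in> {p :: nat. Factorial_Ring.prime p}.
        p_cohomological_dim TYPE('a alg_closure)
          (absolute_galois_group :: ('a alg_closure \<Rightarrow> 'a alg_closure) monoid)
          krull_topology p)"

definition cubic_form :: "('n \<Rightarrow> 'n \<Rightarrow> 'n \<Rightarrow> 'a) \<Rightarrow> 'a::comm_ring_1 ^ 'n \<Rightarrow> 'a" where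
  "cubic_form c x = (\<Sum>i\<in>UNIV. \<Sum>j\<in>UNIV. \<Sum>k\<in>UNIV. c i j k * x $ i * x $ j * x $ k)"

end

theory Submission
  imports
    Defs
    "HOL-Combinatorics.Permutations"
    "HOL-Library.Poly_Mapping"
    "HOL-Library.List_Lexorder"
    "HOL-Computational_Algebra.Polynomial_Factorial"
    "HOL-Number_Theory.Cong"
begin

text \<open>
  A hyperplane \<open>H\<close> of the geometry of 3-dimensional subspaces is the zero set of an alternating
  trilinear form \<open>\<phi>\<close> on \<open>V\<close> (\<open>trilinear_form_of_H\<close>, Shult). Write \<open>\<phi>\<^sub>v\<close> for the alternating
  bilinear form \<open>\<phi>(v, \<cdot>, \<cdot>)\<close>. A line \<open>\<langle>v, y\<rangle>\<close> of \<open>PG(V)\<close> lies in the upper radical exactly when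
  \<open>y\<close> is in the radical of \<open>\<phi>\<^sub>v\<close>. If the upper radical is a spread, the radical of \<open>\<phi>\<^sub>v\<close> is therefore
  contained in the 2-dimensional member through \<open>v\<close>, for every \<open>v \<noteq> 0\<close>; that is, \<open>\<phi>\<^sub>v\<close> always has
  rank 6. The theorem follows once such forms are excluded (\<open>no_regular_form\<close>).

  Since \<open>v\<close> is in the radical of \<open>\<phi>\<^sub>v\<close>, the rank is at most 6, and it is 6 exactly when one of
  the \<open>6 \<times> 6\<close> Pfaffian cofactors \<open>P\<^sub>i\<^sub>j(v)\<close> is non-zero. These are cubic forms in \<open>v\<close> and satisfy
  \<open>v \<and> P(v) = 0\<close>. By exactness of the Koszul complex, \<open>P(v) = v \<and> w(v)\<close> for a quadratic map \<open>w\<close>.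
  Where the rank is 6, the radical of \<open>\<phi>\<^sub>v\<close> is \<open>\<langle>v, w(v)\<rangle>\<close>. Differentiating
  \<open>\<phi>(v, w(v), \<cdot>) = 0\<close> shows that it contains \<open>w(w(v))\<close> as well, so that
  \<open>w(w(v)) = \<alpha>(v) v + \<beta>(v) w(v)\<close> and hence
  \<open>w(v) \<and> w(w(v)) = - \<alpha>(v) P(v)\<close>.

  The point is that \<open>\<alpha>\<close> is a cubic form. By hypothesis it has a zero \<open>u \<noteq> 0\<close>. If \<open>P(u) \<noteq> 0\<close>, then
  \<open>x = w(u)\<close> is non-zero and \<open>P(x) = x \<and> w(x) = 0\<close>; so \<open>\<phi>\<^sub>u\<close> or \<open>\<phi>\<^sub>x\<close> has rank less than 6.
  (For \<open>\<phi>(x, y, z) = tr (x [y, z])\<close> on the \<open>3 \<times> 3\<close> matrices of trace zero over a field of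
  characteristic zero, \<open>w(x)\<close> is the trace-free part of \<open>x\<^sup>2\<close> and \<open>\<alpha>\<close> is the determinant, up to scalars.)

  That \<open>\<alpha>\<close> is a form is seen from traces. Let \<open>D\<^sub>v\<close> be the derivative of \<open>w\<close> at \<open>v\<close>. It acts on
  \<open>\<langle>v, w(v)\<rangle>\<close> by an explicit \<open>2 \<times> 2\<close> matrix, and on the quotient \<open>\<phi>\<^sub>v\<close> turns it into
  \<open>\<phi>\<^sub>w\<^sub>(\<^sub>v\<^sub>)\<close>. Comparing the derivative of the Pfaffian with that of \<open>v \<and> w(v)\<close> yields
  \<open>tr D\<^sub>v\<close>, and linear relations between \<open>tr D\<^sub>v\<close>, \<open>tr D\<^sub>w\<^sub>(\<^sub>v\<^sub>)\<close>, \<open>tr D\<^sub>v\<^sup>2\<close> and \<open>tr (D\<^sub>v D\<^sub>w\<^sub>(\<^sub>v\<^sub>))\<close>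
  give \<open>900 \<alpha>\<close> as a polynomial (\<open>cubic_covariant\<close>). To make sense of the division by 900 in small
  characteristic, the computation is done for the form and the vector with indeterminate entries over
  the integers. There \<open>P\<^sub>0\<^sub>1\<close> is not divisible by any prime, so 900 divides the polynomial
  (\<open>ex_cubic_covariant\<close>), and the resulting identity can be specialised to any field.
\<close>

text \<open>The symbol \<open>$\<close> is kept for the components of vectors.\<close>

no_notation fps_nth (infixl "$" 75)

section \<open>Linear functionals and alternating forms recovered from their zero sets\<close>

locale linear_forms = vector_space scale
  for scale :: "'a::field \<Rightarrow> 'b::ab_group_add \<Rightarrow> 'b"
begin

definition functional :: "('b \<Rightarrow> 'a) \<Rightarrow> bool" where
  "functional l \<longleftrightarrow> (\<forall>x y. l (x + y) = l x + l y) \<and> (\<forall>c x. l (scale c x) = c * l x)"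

lemma functionalI:
  "(\<And>x y. l (x + y) = l x + l y) \<Longrightarrow> (\<And>c x. l (scale c x) = c * l x) \<Longrightarrow> functional l"
  by (simp add: functional_def)

lemma functional_add: "functional l \<Longrightarrow> l (x + y) = l x + l y"
  and functional_scale: "functional l \<Longrightarrow> l (scale c x) = c * l x"
  by (auto simp: functional_def)

lemma functional_diff: "functional l \<Longrightarrow> l (x - y) = l x - l y"
  using functional_add[of l "x - y" y] by simp

lemma functional_zero: "functional l \<Longrightarrow> l 0 = 0"
  using functional_diff[of l 0 0] by simp

lemma functional_neg: "functional l \<Longrightarrow> l (- x) = - l x"
  using functional_diff[of l 0 x] by (simp add: functional_zero)

lemmas functional_simps = functional_add functional_scale functional_diff functional_zero functional_neg

lemma functional_mult: "functional l \<Longrightarrow> functional (\<lambda>x. c * l x)"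
  by (rule functionalI) (simp_all add: functional_simps algebra_simps)

lemma functional_minus: "functional l \<Longrightarrow> functional k \<Longrightarrow> functional (\<lambda>x. l x - k x)"
  by (rule functionalI) (simp_all add: functional_simps algebra_simps)

lemma functional_proportional:
  assumes l: "functional l" and k: "functional k"
    and same: "\<And>x. l x = 0 \<longleftrightarrow> k x = 0" and e: "k e \<noteq> 0"
  shows "l x = l e / k e * k x"
proof -
  have "k (x - scale (k x / k e) e) = 0"
    using e by (simp add: functional_simps[OF k])
  then have "l (x - scale (k x / k e) e) = 0" using same by blast
  then show ?thesis by (simp add: functional_simps[OF l])
qed

text \<open>
  The last clause holds for a subspace of codimension at most one: modulo the subspace, every \<open>x\<close> is
  a multiple of \<open>f\<close>. In the geometry it says that every line meets the hyperplane.
\<close>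

definition codim_le_one :: "('b \<Rightarrow> bool) \<Rightarrow> bool" where
  "codim_le_one S \<longleftrightarrow> (\<forall>x y. S x \<longrightarrow> S y \<longrightarrow> S (x + y)) \<and> (\<forall>c x. S x \<longrightarrow> S (scale c x)) \<and>
     (\<forall>f x. \<not> S f \<longrightarrow> (\<exists>c. S (x - scale c f)))"

lemma codim_le_one_add: "codim_le_one S \<Longrightarrow> S x \<Longrightarrow> S y \<Longrightarrow> S (x + y)"
  and codim_le_one_scale: "codim_le_one S \<Longrightarrow> S x \<Longrightarrow> S (scale c x)"
  and codim_le_one_ex: "codim_le_one S \<Longrightarrow> \<not> S f \<Longrightarrow> \<exists>c. S (x - scale c f)"
  by (auto simp: codim_le_one_def)

lemma codim_le_one_diff: "codim_le_one S \<Longrightarrow> S x \<Longrightarrow> S y \<Longrightarrow> S (x - y)"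
  using codim_le_one_add[of S x "scale (-1) y"] codim_le_one_scale[of S y "-1"] by simp

lemma codim_le_one_descale: "codim_le_one S \<Longrightarrow> S (scale c x) \<Longrightarrow> c \<noteq> 0 \<Longrightarrow> S x"
  using codim_le_one_scale[of S "scale c x" "inverse c"] by simp

text \<open>
  If \<open>f\<close> is outside \<open>S\<close>, the scalar \<open>c\<close> with \<open>x - c f\<close> in \<open>S\<close> is unique, and it is linear in \<open>x\<close>.
\<close>

lemma codim_le_one_functional:
  assumes S: "codim_le_one S"
  shows "\<exists>l. functional l \<and> (\<forall>x. S x \<longleftrightarrow> l x = 0)"
proof (cases "\<forall>x. S x")
  case True
  then show ?thesis by (intro exI[of _ "\<lambda>_. 0"]) (simp add: functional_def)
next
  case False
  then obtain f where f: "\<not> S f" by blast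
  have uniq: "c = d" if "S (x - scale c f)" "S (x - scale d f)" for c d x
  proof (rule ccontr)
    assume "c \<noteq> d"
    have "S ((x - scale d f) - (x - scale c f))" using codim_le_one_diff[OF S that(2,1)] .
    then have "S (scale (c - d) f)" by (simp add: algebra_simps)
    then show False using codim_le_one_descale[OF S] f \<open>c \<noteq> d\<close> by (metis right_minus_eq)
  qed
  define l where "l x = (THE c. S (x - scale c f))" for x
  have lS: "S (x - scale (l x) f)" for x
    unfolding l_def by (rule theI') (use codim_le_one_ex[OF S f] uniq in blast)
  have l_eq: "l x = c" if "S (x - scale c f)" for x c using uniq[OF lS that] .
  have "functional l"
  proof (rule functionalI)
    fix x y
    have "S ((x - scale (l x) f) + (y - scale (l y) f))" by (rule codim_le_one_add[OF S lS lS])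
    then show "l (x + y) = l x + l y" by (intro l_eq) (simp add: algebra_simps)
  next
    fix c x
    have "S (scale c (x - scale (l x) f))" by (rule codim_le_one_scale[OF S lS])
    then show "l (scale c x) = c * l x" by (intro l_eq) (simp add: algebra_simps)
  qed
  moreover have "S x \<longleftrightarrow> l x = 0" for x using l_eq[of x 0] lS[of x] by auto
  ultimately show ?thesis by blast
qed

text \<open>
  The forms constructed by patching are first known to have the correct zeros only outside a proper
  subspace \<open>Y\<close>. A vector \<open>z\<close> of \<open>Y\<close> is moved out of \<open>Y\<close> by subtracting any non-zero multiple of \<open>f\<close>,
  and a suitable multiple makes both sides comparable.
\<close>

lemma codim_le_one_eq_functional_extend:
  assumes S: "codim_le_one S" and l: "functional l" and Y: "\<And>x y. Y x \<Longrightarrow> Y y \<Longrightarrow> Y (x - y)"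
    "\<And>c x. Y x \<Longrightarrow> Y (scale c x)"
    and f: "\<not> Y f" and eq: "\<And>x. \<not> Y x \<Longrightarrow> S x \<longleftrightarrow> l x = 0"
  shows "S z \<longleftrightarrow> l z = 0"
proof (cases "Y z")
  case False then show ?thesis by (rule eq)
next
  case True
  have out: "\<not> Y (z - scale c f)" if "c \<noteq> 0" for c
  proof
    assume "Y (z - scale c f)"
    then have "Y (z - (z - scale c f))" using Y(1)[OF True] by blast
    then have "Y (scale c f)" by simp
    then have "Y (scale (inverse c) (scale c f))" by (rule Y(2))
    then show False using f that by simp
  qed
  show ?thesis
  proof (cases "S f")
    case Sf: True
    then have lf: "l f = 0" using eq[OF f] by simp
    have "S z \<longleftrightarrow> S (z - scale 1 f)"
      using codim_le_one_diff[OF S, of z f] codim_le_one_add[OF S, of "z - f" f] Sf by auto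
    also have "\<dots> \<longleftrightarrow> l z = 0"
      using eq[OF out, of 1] by (simp add: functional_simps[OF l] lf)
    finally show ?thesis .
  next
    case Sf: False
    then have lf: "l f \<noteq> 0" using eq[OF f] by simp
    show ?thesis
    proof
      assume Sz: "S z"
      show "l z = 0"
      proof (rule ccontr)
        assume lz: "l z \<noteq> 0"
        let ?c = "l z / l f"
        have c: "?c \<noteq> 0" using lz lf by simp
        have "l (z - scale ?c f) = 0" using lf by (simp add: functional_simps[OF l])
        then have "S (z - scale ?c f)" using eq[OF out[OF c]] by simp
        from codim_le_one_diff[OF S Sz this] have "S (scale ?c f)" by simp
        then show False using codim_le_one_descale[OF S _ c] Sf by blast
      qed
    next
      assume lz: "l z = 0"
      obtain c where c: "S (z - scale c f)" using codim_le_one_ex[OF S Sf] by blast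
      show "S z"
      proof (cases "c = 0")
        case True then show ?thesis using c by simp
      next
        case False
        then have "l (z - scale c f) = 0" using eq[OF out[OF False]] c by simp
        then show ?thesis using False lz lf by (simp add: functional_simps[OF l])
      qed
    qed
  qed
qed

text \<open>
  The values \<open>g x\<close> are meaningful only for \<open>x\<close> outside the subspace \<open>Y\<close>. A vector of \<open>Y\<close> is the
  difference of the two outside vectors \<open>x + f\<close> and \<open>f\<close>, which forces the bilinear extension. Linearity
  in the first argument comes for free from linearity in the second and antisymmetry.
\<close>

lemma alternating_patch:
  fixes g :: "'b \<Rightarrow> 'b \<Rightarrow> 'a"
  assumes Y: "\<And>x y. Y x \<Longrightarrow> Y y \<Longrightarrow> Y (x - y)" and f: "\<not> Y f"
    and lin: "\<And>x. \<not> Y x \<Longrightarrow> functional (g x)"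
    and alt: "\<And>x. \<not> Y x \<Longrightarrow> g x x = 0"
    and anti: "\<And>x y. \<not> Y x \<Longrightarrow> \<not> Y y \<Longrightarrow> g x y = - g y x"
  defines "G \<equiv> \<lambda>x y. if Y x then g (x + f) y - g f y else g x y"
  shows "functional (G x)" "G x x = 0" "G x y = - G y x" "functional (\<lambda>x. G x y)"
proof -
  have out: "\<not> Y (x + f)" if "Y x" for x using Y[of "x + f" x] that f by auto
  show lin': "functional (G x)" for x
  proof (cases "Y x")
    case True
    then show ?thesis using functional_minus[OF lin[OF out[OF True]] lin[OF f]] by (simp add: G_def)
  next
    case False then show ?thesis using lin by (simp add: G_def)
  qed
  have 1: "G x y = - g y x" if "\<not> Y y" for x y
  proof (cases "Y x")
    case True
    show ?thesis using anti[OF out[OF True] that] anti[OF f that] True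
      by (simp add: G_def functional_simps[OF lin[OF that]])
  next
    case False then show ?thesis using anti[OF _ that] by (simp add: G_def)
  qed
  show anti': "G x y = - G y x" for x y
  proof (cases "Y y")
    case False then show ?thesis using 1 by (simp add: G_def)
  next
    case True
    have "G x y = G x (y + f) - G x f" by (simp add: functional_simps[OF lin'])
    also have "\<dots> = - g (y + f) x + g f x" using 1 out[OF True] f by simp
    also have "\<dots> = - G y x" using True by (simp add: G_def)
    finally show ?thesis .
  qed
  show "G x x = 0"
  proof (cases "Y x")
    case False then show ?thesis using alt by (simp add: G_def)
  next
    case True
    have "g (x + f) x = - g (x + f) f"
      using alt[OF out[OF True]] by (simp add: functional_simps[OF lin[OF out[OF True]]] add_eq_0_iff)
    moreover have "g f x = g f (x + f)"
      using alt[OF f] by (simp add: functional_simps[OF lin[OF f]])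
    ultimately show ?thesis using True anti[OF out[OF True] f] by (simp add: G_def)
  qed
  have "G x y = (-1) * G y x" for x using anti'[of x y] by simp
  then show "functional (\<lambda>x. G x y)" using functional_mult[OF lin'[of y], of "-1"] by simp
qed

text \<open>
  The set of \<open>y\<close> with \<open>Z x y\<close> determines a functional up to a scalar. For \<open>x\<close> not orthogonal to a
  fixed vector \<open>e\<close>, the scalar is fixed by the value at \<open>e\<close>, which has to be the negative of the value
  at \<open>x\<close> of the functional of \<open>e\<close>. Antisymmetry of this choice is checked in the span of \<open>e\<close>, \<open>x\<close> and
  \<open>y\<close>; the remaining \<open>x\<close> are reached by patching.
\<close>

lemma binary_form_exists:
  fixes Z :: "'b \<Rightarrow> 'b \<Rightarrow> bool"
  assumes sym: "\<And>x y. Z x y \<Longrightarrow> Z y x" and alt: "\<And>x. Z x x" and cos: "\<And>x. codim_le_one (Z x)"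
  shows "\<exists>b. (\<forall>x. functional (b x)) \<and> (\<forall>y. functional (\<lambda>x. b x y)) \<and> (\<forall>x. b x x = 0) \<and>
     (\<forall>x y. b x y = - b y x) \<and> (\<forall>x y. Z x y \<longleftrightarrow> b x y = 0)"
proof (cases "\<forall>x y. Z x y")
  case True
  then show ?thesis by (intro exI[of _ "\<lambda>_ _. 0"]) (simp add: functional_def)
next
  case False
  then obtain e f where ef: "\<not> Z e f" by blast
  have "\<forall>x. \<exists>l. functional l \<and> (\<forall>y. Z x y \<longleftrightarrow> l y = 0)"
    using codim_le_one_functional[OF cos] by blast
  then obtain h where h: "\<And>x. functional (h x)" and hZ: "\<And>x y. Z x y \<longleftrightarrow> h x y = 0" by metis
  let ?l = "h e"
  define g where "g x y = - ?l x / h x e * h x y" for x y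
  have he: "h x e \<noteq> 0" if "\<not> Z e x" for x using that sym hZ by blast
  have g_fun: "functional (g x)" for x unfolding g_def by (rule functional_mult[OF h])
  have gZ: "Z x y \<longleftrightarrow> g x y = 0" if "\<not> Z e x" for x y
    using that he[OF that] hZ by (auto simp: g_def)
  have ge: "g x e = - ?l x" if "\<not> Z e x" for x using he[OF that] by (simp add: g_def)
  have anti: "g x y = - g y x" if x: "\<not> Z e x" and y: "\<not> Z e y" for x y
  proof (cases "Z x y")
    case True then show ?thesis using gZ[OF x] gZ[OF y] sym by fastforce
  next
    case False
    let ?s = "g x y" and ?t = "g y x"
    have s0: "?s \<noteq> 0" using gZ[OF x] False by blast
    \<comment> \<open>\<open>u\<close> is chosen orthogonal to \<open>x\<close>, and \<open>m\<close> orthogonal to \<open>e\<close> and \<open>y\<close>, hence also to \<open>u\<close>.\<close>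
    define c where "c = ?l x / ?s"
    define u where "u = e + scale c y"
    define m where "m = scale ?t e + scale (?l y) x - scale (?l x) y"
    have l0: "?l x \<noteq> 0" "?l y \<noteq> 0" "?l e = 0" using x y hZ alt by auto
    have c0: "c \<noteq> 0" using l0 s0 by (simp add: c_def)
    have "g x u = 0" using ge[OF x] s0 by (simp add: u_def c_def functional_simps[OF g_fun])
    then have "Z u x" using gZ[OF x] sym by blast
    have "?l m = 0" by (simp add: m_def functional_simps[OF h] l0)
    then have "Z m e" using hZ sym by blast
    have "g y y = 0" using gZ[OF y] alt by blast
    then have "g y m = 0" using ge[OF y] by (simp add: m_def functional_simps[OF g_fun])
    then have "Z m y" using gZ[OF y] sym by blast
    have "Z m u" unfolding u_def
      by (intro codim_le_one_add[OF cos] codim_le_one_scale[OF cos] \<open>Z m e\<close> \<open>Z m y\<close>)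
    then have um: "h u m = 0" and ux: "h u x = 0" and uu: "h u u = 0"
      using sym \<open>Z u x\<close> alt hZ by blast+
    \<comment> \<open>The functional of \<open>u\<close> vanishes at \<open>u\<close>, \<open>x\<close> and \<open>m\<close> but not at \<open>e\<close>. So these three vectors of
      the span of \<open>e, x, y\<close> are dependent, and their determinant is \<open>t c + l x\<close> up to sign.\<close>
    have "?l u \<noteq> 0" using c0 l0 by (simp add: u_def functional_simps[OF h])
    then have ue: "h u e \<noteq> 0" using hZ sym by blast
    have 1: "h u e + c * h u y = 0" using uu by (simp add: u_def functional_simps[OF h])
    have 2: "?t * h u e - ?l x * h u y = 0"
      using um ux by (simp add: m_def functional_simps[OF h])
    have "h u y * (?t * c + ?l x) = 0"
    proof -
      have "h u y * (?t * c + ?l x) = ?t * (h u e + c * h u y) - (?t * h u e - ?l x * h u y)"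
        by (simp add: algebra_simps)
      then show ?thesis using 1 2 by simp
    qed
    moreover have "h u y \<noteq> 0" using 1 ue by auto
    ultimately have "?t * c + ?l x = 0" by simp
    then have "(?t + ?s) * ?l x = 0" using s0 by (simp add: c_def field_simps)
    then have "?t + ?s = 0" using l0 by simp
    then show ?thesis by (simp add: add_eq_0_iff)
  qed
  define G where "G x y = (if Z e x then g (x + f) y - g f y else g x y)" for x y
  have Y: "Z e (x - y)" if "Z e x" "Z e y" for x y using codim_le_one_diff[OF cos that] .
  have galt: "g x x = 0" if "\<not> Z e x" for x using gZ[OF that] alt by blast
  note patch = alternating_patch[of "Z e" f g, OF Y ef g_fun galt anti, folded G_def]
  have Gfun: "functional (G x)" and Ganti: "G x y = - G y x"
    and "G x x = 0" "functional (\<lambda>x. G x y)" for x y using patch(1)[of x] patch(3)[of x y] patch(2)[of x] patch(4)[of y] by auto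
  moreover have "Z x y \<longleftrightarrow> G x y = 0" for x y
  proof (rule codim_le_one_eq_functional_extend[where Y = "Z e" and f = f, OF cos Gfun Y])
    show "Z e (scale c x)" if "Z e x" for c x using codim_le_one_scale[OF cos that] .
    show "\<not> Z e f" by (rule ef)
    fix y assume y: "\<not> Z e y"
    have "Z x y \<longleftrightarrow> Z y x" using sym by blast
    also have "\<dots> \<longleftrightarrow> G y x = 0" using gZ[OF y] y by (simp add: G_def)
    finally show "Z x y \<longleftrightarrow> G x y = 0" using Ganti[of x y] by simp
  qed
  ultimately show ?thesis by blast
qed


text \<open>
  Fixing \<open>x\<close> gives a bilinear form \<open>b x\<close>, unique up to a scalar. For \<open>x\<close> outside the radical \<open>Y\<close> of
  \<open>b e\<close>, the scalar is chosen such that \<open>g x e = - b e x\<close>. Then \<open>g x y\<close> and \<open>- g y x\<close> are functionals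
  with the same kernel. If \<open>b e x y \<noteq> 0\<close>, they agree at \<open>e\<close> and so coincide. Otherwise the first case
  compares both with a third vector \<open>z\<close> that is orthogonal under \<open>b e\<close> to neither \<open>x\<close> nor \<open>y\<close>. If the
  functionals differed by a factor \<open>\<rho> \<noteq> 1\<close>, both would vanish at all these \<open>z\<close>. The field then has the
  three elements \<open>0, 1, \<rho>\<close>, which is enough for these \<open>z\<close> to span the space.
\<close>

lemma trilinear_form_exists:
  fixes Z :: "'b \<Rightarrow> 'b \<Rightarrow> 'b \<Rightarrow> bool"
  assumes sym12: "\<And>x y z. Z x y z \<Longrightarrow> Z y x z" and sym23: "\<And>x y z. Z x y z \<Longrightarrow> Z x z y"
    and alt: "\<And>x z. Z x x z" and cos: "\<And>x y. codim_le_one (Z x y)"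
  shows "\<exists>\<phi>. (\<forall>y z. functional (\<lambda>x. \<phi> x y z)) \<and> (\<forall>x z. functional (\<lambda>y. \<phi> x y z)) \<and>
     (\<forall>x y. functional (\<phi> x y)) \<and> (\<forall>x z. \<phi> x x z = 0) \<and> (\<forall>x y. \<phi> x y y = 0) \<and>
     (\<forall>x y z. Z x y z \<longleftrightarrow> \<phi> x y z = 0)"
proof (cases "\<forall>x y z. Z x y z")
  case True
  then show ?thesis by (intro exI[of _ "\<lambda>_ _ _. 0"]) (simp add: functional_def)
next
  case False
  then obtain e f h where efh: "\<not> Z e f h" by blast
  have "\<exists>b. (\<forall>y. functional (b y)) \<and> (\<forall>z. functional (\<lambda>y. b y z)) \<and> (\<forall>y. b y y = 0) \<and>
     (\<forall>y z. b y z = - b z y) \<and> (\<forall>y z. Z x y z \<longleftrightarrow> b y z = 0)" for x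
    by (rule binary_form_exists) (use sym12 sym23 alt cos in blast)+
  then obtain b where b: "\<And>x y. functional (b x y)" "\<And>x z. functional (\<lambda>y. b x y z)"
    "\<And>x y. b x y y = 0" "\<And>x y z. b x y z = - b x z y" and bZ: "\<And>x y z. Z x y z \<longleftrightarrow> b x y z = 0"
    by metis
  define Y where "Y x \<longleftrightarrow> (\<forall>z. b e x z = 0)" for x
  have "\<exists>k. \<not> Y x \<longrightarrow> k \<noteq> 0 \<and> (\<forall>z. k * b x e z = - b e x z)" for x
  proof (cases "Y x")
    case False
    then obtain w where w: "b e x w \<noteq> 0" by (auto simp: Y_def)
    have same: "b e x z = 0 \<longleftrightarrow> b x e z = 0" for z using bZ sym12 by blast
    then have w': "b x e w \<noteq> 0" using w by blast
    have "b e x z = b e x w / b x e w * b x e z" for z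
      by (rule functional_proportional[OF b(1) b(1) same w'])
    then have "- (b e x w / b x e w) * b x e z = - b e x z" for z by (metis mult_minus_left)
    then show ?thesis using w w' by (intro exI[of _ "- (b e x w / b x e w)"]) auto
  qed auto
  then obtain k where k: "\<And>x. \<not> Y x \<Longrightarrow> k x \<noteq> 0" "\<And>x z. \<not> Y x \<Longrightarrow> k x * b x e z = - b e x z"
    by metis
  define g where "g x y z = k x * b x y z" for x y z
  have g: "functional (g x y)" "functional (\<lambda>y. g x y z)" "g x y y = 0" "g x y z = - g x z y" for x y z
    unfolding g_def using functional_mult[OF b(1)] functional_mult[OF b(2)] b(3) b(4)[of x y z] by auto
  have gZ: "Z x y z \<longleftrightarrow> g x y z = 0" if "\<not> Y x" for x y z
    using k(1)[OF that] bZ by (simp add: g_def)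
  have ge: "g x e z = - b e x z" if "\<not> Y x" for x z using k(2)[OF that] by (simp add: g_def)
  have gx: "g x x z = 0" if "\<not> Y x" for x z using gZ[OF that] alt by blast
  have kernel: "g x y u = 0 \<longleftrightarrow> - g y x u = 0" if "\<not> Y x" "\<not> Y y" for x y u
    using gZ[OF that(1)] gZ[OF that(2)] sym12 by (metis neg_equal_0_iff_equal)
  have fneg: "functional (\<lambda>u. - g y x u)" for x y using functional_mult[OF g(1), of "-1" y x] by simp
  have anti1: "g x y u = - g y x u" if x: "\<not> Y x" and y: "\<not> Y y" and ne: "b e x y \<noteq> 0" for x y u
  proof -
    have 1: "g x y e = b e x y" using ge[OF x, of y] g(4)[of x y e] by simp
    have 2: "- g y x e = b e x y" using ge[OF y, of x] g(4)[of y x e] b(4)[of e x y] by simp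
    have "g x y u = g x y e / (- g y x e) * (- g y x u)"
      by (rule functional_proportional[OF g(1) fneg kernel[OF x y]]) (use 2 ne in simp)
    then show ?thesis using 1 2 ne by simp
  qed
  have anti: "g x y u = - g y x u" if x: "\<not> Y x" and y: "\<not> Y y" for x y u
  proof (rule ccontr)
    assume neq: "g x y u \<noteq> - g y x u"
    then have qu: "- g y x u \<noteq> 0" using kernel[OF x y, of u] by auto
    define \<rho> where "\<rho> = g x y u / (- g y x u)"
    have ratio: "g x y z = \<rho> * (- g y x z)" for z
      unfolding \<rho>_def by (rule functional_proportional[OF g(1) fneg kernel[OF x y] qu])
    have \<rho>: "\<rho> \<noteq> 1" "\<rho> \<noteq> 0" using neq qu kernel[OF x y, of u] ratio[of u] by auto
    have zero: "g x y z = 0" if zx: "b e z x \<noteq> 0" and zy: "b e z y \<noteq> 0" for z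
    proof -
      have z: "\<not> Y z" using zx by (auto simp: Y_def)
      have "g x y z = g z x y" using anti1[OF z x zx, of y] g(4)[of x y z] by simp
      moreover have "- g y x z = g z x y"
        using anti1[OF z y zy, of x] g(4)[of y x z] g(4)[of z x y] by simp
      ultimately have "g x y z = \<rho> * g x y z" using ratio[of z] by simp
      then show ?thesis using \<rho>(1) by simp
    qed
    obtain z1 z2 where z12: "b e z1 x \<noteq> 0" "b e z2 y \<noteq> 0"
      using x y b(4) unfolding Y_def by (metis neg_equal_0_iff_equal)
    have "\<exists>z. b e z x \<noteq> 0 \<and> b e z y \<noteq> 0"
    proof (cases "b e z1 y \<noteq> 0 \<or> b e z2 x \<noteq> 0")
      case True then show ?thesis using z12 by blast
    next
      case False
      then show ?thesis using z12 by (intro exI[of _ "z1 + z2"]) (simp add: functional_simps[OF b(2)])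
    qed
    then obtain z0 where z0: "b e z0 x \<noteq> 0" "b e z0 y \<noteq> 0" by blast
    have "\<exists>c. b e (u + scale c z0) x \<noteq> 0 \<and> b e (u + scale c z0) y \<noteq> 0"
    proof (rule ccontr)
      assume "\<not> ?thesis"
      then have *: "b e u x + c * b e z0 x = 0 \<or> b e u y + c * b e z0 y = 0" for c
        by (auto simp: functional_simps[OF b(2)])
      have uniq1: "c = d" if "b e u x + c * b e z0 x = 0" "b e u x + d * b e z0 x = 0" for c d
        using that z0 by (metis add_left_cancel mult_right_cancel)
      have uniq2: "c = d" if "b e u y + c * b e z0 y = 0" "b e u y + d * b e z0 y = 0" for c d
        using that z0 by (metis add_left_cancel mult_right_cancel)
      from *[of 0] *[of 1] *[of \<rho>] show False using uniq1 uniq2 \<rho> by (metis zero_neq_one)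
    qed
    then obtain c where "b e (u + scale c z0) x \<noteq> 0" "b e (u + scale c z0) y \<noteq> 0" by blast
    from zero[OF this] zero[OF z0] have "g x y u = 0" by (simp add: functional_simps[OF g(1)])
    then show False using kernel[OF x y] qu by blast
  qed
  have f: "\<not> Y f" using efh bZ by (auto simp: Y_def)
  have Y: "Y (x - y)" if "Y x" "Y y" for x y using that by (simp add: Y_def functional_simps[OF b(2)])
  define \<phi> where "\<phi> x y z = (if Y x then g (x + f) y z - g f y z else g x y z)" for x y z
  note patch = alternating_patch[of Y f "\<lambda>x y. g x y z" for z, OF Y f g(2) gx anti, folded \<phi>_def]
  have \<phi>: "functional (\<lambda>y. \<phi> x y z)" "\<phi> x x z = 0" "\<phi> x y z = - \<phi> y x z" "functional (\<lambda>x. \<phi> x y z)" for x y z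
    using patch(1)[of x z] patch(2)[of x z] patch(3)[of x y z] patch(4)[of y z] by auto
  have \<phi>3: "functional (\<phi> x y)" for x y
    unfolding \<phi>_def by (cases "Y x") (simp_all add: g(1) functional_minus)
  have \<phi>23: "\<phi> x y z = - \<phi> x z y" for x y z
    unfolding \<phi>_def using g(4)[of "x + f" y z] g(4)[of f y z] g(4)[of x y z] by simp
  have \<phi>yy: "\<phi> x y y = 0" for x y unfolding \<phi>_def using g(3) by simp
  have 1: "Z x y z \<longleftrightarrow> \<phi> x y z = 0" if "\<not> Y x" for x y z using gZ[OF that] that by (simp add: \<phi>_def)
  have 2: "Z x y z \<longleftrightarrow> \<phi> x y z = 0" if "\<not> Y z" for x y z
  proof -
    have "Z x y z \<longleftrightarrow> Z z x y" using sym12 sym23 by blast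
    also have "\<dots> \<longleftrightarrow> \<phi> z x y = 0" by (rule 1[OF that])
    also have "\<phi> z x y = \<phi> x y z" using \<phi>(3)[of z x y] \<phi>23[of x z y] by simp
    finally show ?thesis .
  qed
  have "Z x y z \<longleftrightarrow> \<phi> x y z = 0" for x y z
    by (rule codim_le_one_eq_functional_extend[where Y = Y and f = f, OF cos \<phi>3 Y _ f 2])
      (simp_all add: Y_def functional_simps[OF b(2)])
  then show ?thesis using \<phi> \<phi>3 \<phi>yy by blast
qed

end

section \<open>The trilinear form of a hyperplane\<close>

lemma finite_dimensional_vector_space_of_dim:
  assumes "vector_space smul" and "vector_space.dim smul (UNIV :: 'v::ab_group_add set) = n" "n > 0"
  shows "\<exists>B. finite_dimensional_vector_space (smul :: 'k::field \<Rightarrow> 'v \<Rightarrow> 'v) B \<and> card B = n"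
proof -
  interpret vector_space smul by fact
  obtain B where B: "B \<subseteq> UNIV" "independent B" "UNIV \<subseteq> span B" "card B = dim (UNIV :: 'v set)"
    using basis_exists by blast
  then have "finite B" using assms card_gt_0_iff by fastforce
  then show ?thesis
    using B assms by (intro exI[of _ B]) (auto intro!: finite_dimensional_vector_space.intro
      finite_dimensional_vector_space_axioms.intro vector_space_axioms)
qed

locale hyperplane_of_G3 = finite_dimensional_vector_space smul Basis
  for smul :: "'k::field \<Rightarrow> 'v::ab_group_add \<Rightarrow> 'v" and Basis :: "'v set" +
  fixes H :: "'v set set"
  assumes hyp: "grassmann_hyperplane smul 3 H"
begin

sublocale linear_forms smul ..

text \<open>
  Dependent triples count as vanishing, as they must for an alternating form.
\<close>

definition vanishes :: "'v \<Rightarrow> 'v \<Rightarrow> 'v \<Rightarrow> bool" where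
  "vanishes x y z \<longleftrightarrow> (span {x, y, z} \<in> k_subspaces smul 3 \<longrightarrow> span {x, y, z} \<in> H)"

lemma k_subspaces_iff: "U \<in> k_subspaces smul k \<longleftrightarrow> subspace U \<and> dim U = k"
  by (simp add: k_subspaces_def)

lemma span_in_k_subspaces: "span S \<in> k_subspaces smul k \<longleftrightarrow> dim S = k"
  by (simp add: k_subspaces_iff)

lemma vanishes_iff:
  assumes "dim {x, y} = 2"
  shows "vanishes x y z \<longleftrightarrow> z \<in> span {x, y} \<or> span {x, y, z} \<in> H"
proof -
  have "{x, y, z} = insert z {x, y}" by auto
  then have "dim {x, y, z} = (if z \<in> span {x, y} then 2 else 3)"
    using assms dim_insert[of z "{x,y}"] by simp
  then show ?thesis by (auto simp: vanishes_def span_in_k_subspaces)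
qed

lemma span_exchange:
  assumes "u \<in> span {x, y, a}" "u \<notin> span {x, y}"
  shows "span {x, y, u} = span {x, y, a}"
proof -
  have i: "{x, y, a} = insert a {x, y}" "{x, y, u} = insert u {x, y}" by auto
  have "a \<in> span {x, y, u}" using in_span_insert[of u a "{x,y}"] assms unfolding i by blast
  then show ?thesis using assms(1)
    by (intro span_eq[THEN iffD2] conjI) (auto intro: span_base)
qed

text \<open>
  The points of this line are the 3-dimensional subspaces through the plane \<open>\<langle>x, y\<rangle>\<close> inside a
  4-dimensional one. Each is spanned by the plane and one further vector, so the axioms for lines
  become statements about the vectors \<open>u\<close>.
\<close>

lemma line_between:
  assumes W: "dim {x, y} = 2" and a: "a \<notin> span {x, y}" and b: "b \<notin> span {x, y, a}"
  obtains l where "l \<in> grassmann_lines smul 3"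
    and "\<And>u. u \<in> span {x, y, a, b} \<Longrightarrow> u \<notin> span {x, y} \<Longrightarrow> span {x, y, u} \<in> l"
    and "\<And>U. U \<in> l \<Longrightarrow> \<exists>u. u \<in> span {x, y, a, b} \<and> u \<notin> span {x, y} \<and> U = span {x, y, u}"
proof -
  define T where "T = span {x, y, a, b}"
  define l where "l = {U \<in> k_subspaces smul 3. span {x, y} \<subset> U \<and> U \<subset> T}"
  have d3: "dim {x, y, u} = 3" if "u \<notin> span {x, y}" for u
  proof -
    have "{x, y, u} = insert u {x, y}" by auto
    then show ?thesis using dim_insert[of u "{x,y}"] W that by simp
  qed
  have "{x, y, a, b} = insert b {x, y, a}" by auto
  then have d4: "dim {x, y, a, b} = 4" using dim_insert[of b "{x,y,a}"] d3[OF a] b by simp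
  have WT: "span {x, y} \<subset> T"
  proof
    show "span {x, y} \<subseteq> T" unfolding T_def by (rule span_mono) auto
    show "span {x, y} \<noteq> T" using W d4 unfolding T_def by (metis dim_span numeral_eq_iff semiring_norm(85) num.distinct(1) num.inject(1))
  qed
  have "l \<in> grassmann_lines smul 3"
  proof -
    have "span {x, y} \<in> k_subspaces smul (3 - 1)" "T \<in> k_subspaces smul (3 + 1)"
      using W d4 by (simp_all add: T_def span_in_k_subspaces)
    then show ?thesis unfolding grassmann_lines_def l_def using WT by blast
  qed
  moreover have "span {x, y, u} \<in> l" if u: "u \<in> T" "u \<notin> span {x, y}" for u
  proof -
    have "span {x, y, u} \<subseteq> T"
      unfolding T_def by (rule span_minimal) (use u(1) in \<open>auto simp: T_def intro: span_base\<close>)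
    moreover have "span {x, y, u} \<noteq> T" using d3[OF u(2)] d4 unfolding T_def
      by (metis dim_span numeral_eq_iff num.distinct(5))
    moreover have "span {x, y} \<subseteq> span {x, y, u}" by (rule span_mono) auto
    moreover have "u \<in> span {x, y, u}" by (rule span_base) auto
    ultimately show ?thesis using d3[OF u(2)] u(2) by (auto simp: l_def span_in_k_subspaces)
  qed
  moreover have "\<exists>u. u \<in> T \<and> u \<notin> span {x, y} \<and> U = span {x, y, u}" if U: "U \<in> l" for U
  proof -
    obtain u where u: "u \<in> U" "u \<notin> span {x, y}" using U by (auto simp: l_def)
    have sub: "subspace U" and dimU: "dim U = 3" using U by (auto simp: l_def k_subspaces_iff)
    have "x \<in> U" "y \<in> U" using U span_base[of x "{x,y}"] span_base[of y "{x,y}"] by (auto simp: l_def)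
    then have "span {x, y, u} \<subseteq> U" using u sub by (intro span_minimal) auto
    moreover have "dim (span {x, y, u}) = 3" using d3[OF u(2)] by simp
    ultimately have "span {x, y, u} = U"
      using subspace_dim_equal[OF subspace_span sub] dimU by simp
    then show ?thesis using u U by (auto simp: l_def)
  qed
  ultimately show ?thesis using that unfolding T_def by blast
qed

lemma line_in_H:
  "l \<in> grassmann_lines smul 3 \<Longrightarrow> U \<in> l \<Longrightarrow> U \<in> H \<Longrightarrow> W \<in> l \<Longrightarrow> W \<in> H \<Longrightarrow> U \<noteq> W \<Longrightarrow> U' \<in> l \<Longrightarrow> U' \<in> H"
  using hyp unfolding grassmann_hyperplane_def grassmann_subspace_def by blast

lemma line_meets_H: "l \<in> grassmann_lines smul 3 \<Longrightarrow> \<exists>U\<in>l. U \<in> H"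
  using hyp unfolding grassmann_hyperplane_def by blast

text \<open>
  Closure under addition is the subspace axiom for the line through the 3-spaces of \<open>a\<close> and \<open>b\<close>. That
  the codimension is at most one is the axiom that the line through the 3-spaces of \<open>f\<close> and \<open>z\<close> meets
  \<open>H\<close>.
\<close>

lemma codim_le_one_vanishes: "codim_le_one (vanishes x y)"
proof (cases "dim {x, y} = 2")
  case False
  have "dim {x, y, z} \<noteq> 3" for z
  proof -
    have "dim {x, y} \<le> card {x, y}" by (rule dim_le_card') simp
    also have "card {x, y} \<le> 2" by (simp add: card_insert_le_m1)
    finally have "dim {x, y} \<le> 1" using False by simp
    moreover have "{x, y, z} = insert z {x, y}" by auto
    ultimately show ?thesis using dim_insert[of z "{x,y}"] by auto
  qed
  then show ?thesis by (simp add: codim_le_one_def vanishes_def span_in_k_subspaces)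
next
  case W: True
  note S = vanishes_iff[OF W]
  have mono: "span {x, y} \<subseteq> span {x, y, a}" for a by (rule span_mono) auto
  have base: "a \<in> span {x, y, a}" for a by (rule span_base) auto
  have F: "vanishes x y u" if u: "u \<in> span {x, y, a}" and a: "vanishes x y a" for u a
  proof (cases "u \<in> span {x, y}")
    case True then show ?thesis by (simp add: S)
  next
    case False
    have "a \<notin> span {x, y}"
    proof
      assume "a \<in> span {x, y}"
      then have "{x, y, a} \<subseteq> span {x, y}" by (auto intro: span_base)
      then show False using False u span_minimal[of "{x,y,a}" "span {x,y}"] by auto
    qed
    then show ?thesis using span_exchange[OF u False] a by (simp add: S)
  qed
  show ?thesis unfolding codim_le_one_def
  proof (intro conjI allI impI)
    fix a b assume a: "vanishes x y a" and b: "vanishes x y b"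
    consider "b \<in> span {x, y, a}" | "a \<in> span {x, y, b}" | "b \<notin> span {x, y, a}" "a \<notin> span {x, y, b}" by blast
    then show "vanishes x y (a + b)"
    proof cases
      case 1 then show ?thesis using F[OF _ a] span_add[OF base 1] by blast
    next
      case 2 then show ?thesis using F[OF _ b] span_add[OF 2 base] by blast
    next
      case 3
      have a': "a \<notin> span {x, y}" and b': "b \<notin> span {x, y}" using 3 mono by blast+
      obtain l where l: "l \<in> grassmann_lines smul 3"
        "\<And>u. u \<in> span {x, y, a, b} \<Longrightarrow> u \<notin> span {x, y} \<Longrightarrow> span {x, y, u} \<in> l"
        using line_between[OF W a' 3(1)] by metis
      have in4: "a \<in> span {x, y, a, b}" "b \<in> span {x, y, a, b}" by (auto intro: span_base)
      have "a + b \<notin> span {x, y}"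
      proof
        assume "a + b \<in> span {x, y}"
        then have "(a + b) - a \<in> span {x, y, a}" using mono base by (intro span_diff) auto
        then show False using 3 by simp
      qed
      moreover have "span {x, y, a} \<noteq> span {x, y, b}" using 3 base by blast
      ultimately have "span {x, y, a + b} \<in> H"
        using line_in_H[OF l(1) l(2)[OF in4(1) a'] _ l(2)[OF in4(2) b']] a b a' b' l(2)[OF span_add[OF in4]]
        by (auto simp: S)
      then show ?thesis by (simp add: S)
    qed
  next
    fix c a assume "vanishes x y a"
    then show "vanishes x y (smul c a)" using F span_scale[OF base] by blast
  next
    fix f z assume f: "\<not> vanishes x y f"
    have f': "f \<notin> span {x, y}" "span {x, y, f} \<notin> H" using f by (auto simp: S)
    have i: "{x, y, f} = insert f {x, y}" "{x, y, f, z} = insert z (insert f {x, y})" by auto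
    show "\<exists>c. vanishes x y (z - smul c f)"
    proof (cases "z \<in> span {x, y, f}")
      case True
      then obtain c where "z - smul c f \<in> span {x, y}" unfolding i span_insert by blast
      then show ?thesis by (auto simp: S)
    next
      case False
      obtain l where l: "l \<in> grassmann_lines smul 3"
        "\<And>U. U \<in> l \<Longrightarrow> \<exists>u. u \<in> span {x, y, f, z} \<and> u \<notin> span {x, y} \<and> U = span {x, y, u}"
        using line_between[OF W f'(1) False] by metis
      obtain U where "U \<in> l" "U \<in> H" using line_meets_H[OF l(1)] by blast
      then obtain u where u: "u \<in> span {x, y, f, z}" "u \<notin> span {x, y}" "span {x, y, u} \<in> H"
        using l(2) by metis
      then obtain a b where ab: "u - smul a z - smul b f \<in> span {x, y}" unfolding i span_insert by blast
      have a: "a \<noteq> 0"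
      proof
        assume "a = 0"
        then have "u \<in> span {x, y, f}" using ab unfolding i span_insert by auto
        then show False using span_exchange u f' by metis
      qed
      have d: "u - smul a z - smul b f \<in> span {x, y, u}" using ab mono by blast
      have "smul (inverse a) (u - (u - smul a z - smul b f)) \<in> span {x, y, u}"
        by (rule span_scale[OF span_diff[OF base d]])
      also have "smul (inverse a) (u - (u - smul a z - smul b f)) = z - smul (- (inverse a * b)) f"
        using a by (simp add: scale_right_distrib)
      finally have "vanishes x y (z - smul (- (inverse a * b)) f)"
        by (rule F) (use u in \<open>simp add: S\<close>)
      then show ?thesis by blast
    qed
  qed
qed

lemma trilinear_form_of_H:
  "\<exists>\<phi>. (\<forall>y z. functional (\<lambda>x. \<phi> x y z)) \<and> (\<forall>x z. functional (\<lambda>y. \<phi> x y z)) \<and>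
     (\<forall>x y. functional (\<phi> x y)) \<and> (\<forall>x z. \<phi> x x z = 0) \<and> (\<forall>x y. \<phi> x y y = 0) \<and>
     (\<forall>x y z. vanishes x y z \<longleftrightarrow> \<phi> x y z = 0)"
proof (rule trilinear_form_exists)
  show "vanishes y x z" if "vanishes x y z" for x y z using that by (simp add: vanishes_def insert_commute)
  show "vanishes x z y" if "vanishes x y z" for x y z using that by (simp add: vanishes_def insert_commute)
  show "vanishes x x z" for x z
  proof -
    have "dim {x, z} \<le> card {x, z}" by (rule dim_le_card') simp
    also have "card {x, z} \<le> 2" by (simp add: card_insert_le_m1)
    finally show ?thesis by (simp add: vanishes_def span_in_k_subspaces)
  qed
  show "codim_le_one (vanishes x y)" for x y by (rule codim_le_one_vanishes)
qed

end

section \<open>Pfaffians of order six and their cofactors\<close>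

lemma UNIV_8: "(UNIV :: 8 set) = {0, 1, 2, 3, 4, 5, 6, 7}"
proof -
  have "card {0, 1, 2, 3, 4, 5, 6, 7 :: 8} = CARD(8)" by simp
  then have "{0, 1, 2, 3, 4, 5, 6, 7 :: 8} = UNIV" by (rule card_subset_eq[OF finite subset_UNIV])
  then show ?thesis by (rule sym)
qed

lemma sum_8: "(\<Sum>i\<in>(UNIV :: 8 set). f i) = f 0 + (f 1 + (f 2 + (f 3 + (f 4 + (f 5 + (f 6 + (f 7 :: 'a::comm_monoid_add)))))))"
  unfolding UNIV_8 by ((subst sum.insert, simp, simp)+, simp)

text \<open>
  The Pfaffian of the rows and columns \<open>2, \<dots>, 7\<close>, expanded along row 2.
\<close>

definition pf6 :: "(8 \<Rightarrow> 8 \<Rightarrow> 'a::comm_ring_1) \<Rightarrow> 'a" where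
  "pf6 m =
     m 2 3 * (m 4 5 * m 6 7 - m 4 6 * m 5 7 + m 4 7 * m 5 6)
   - m 2 4 * (m 3 5 * m 6 7 - m 3 6 * m 5 7 + m 3 7 * m 5 6)
   + m 2 5 * (m 3 4 * m 6 7 - m 3 6 * m 4 7 + m 3 7 * m 4 6)
   - m 2 6 * (m 3 4 * m 5 7 - m 3 5 * m 4 7 + m 3 7 * m 4 5)
   + m 2 7 * (m 3 4 * m 5 6 - m 3 5 * m 4 6 + m 3 6 * m 4 5)"

text \<open>
  The diagonal condition is independent of antisymmetry in characteristic two.
\<close>

definition alternating_matrix :: "('i \<Rightarrow> 'i \<Rightarrow> 'a::comm_ring_1) \<Rightarrow> bool" where
  "alternating_matrix m \<longleftrightarrow> (\<forall>i. m i i = 0) \<and> (\<forall>i j. m i j = - m j i)"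

lemma alternating_matrix_comp: "alternating_matrix m \<Longrightarrow> alternating_matrix (\<lambda>a c. m (f a) (f c))"
  unfolding alternating_matrix_def by blast

abbreviation slots :: "8 set" where "slots \<equiv> {2, 3, 4, 5, 6, 7}"

lemma pf6_transpose:
  assumes m: "alternating_matrix m" and ab: "a \<in> slots" "b \<in> slots" "a \<noteq> b"
  shows "pf6 (\<lambda>i j. m (Transposition.transpose a b i) (Transposition.transpose a b j)) = - pf6 m"
proof -
  have sk: "m 3 2 = - m 2 3" "m 4 2 = - m 2 4" "m 5 2 = - m 2 5" "m 6 2 = - m 2 6" "m 7 2 = - m 2 7"
    "m 4 3 = - m 3 4" "m 5 3 = - m 3 5" "m 6 3 = - m 3 6" "m 7 3 = - m 3 7"
    "m 5 4 = - m 4 5" "m 6 4 = - m 4 6" "m 7 4 = - m 4 7" "m 6 5 = - m 5 6" "m 7 5 = - m 5 7" "m 7 6 = - m 6 7"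
    using m unfolding alternating_matrix_def by blast+
  show ?thesis using ab
    by (elim insertE emptyE; simp add: pf6_def Transposition.transpose_def sk algebra_simps)
qed

lemma pf6_permutes:
  assumes "\<tau> permutes slots" and "alternating_matrix m"
  shows "pf6 (\<lambda>i j. m (\<tau> i) (\<tau> j)) = of_int (sign \<tau>) * pf6 m"
  using assms(1) finite assms(2)
proof (induction arbitrary: m rule: permutes_induct)
  case id then show ?case by simp
next
  case (swap a b p)
  have p: "permutation p" using swap.hyps permutation_permutes finite by blast
  have "pf6 (\<lambda>i j. m ((Transposition.transpose a b \<circ> p) i) ((Transposition.transpose a b \<circ> p) j)) =
    of_int (sign p) * pf6 (\<lambda>i j. m (Transposition.transpose a b i) (Transposition.transpose a b j))"
    using swap.IH[OF alternating_matrix_comp[OF swap.prems]] by simp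
  also have "\<dots> = of_int (sign (Transposition.transpose a b \<circ> p)) * pf6 m"
    using swap.hyps pf6_transpose[OF swap.prems]
    by (simp add: sign_compose[OF permutation_swap_id p] sign_swap_id)
  finally show ?case .
qed

text \<open>
  The Pfaffian of the matrix without the rows and columns \<open>i\<close> and \<open>j\<close>. The sign of a permutation that
  brings the two indices to the positions 0 and 1 makes it antisymmetric in \<open>i\<close> and \<open>j\<close>.
\<close>

definition pf_cofactor :: "(8 \<Rightarrow> 8 \<Rightarrow> 'a::comm_ring_1) \<Rightarrow> 8 \<Rightarrow> 8 \<Rightarrow> 'a" where
  "pf_cofactor m i j = (if i = j then 0 else
     (let \<pi> = (SOME \<pi>. \<pi> permutes UNIV \<and> \<pi> 0 = i \<and> \<pi> 1 = j) in
       of_int (sign \<pi>) * pf6 (\<lambda>a c. m (\<pi> a) (\<pi> c))))"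

lemma ex_perm2:
  assumes "i \<noteq> j" shows "\<exists>\<pi>. \<pi> permutes (UNIV :: 8 set) \<and> \<pi> 0 = i \<and> \<pi> 1 = j"
proof (cases "i = 1")
  case True
  then show ?thesis using assms
    by (intro exI[of _ "Transposition.transpose 0 j \<circ> Transposition.transpose 0 1"] conjI permutes_compose permutes_swap_id)
      (auto simp: Transposition.transpose_def)
next
  case False
  then show ?thesis using assms
    by (intro exI[of _ "Transposition.transpose 0 i \<circ> Transposition.transpose 1 (Transposition.transpose 0 i j)"] conjI permutes_compose permutes_swap_id)
      (auto simp: Transposition.transpose_def)
qed

text \<open>
  Two permutations with the same values at 0 and 1 differ by a permutation of the other six
  positions, which changes the sign and the Pfaffian by the same factor.
\<close>

lemma pf_cofactor_perm:
  assumes m: "alternating_matrix m" and \<pi>: "\<pi> permutes UNIV"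
  shows "pf_cofactor m (\<pi> 0) (\<pi> 1) = of_int (sign \<pi>) * pf6 (\<lambda>a c. m (\<pi> a) (\<pi> c))"
proof -
  define \<rho> where "\<rho> = (SOME \<rho>. \<rho> permutes (UNIV :: 8 set) \<and> \<rho> 0 = \<pi> 0 \<and> \<rho> 1 = \<pi> 1)"
  have ne: "\<pi> 0 \<noteq> \<pi> 1" using permutes_inj[OF \<pi>] by (metis injD zero_neq_one)
  have \<rho>: "\<rho> permutes UNIV" "\<rho> 0 = \<pi> 0" "\<rho> 1 = \<pi> 1"
    using someI_ex[OF ex_perm2[OF ne]] unfolding \<rho>_def by auto
  define \<tau> where "\<tau> = inv_into UNIV \<pi> \<circ> \<rho>"
  have inv: "inv_into UNIV \<pi> permutes UNIV" by (rule permutes_inv[OF \<pi>])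
  have \<tau>U: "\<tau> permutes UNIV" unfolding \<tau>_def by (rule permutes_compose[OF \<rho>(1) inv])
  have \<tau>01: "\<tau> 0 = 0" "\<tau> 1 = 1" using \<rho> permutes_inverses(2)[OF \<pi>] by (auto simp: \<tau>_def)
  have "x = 0 \<or> x = 1" if "x \<notin> slots" for x :: 8
    using that UNIV_I[of x] unfolding UNIV_8 by blast
  then have \<tau>: "\<tau> permutes slots"
    using permutes_superset[OF \<tau>U, of slots] \<tau>01 by blast
  have \<rho>': "\<rho> = \<pi> \<circ> \<tau>" using permutes_inverses(1)[OF \<pi>] by (auto simp: \<tau>_def fun_eq_iff)
  have perm: "permutation \<pi>" "permutation \<tau>" using \<pi> \<tau>U permutation_permutes finite by blast+
  have "pf_cofactor m (\<pi> 0) (\<pi> 1) = of_int (sign \<rho>) * pf6 (\<lambda>a c. m (\<rho> a) (\<rho> c))"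
    using ne by (simp add: pf_cofactor_def \<rho>_def Let_def)
  also have "\<dots> = of_int (sign \<pi> * sign \<tau>) * pf6 (\<lambda>a c. m (\<pi> (\<tau> a)) (\<pi> (\<tau> c)))"
    by (simp add: \<rho>' sign_compose[OF perm])
  also have "pf6 (\<lambda>a c. m (\<pi> (\<tau> a)) (\<pi> (\<tau> c))) = of_int (sign \<tau>) * pf6 (\<lambda>a c. m (\<pi> a) (\<pi> c))"
    using pf6_permutes[OF \<tau> alternating_matrix_comp[OF m]] .
  also have "of_int (sign \<pi> * sign \<tau>) * (of_int (sign \<tau>) * pf6 (\<lambda>a c. m (\<pi> a) (\<pi> c))) =
    of_int (sign \<pi>) * of_int (sign \<tau> * sign \<tau>) * pf6 (\<lambda>a c. m (\<pi> a) (\<pi> c))"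
    by (simp only: of_int_mult mult.assoc)
  finally show ?thesis by simp
qed

lemma pf_cofactor_same [simp]: "pf_cofactor m i i = 0"
  by (simp add: pf_cofactor_def)

lemma pf_cofactor_hom:
  assumes "\<And>x y. h (x + y) = h x + h y" "\<And>x y. h (x * y) = h x * h y" "\<And>x. h (- x) = - h x" "h 0 = 0" "h 1 = 1"
  shows "pf_cofactor (\<lambda>i j. h (m i j)) i j = h (pf_cofactor m i j)"
proof -
  have d: "h (x - y) = h x - h y" for x y using assms(1)[of x "- y"] assms(3) by simp
  have "h (of_int (sign p)) = of_int (sign p)" for p :: "8 \<Rightarrow> 8"
    by (cases p rule: sign_cases) (simp_all add: assms)
  then show ?thesis by (simp add: pf_cofactor_def Let_def pf6_def assms d)
qed

lemma pf_cofactor_antisym: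
  assumes m: "alternating_matrix m"
  shows "pf_cofactor m j i = - pf_cofactor m i j"
proof (cases "i = j")
  case False
  obtain \<pi> where \<pi>: "\<pi> permutes (UNIV :: 8 set)" "\<pi> 0 = i" "\<pi> 1 = j" using ex_perm2[OF False] by blast
  let ?\<sigma> = "\<pi> \<circ> Transposition.transpose 0 1"
  have \<sigma>: "?\<sigma> permutes UNIV" by (intro permutes_compose permutes_swap_id \<pi>) auto
  have p: "permutation \<pi>" using \<pi> permutation_permutes finite by blast
  have sg: "sign ?\<sigma> = - sign \<pi>"
    by (simp add: sign_compose[OF p permutation_swap_id] sign_swap_id del: o_apply)
  have "pf_cofactor m j i = of_int (sign ?\<sigma>) * pf6 (\<lambda>a c. m (?\<sigma> a) (?\<sigma> c))"
    using pf_cofactor_perm[OF m \<sigma>] \<pi> by (simp add: Transposition.transpose_def)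
  also have "pf6 (\<lambda>a c. m (?\<sigma> a) (?\<sigma> c)) = pf6 (\<lambda>a c. m (\<pi> a) (\<pi> c))"
    by (simp add: pf6_def Transposition.transpose_def)
  finally show ?thesis using pf_cofactor_perm[OF m \<pi>(1)] \<pi> unfolding sg by simp
qed simp

lemma ex_perm3:
  assumes "i \<noteq> j" "i \<noteq> l" "j \<noteq> l" shows "\<exists>\<pi>. \<pi> permutes (UNIV :: 8 set) \<and> \<pi> 0 = i \<and> \<pi> 1 = j \<and> \<pi> 2 = l"
proof -
  obtain \<pi> where \<pi>: "\<pi> permutes (UNIV :: 8 set)" "\<pi> 0 = i" "\<pi> 1 = j" using ex_perm2[OF assms(1)] by blast
  have "\<pi> (inv_into UNIV \<pi> l) = l" using permutes_inverses(1)[OF \<pi>(1)] by simp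
  then show ?thesis using \<pi> assms
    by (intro exI[of _ "\<pi> \<circ> Transposition.transpose 2 (inv_into UNIV \<pi> l)"] conjI permutes_compose permutes_swap_id)
      (auto simp: Transposition.transpose_def)
qed

text \<open>
  This is \<open>v \<and> P = 0\<close>. In the order \<open>l\<close>, \<open>m\<^sub>1\<close>, \<open>\<dots>\<close>, \<open>m\<^sub>5\<close> of the indices different from \<open>i\<close> and \<open>j\<close>,
  the three cofactors differ only in their first row. So the left-hand side is a Pfaffian whose first
  row is the combination of the rows \<open>i\<close>, \<open>j\<close>, \<open>l\<close> with coefficients from \<open>v\<close>. As \<open>v\<close> is in the kernel,
  this row is a combination of the other five, and the Pfaffian vanishes.
\<close>

lemma pf_cofactor_wedge:
  fixes m :: "8 \<Rightarrow> 8 \<Rightarrow> 'a::comm_ring_1"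
  assumes m: "alternating_matrix m" and v: "\<And>i. (\<Sum>j\<in>UNIV. m j i * v j) = 0"
  shows "v l * pf_cofactor m i j + v i * pf_cofactor m j l + v j * pf_cofactor m l i = 0"
proof -
  consider "i = j" | "i = l" | "j = l" | "i \<noteq> j" "i \<noteq> l" "j \<noteq> l" by blast
  then show ?thesis
  proof cases
    case 4
    then obtain \<pi> where \<pi>: "\<pi> permutes (UNIV :: 8 set)" "\<pi> 0 = i" "\<pi> 1 = j" "\<pi> 2 = l" using ex_perm3 by blast
    let ?c = "Transposition.transpose 0 1 \<circ> Transposition.transpose 1 (2::8)"
    have c: "?c permutes UNIV" by (intro permutes_compose permutes_swap_id) auto
    have cp: "permutation ?c" "permutation \<pi>" using c \<pi>(1) permutation_permutes finite by blast+
    have sc: "sign ?c = 1" by (simp add: sign_compose[OF permutation_swap_id permutation_swap_id] sign_swap_id)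
    have \<pi>c: "\<pi> \<circ> ?c permutes UNIV" "\<pi> \<circ> (?c \<circ> ?c) permutes UNIV" by (intro permutes_compose c \<pi>(1))+
    have s: "sign (\<pi> \<circ> ?c) = sign \<pi>" "sign (\<pi> \<circ> (?c \<circ> ?c)) = sign \<pi>"
      using sign_compose[OF cp(2,1)] sign_compose[OF cp(1,1)] sign_compose[OF cp(2) permutation_compose[OF cp(1,1)]] sc
      by auto
    let ?M = "\<lambda>a c. m (\<pi> a) (\<pi> c)"
    define V where "V a = v (\<pi> a)" for a
    define P where "P = of_int (sign \<pi>) * pf6 ?M"
    have M: "alternating_matrix ?M" by (rule alternating_matrix_comp[OF m])
    have sk: "?M b a = - ?M a b" and dg: "?M a a = 0" for a b using M unfolding alternating_matrix_def by blast+
    have ker: "(\<Sum>a\<in>UNIV. ?M a c * V a) = 0" for c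
    proof -
      have "(\<Sum>a\<in>UNIV. ?M a c * V a) = (\<Sum>j\<in>UNIV. m j (\<pi> c) * v j)"
        unfolding V_def by (rule sum.reindex_bij_betw[OF permutes_imp_bij[OF \<pi>(1)], of "\<lambda>j. m j (\<pi> c) * v j"])
      then show ?thesis using v by simp
    qed
    have 0: "pf_cofactor m i j = of_int (sign \<pi>) * pf6 ?M"
      using pf_cofactor_perm[OF m \<pi>(1)] \<pi> by simp
    have 1: "pf_cofactor m j l = of_int (sign \<pi>) * pf6 (\<lambda>a b. ?M (?c a) (?c b))"
      using pf_cofactor_perm[OF m \<pi>c(1), unfolded s] \<pi> by (simp add: Transposition.transpose_def)
    have 2: "pf_cofactor m l i = of_int (sign \<pi>) * pf6 (\<lambda>a b. ?M ((?c \<circ> ?c) a) ((?c \<circ> ?c) b))"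
      using pf_cofactor_perm[OF m \<pi>c(2), unfolded s] \<pi> by (simp add: Transposition.transpose_def)
    have k: "V 2 * ?M 2 c + V 0 * ?M 0 c + V 1 * ?M 1 c =
        - (V 3 * ?M 3 c + V 4 * ?M 4 c + V 5 * ?M 5 c + V 6 * ?M 6 c + V 7 * ?M 7 c)" for c
      unfolding eq_neg_iff_add_eq_0 using ker[of c] by (simp add: sum_8 algebra_simps)
    define r where "r c = V 2 * ?M 2 c + V 0 * ?M 0 c + V 1 * ?M 1 c" for c
    have "V 2 * pf6 ?M + V 0 * pf6 (\<lambda>a b. ?M (?c a) (?c b)) + V 1 * pf6 (\<lambda>a b. ?M ((?c \<circ> ?c) a) ((?c \<circ> ?c) b)) =
      r 3 * (?M 4 5 * ?M 6 7 - ?M 4 6 * ?M 5 7 + ?M 4 7 * ?M 5 6)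
    - r 4 * (?M 3 5 * ?M 6 7 - ?M 3 6 * ?M 5 7 + ?M 3 7 * ?M 5 6)
    + r 5 * (?M 3 4 * ?M 6 7 - ?M 3 6 * ?M 4 7 + ?M 3 7 * ?M 4 6)
    - r 6 * (?M 3 4 * ?M 5 7 - ?M 3 5 * ?M 4 7 + ?M 3 7 * ?M 4 5)
    + r 7 * (?M 3 4 * ?M 5 6 - ?M 3 5 * ?M 4 6 + ?M 3 6 * ?M 4 5)"
      by (simp add: pf6_def r_def Transposition.transpose_def algebra_simps)
    also have "\<dots> = 0"
      unfolding r_def k using sk[of 3 4] sk[of 3 5] sk[of 3 6] sk[of 3 7] sk[of 4 5] sk[of 4 6] sk[of 4 7]
        sk[of 5 6] sk[of 5 7] sk[of 6 7] dg[of 3] dg[of 4] dg[of 5] dg[of 6] dg[of 7]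
      by (simp add: algebra_simps)
    finally have "of_int (sign \<pi>) * (V 2 * pf6 ?M + V 0 * pf6 (\<lambda>a b. ?M (?c a) (?c b)) +
        V 1 * pf6 (\<lambda>a b. ?M ((?c \<circ> ?c) a) ((?c \<circ> ?c) b))) = 0" by simp
    then show ?thesis unfolding 0 1 2 using \<pi> by (simp add: V_def algebra_simps)
  next
    case 1 then show ?thesis using pf_cofactor_antisym[OF m, of l j] by simp
  next
    case 2 then show ?thesis using pf_cofactor_antisym[OF m, of j l] by simp
  next
    case 3 then show ?thesis using pf_cofactor_antisym[OF m, of i l] by simp
  qed
qed

text \<open>
  Up to sign, the sum expands an \<open>8 \<times> 8\<close> Pfaffian in which row \<open>i\<close> has been replaced by row \<open>k\<close>.
\<close>

lemma pf_cofactor_mult: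
  fixes m :: "8 \<Rightarrow> 8 \<Rightarrow> 'a::comm_ring_1"
  assumes m: "alternating_matrix m" and ki: "k \<noteq> i"
  shows "(\<Sum>j\<in>UNIV. m k j * pf_cofactor m i j) = 0"
proof -
  obtain \<pi> where \<pi>: "\<pi> permutes (UNIV :: 8 set)" "\<pi> 0 = i" "\<pi> 1 = k" using ex_perm2 ki by metis
  let ?M = "\<lambda>a c. m (\<pi> a) (\<pi> c)"
  have M: "alternating_matrix ?M" by (rule alternating_matrix_comp[OF m])
  have sk: "?M b a = - ?M a b" and dg: "?M a a = 0" for a b using M unfolding alternating_matrix_def by blast+
  have p: "permutation \<pi>" using \<pi> permutation_permutes finite by blast
  have P: "pf_cofactor m i (\<pi> s) = - (of_int (sign \<pi>) * pf6 (\<lambda>a c. ?M (Transposition.transpose 1 s a) (Transposition.transpose 1 s c)))"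
    if "s \<in> slots" for s
  proof -
    have s: "s \<noteq> 1" "s \<noteq> 0" using that by auto
    have \<sigma>: "\<pi> \<circ> Transposition.transpose 1 s permutes UNIV" by (intro permutes_compose permutes_swap_id \<pi>) auto
    have sg: "sign (\<pi> \<circ> Transposition.transpose 1 s) = - sign \<pi>"
      using s by (simp add: sign_compose[OF p permutation_swap_id] sign_swap_id)
    from pf_cofactor_perm[OF m \<sigma>, unfolded sg] \<pi> s show ?thesis by simp
  qed
  have "(\<Sum>j\<in>UNIV. m k j * pf_cofactor m i j) = (\<Sum>s\<in>UNIV. m k (\<pi> s) * pf_cofactor m i (\<pi> s))"
    by (rule sum.reindex_bij_betw[OF permutes_imp_bij[OF \<pi>(1)], symmetric])
  also have "\<dots> = - of_int (sign \<pi>) * (\<Sum>s\<in>slots. ?M 1 s * pf6 (\<lambda>a c. ?M (Transposition.transpose 1 s a) (Transposition.transpose 1 s c)))"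
    using \<pi> P dg[of 1] by (simp add: sum_8 algebra_simps)
  also have "(\<Sum>s\<in>slots. ?M 1 s * pf6 (\<lambda>a c. ?M (Transposition.transpose 1 s a) (Transposition.transpose 1 s c))) = 0"
    using sk[of 1 2] sk[of 1 3] sk[of 1 4] sk[of 1 5] sk[of 1 6] sk[of 1 7]
    by (simp add: pf6_def Transposition.transpose_def algebra_simps)
  finally show ?thesis by simp
qed

section \<open>Integer polynomials in the coordinates and the coefficients\<close>

abbreviation lookup where "lookup \<equiv> Poly_Mapping.lookup"
abbreviation keys where "keys \<equiv> Poly_Mapping.keys"
abbreviation single where "single \<equiv> Poly_Mapping.single"

type_synonym monomial = "8 list \<Rightarrow>\<^sub>0 nat"
text \<open>
  The variable \<open>[i]\<close> stands for the \<open>i\<close>-th coordinate of a vector, the variable \<open>[i, j, k]\<close> for a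
  coefficient of a trilinear form. Lists are linearly ordered, and this is what makes the polynomial
  ring an integral domain.
\<close>

type_synonym zpoly = "monomial \<Rightarrow>\<^sub>0 int"

definition Var :: "8 list \<Rightarrow> zpoly" where "Var n = single (single n 1) 1"

lemma sum_single_lookup: "(\<Sum>k\<in>keys f. single k (lookup f k)) = f"
  by (rule poly_mapping_eqI)
    (simp add: lookup_sum lookup_single when_def in_keys_iff)

definition eval_monomial :: "(8 list \<Rightarrow> 'a::comm_ring_1) \<Rightarrow> monomial \<Rightarrow> 'a" where
  "eval_monomial x m = (\<Prod>n\<in>keys m. x n ^ lookup m n)"

definition evalp :: "(8 list \<Rightarrow> 'a::comm_ring_1) \<Rightarrow> zpoly \<Rightarrow> 'a" where
  "evalp x f = (\<Sum>m\<in>keys f. of_int (lookup f m) * eval_monomial x m)"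

lemma eval_monomial_superset: "finite S \<Longrightarrow> keys m \<subseteq> S \<Longrightarrow> eval_monomial x m = (\<Prod>n\<in>S. x n ^ lookup m n)"
  unfolding eval_monomial_def by (rule prod.mono_neutral_left) (auto simp: in_keys_iff)

lemma eval_monomial_0 [simp]: "eval_monomial x 0 = 1" by (simp add: eval_monomial_def)

lemma eval_monomial_add: "eval_monomial x (a + b) = eval_monomial x a * eval_monomial x b"
proof -
  let ?S = "keys a \<union> keys b"
  have "eval_monomial x (a + b) = (\<Prod>n\<in>?S. x n ^ lookup (a + b) n)"
    by (rule eval_monomial_superset) (use keys_add[of a b] in auto)
  also have "\<dots> = eval_monomial x a * eval_monomial x b"
    by (simp add: lookup_add power_add prod.distrib eval_monomial_superset[of ?S a] eval_monomial_superset[of ?S b])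
  finally show ?thesis .
qed

lemma evalp_superset: "finite S \<Longrightarrow> keys f \<subseteq> S \<Longrightarrow> evalp x f = (\<Sum>m\<in>S. of_int (lookup f m) * eval_monomial x m)"
  unfolding evalp_def by (rule sum.mono_neutral_left) (auto simp: in_keys_iff)

lemma evalp_0 [simp]: "evalp x 0 = 0" by (simp add: evalp_def)

lemma evalp_add [simp]: "evalp x (f + g) = evalp x f + evalp x g"
proof -
  let ?S = "keys f \<union> keys g"
  have "evalp x (f + g) = (\<Sum>m\<in>?S. of_int (lookup (f + g) m) * eval_monomial x m)"
    by (rule evalp_superset) (use keys_add[of f g] in auto)
  also have "\<dots> = evalp x f + evalp x g"
    by (simp add: lookup_add distrib_right sum.distrib evalp_superset[of ?S f] evalp_superset[of ?S g])
  finally show ?thesis .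
qed

lemma evalp_single [simp]: "evalp x (single m c) = of_int c * eval_monomial x m"
  by (simp add: evalp_def)

lemma evalp_sum [simp]: "evalp x (sum f A) = (\<Sum>a\<in>A. evalp x (f a))"
  by (induction A rule: infinite_finite_induct) auto

lemma evalp_uminus [simp]: "evalp x (- f) = - evalp x f"
  using evalp_add[of x f "- f"] by (simp add: add_eq_0_iff del: evalp_add)

lemma evalp_diff [simp]: "evalp x (f - g) = evalp x f - evalp x g"
  using evalp_add[of x f "- g"] by (simp del: evalp_add)

lemma evalp_1 [simp]: "evalp x 1 = 1"
  using evalp_single[of x 0 1] by (simp del: evalp_single)

lemma zpoly_induct [case_names add single]:
  assumes "\<And>f g. Q f \<Longrightarrow> Q g \<Longrightarrow> Q (f + g)" and "\<And>m c. m \<in> keys f \<or> c = 0 \<Longrightarrow> Q (single m c)"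
  shows "Q (f :: zpoly)"
proof -
  have "Q (\<Sum>k\<in>A. single k (lookup f k))" if "finite A" "A \<subseteq> keys f" for A
    using that
  proof (induction A)
    case empty then show ?case using assms(2)[of 0 0] by simp
  next
    case (insert a A) then show ?case using assms by simp
  qed
  from this[of "keys f"] show ?thesis by (simp add: sum_single_lookup)
qed

lemma evalp_mult [simp]: "evalp x (f * g) = evalp x f * evalp x g"
proof (induction f rule: zpoly_induct)
  case (add f1 f2) then show ?case by (simp add: distrib_right)
next
  case (single m c)
  show ?case
  proof (induction g rule: zpoly_induct)
    case (add g1 g2) then show ?case by (simp add: distrib_left)
  next
    case (single n d) then show ?case by (simp add: mult_single eval_monomial_add algebra_simps)
  qed
qed

lemma evalp_power [simp]: "evalp x (f ^ n) = evalp x f ^ n"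
  by (induction n) auto

lemma evalp_prod [simp]: "evalp x (prod f A) = (\<Prod>a\<in>A. evalp x (f a))"
  by (induction A rule: infinite_finite_induct) auto

lemma evalp_Var [simp]: "evalp x (Var n) = x n"
  by (simp add: Var_def eval_monomial_def)

lemma evalp_of_nat [simp]: "evalp x (of_nat n) = of_nat n" by (induction n) auto
lemma evalp_of_int [simp]: "evalp x (of_int n) = of_int n" by (cases n) auto

lemma evalp_evalp: "evalp x (evalp y f) = evalp (\<lambda>n. evalp x (y n)) f"
  by (simp add: evalp_def[of y] evalp_def[of "\<lambda>n. evalp x (y n)"] eval_monomial_def)

lemma eval_monomial_Var: "eval_monomial Var m = single m 1"
proof -
  have p: "Var n ^ k = single (single n k) 1" for n k
    by (induction k) (simp_all add: Var_def mult_single single_add[symmetric])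
  have "(\<Prod>n\<in>A. single (f n) (1::int)) = single (\<Sum>n\<in>A. f n) 1" if "finite A" for A and f :: "8 list \<Rightarrow> monomial"
    using that by induction (simp_all add: mult_single)
  then show ?thesis by (simp add: eval_monomial_def p sum_single_lookup)
qed

lemma single_of_int_mult: "of_int c * single m (1::int) = single m c"
  by (metis mult.right_neutral mult_single add.left_neutral single_of_int of_int_eq_id id_apply)

lemma evalp_cong_keys: "(\<And>m n. m \<in> keys f \<Longrightarrow> n \<in> keys m \<Longrightarrow> x n = y n) \<Longrightarrow> evalp x f = evalp y f"
  unfolding evalp_def eval_monomial_def by (intro sum.cong prod.cong arg_cong2[of _ _ _ _ "(*)"] refl) auto

text \<open>
  Only the coordinates of the vector are counted; the coefficients of the form have degree 0.
\<close>

definition vec_degree :: "monomial \<Rightarrow> nat" where "vec_degree m = (\<Sum>i\<in>UNIV. lookup m [i])"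

definition homogeneous :: "nat \<Rightarrow> zpoly \<Rightarrow> bool" where "homogeneous d f \<longleftrightarrow> (\<forall>m\<in>keys f. vec_degree m = d)"

lemma vec_degree_add: "vec_degree (a + b) = vec_degree a + vec_degree b"
  by (simp add: vec_degree_def lookup_add sum.distrib)

lemma homogeneous_add [intro]: "homogeneous d f \<Longrightarrow> homogeneous d g \<Longrightarrow> homogeneous d (f + g)"
  using keys_add[of f g] by (auto simp: homogeneous_def)
lemma homogeneous_uminus [intro]: "homogeneous d f \<Longrightarrow> homogeneous d (- f)" by (simp add: homogeneous_def)
lemma homogeneous_diff [intro]: "homogeneous d f \<Longrightarrow> homogeneous d g \<Longrightarrow> homogeneous d (f - g)"
  using homogeneous_add[OF _ homogeneous_uminus, of d f g] by simp
lemma homogeneous_0 [intro,simp]: "homogeneous d 0" by (simp add: homogeneous_def)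
lemma homogeneous_sum [intro]: "(\<And>a. a \<in> A \<Longrightarrow> homogeneous d (f a)) \<Longrightarrow> homogeneous d (sum f A)"
  by (induction A rule: infinite_finite_induct) auto
lemma homogeneous_mult: "homogeneous d f \<Longrightarrow> homogeneous e g \<Longrightarrow> d + e = s \<Longrightarrow> homogeneous s (f * g)"
  using keys_mult[of f g] by (fastforce simp: homogeneous_def vec_degree_add)
lemma homogeneous_single: "vec_degree m = d \<Longrightarrow> homogeneous d (single m c)" by (simp add: homogeneous_def)
lemma vec_degree_single: "vec_degree (single n k) = (if length n = 1 then k else 0)"
proof (cases "length n = 1")
  case True
  then obtain i where "n = [i]" by (auto simp: length_Suc_conv)
  then show ?thesis by (simp add: vec_degree_def lookup_single when_def)
next
  case False
  then show ?thesis by (auto simp: vec_degree_def lookup_single when_def)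
qed
lemma homogeneous_Var1 [intro,simp]: "homogeneous (Suc 0) (Var [i])" unfolding Var_def by (rule homogeneous_single) (simp add: vec_degree_single)
lemma homogeneous_Var3 [intro,simp]: "homogeneous 0 (Var [i,j,k])" unfolding Var_def by (rule homogeneous_single) (simp add: vec_degree_single)
lemma homogeneous_of_int: "homogeneous 0 (of_int c)"
proof -
  have "single 0 (of_int c :: int) = (of_int c :: zpoly)" by (rule single_of_int)
  then have "of_int c = (single 0 c :: zpoly)" by (metis of_int_eq_id id_apply)
  then show ?thesis using homogeneous_single[of 0 0 c] by (simp add: vec_degree_def del: single_of_int)
qed
lemma homogeneous_const_mult: "homogeneous d f \<Longrightarrow> homogeneous d (of_int c * f)"
  by (rule homogeneous_mult[OF homogeneous_of_int]) auto
lemma homogeneous_numeral_mult: "homogeneous d f \<Longrightarrow> homogeneous d (numeral c * f)"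
  using homogeneous_const_mult[of d f "numeral c"] by simp

lemma lookup_single_mult: "lookup (single a 1 * f) (a + m) = (lookup f m :: int)" for a :: monomial
proof -
  have "single a 1 * f = (\<Sum>k\<in>keys f. single (a + k) (lookup f k))"
    by (subst sum_single_lookup[of f, symmetric], subst sum_distrib_left) (simp add: mult_single)
  then show ?thesis by (simp add: lookup_sum lookup_single when_def in_keys_iff)
qed

lemma homogeneous_Var_mult_cancel:
  assumes "homogeneous (Suc d) (Var [i] * f)" shows "homogeneous d f"
  unfolding homogeneous_def
proof
  fix m assume "m \<in> keys f"
  then have "single [i] 1 + m \<in> keys (Var [i] * f)"
    using lookup_single_mult[of "single [i] 1" f m] by (simp add: Var_def in_keys_iff)
  then have "vec_degree (single [i] 1 + m) = Suc d" using assms unfolding homogeneous_def by blast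
  then show "vec_degree m = d" by (simp add: vec_degree_add vec_degree_single)
qed

lemma monomial_split:
  assumes "lookup m n \<noteq> (0::nat)" shows "\<exists>m'. m = single n 1 + m'"
proof
  show "m = single n 1 + (m - single n 1)"
    by (rule poly_mapping_eqI) (use assms in \<open>auto simp: lookup_add lookup_minus lookup_single when_def\<close>)
qed

definition splits :: "nat \<Rightarrow> zpoly \<Rightarrow> bool" where
  "splits d f \<longleftrightarrow> (\<exists>g. (\<forall>i. homogeneous d (g i)) \<and> f = (\<Sum>i\<in>UNIV. Var [i] * g i))"

text \<open>
  Every monomial of positive degree contains a coordinate, which can be split off.
\<close>

lemma homogeneous_Suc_splits:
  assumes "homogeneous (Suc d) f" shows "splits d f"
proof (induction f rule: zpoly_induct)
  case (add f1 f2)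
  then obtain g1 g2 where "\<forall>i. homogeneous d (g1 i)" "f1 = (\<Sum>i\<in>UNIV. Var [i] * g1 i)"
    "\<forall>i. homogeneous d (g2 i)" "f2 = (\<Sum>i\<in>UNIV. Var [i] * g2 i)" unfolding splits_def by blast
  then show ?case unfolding splits_def
    by (intro exI[of _ "\<lambda>i. g1 i + g2 i"]) (auto simp: distrib_left sum.distrib)
next
  case (single m c)
  show ?case
  proof (cases "c = 0")
    case True then show ?thesis unfolding splits_def by (intro exI[of _ "\<lambda>_. 0"]) auto
  next
    case False
    then have "vec_degree m = Suc d" using single assms by (auto simp: homogeneous_def)
    then obtain i where i: "lookup m [i] \<noteq> 0" unfolding vec_degree_def by (metis nat.simps(3) sum.neutral)
    obtain m' where m': "m = single [i] 1 + m'" using monomial_split[OF i] by (rule exE)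
    have "vec_degree m' = d" using \<open>vec_degree m = Suc d\<close> by (simp add: m' vec_degree_add vec_degree_single)
    then have "homogeneous d (single m' c)" by (rule homogeneous_single)
    moreover have "(\<Sum>j\<in>UNIV. Var [j] * (if j = i then single m' c else 0)) = single m c"
      by (simp add: if_distrib[of "\<lambda>x. Var _ * x"] sum.delta cong: if_cong) (simp add: Var_def mult_single m')
    ultimately show ?thesis unfolding splits_def
      by (intro exI[of _ "\<lambda>j. if j = i then single m' c else 0"]) auto
  qed
qed

definition set_zero :: "8 list \<Rightarrow> zpoly \<Rightarrow> zpoly" where "set_zero n = evalp (\<lambda>k. if k = n then 0 else Var k)"

lemma set_zero_single: "set_zero n (single m c) = (if lookup m n = 0 then single m c else 0)"
proof (cases "lookup m n = 0")
  case True
  then have "eval_monomial (\<lambda>k. if k = n then 0 else Var k) m = eval_monomial Var m"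
    unfolding eval_monomial_def by (intro prod.cong) (auto simp: in_keys_iff)
  then show ?thesis using True by (simp add: set_zero_def eval_monomial_Var single_of_int_mult)
next
  case False
  then have "eval_monomial (\<lambda>k. if k = n then 0 else Var k) m = (0::zpoly)"
    unfolding eval_monomial_def by (intro prod_zero) (auto simp: in_keys_iff intro!: bexI[of _ n])
  then show ?thesis using False by (simp add: set_zero_def)
qed

lemma Var_dvd_diff_set_zero: "Var n dvd f - set_zero n f"
proof (induction f rule: zpoly_induct)
  case (add f g)
  then show ?case using dvd_add[OF add] by (simp add: set_zero_def algebra_simps)
next
  case (single m c)
  show ?case
  proof (cases "lookup m n = 0")
    case False
    then obtain m' where "m = single n 1 + m'" using monomial_split[OF False] by (elim exE)
    then have "single m c = Var n * single m' c" by (simp add: Var_def mult_single)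
    moreover have "set_zero n (single m c) = 0" using False by (simp add: set_zero_single)
    ultimately show ?thesis by simp
  qed (simp add: set_zero_single)
qed

lemma homogeneous_set_zero: "homogeneous d f \<Longrightarrow> homogeneous d (set_zero n f)"
proof -
  assume f: "homogeneous d f"
  have "set_zero n f = (\<Sum>m\<in>keys f. set_zero n (single m (lookup f m)))"
    by (subst sum_single_lookup[of f, symmetric]) (simp only: set_zero_def evalp_sum)
  moreover have "homogeneous d (set_zero n (single m (lookup f m)))" if "m \<in> keys f" for m
    using f that by (auto simp: set_zero_single homogeneous_def)
  ultimately show ?thesis by auto
qed

lemma Var_nonzero [simp]: "Var n \<noteq> 0"
  using lookup_single_eq[of "single n 1" "1::int"] unfolding Var_def by (metis lookup_zero one_neq_zero)

lemma lookup_of_nat_mult: "lookup (of_nat p * g) m = int p * lookup (g :: _ \<Rightarrow>\<^sub>0 int) m"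
proof -
  have "of_nat p * g = single 0 (int p) * g" by simp
  also have "\<dots> = Poly_Mapping.map ((*) (int p)) g" by (simp add: mult_map_scale_conv_mult)
  finally show ?thesis by (simp add: map.rep_eq when_def)
qed

lemma of_nat_dvd_zpoly_iff: "of_nat p dvd f \<longleftrightarrow> (\<forall>m. int p dvd lookup f m)"
proof
  assume "of_nat p dvd f"
  then obtain g where "f = of_nat p * g" by blast
  then show "\<forall>m. int p dvd lookup f m" by (simp add: lookup_of_nat_mult)
next
  assume *: "\<forall>m. int p dvd lookup f m"
  have "f = (\<Sum>m\<in>keys f. single m (lookup f m))" by (simp add: sum_single_lookup)
  also have "\<dots> = (\<Sum>m\<in>keys f. of_nat p * single m (lookup f m div int p))"
    by (intro sum.cong refl) (use * in \<open>simp add: single_of_nat[symmetric] mult_single del: single_of_nat\<close>)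
  also have "\<dots> = of_nat p * (\<Sum>m\<in>keys f. single m (lookup f m div int p))"
    by (rule sum_distrib_left[symmetric])
  finally show "of_nat p dvd f" by (rule dvdI)
qed

text \<open>
  Gauss's lemma. Of the monomials whose coefficients are not divisible by \<open>p\<close>, take the largest one in
  each factor. Modulo \<open>p\<close>, their product occurs in \<open>f * g\<close> with the product of the two coefficients.
\<close>

lemma prime_dvd_mult_zpoly:
  assumes p: "Factorial_Ring.prime (p::nat)" and d: "of_nat p dvd f * (g :: zpoly)"
  shows "of_nat p dvd f \<or> of_nat p dvd g"
proof (rule ccontr)
  assume *: "\<not> ?thesis"
  let ?P = "\<lambda>f k. \<not> int p dvd lookup f k"
  define top where "top f = Max {k. ?P f k}" for f :: zpoly
  have fin: "finite {k. ?P f k}" for f :: zpoly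
    by (rule finite_subset[of _ "keys f"]) (auto simp: in_keys_iff)
  have top: "?P f (top f)" and top_ge: "\<And>k. ?P f k \<Longrightarrow> k \<le> top f" if "\<not> of_nat p dvd f" for f :: zpoly
  proof -
    have "{k. ?P f k} \<noteq> {}" using that by (auto simp: of_nat_dvd_zpoly_iff)
    from Max_in[OF fin this] show "?P f (top f)" by (simp add: top_def)
    show "k \<le> top f" if "?P f k" for k unfolding top_def using Max_ge[OF fin] that by blast
  qed
  define M where "M = top f"
  define N where "N = top g"
  have "lookup (f * g) (M + N) = (\<Sum>k\<in>keys f. \<Sum>l\<in>keys g. (lookup f k * lookup g l when k + l = M + N))"
  proof -
    have "f * g = (\<Sum>k\<in>keys f. \<Sum>l\<in>keys g. single (k + l) (lookup f k * lookup g l))"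
      by (subst sum_single_lookup[of f, symmetric], subst sum_single_lookup[of g, symmetric])
        (simp add: sum_product mult_single)
    then show ?thesis by (simp add: lookup_sum lookup_single)
  qed
  also have "[\<dots> = (\<Sum>k\<in>keys f. \<Sum>l\<in>keys g. (if k = M \<and> l = N then lookup f k * lookup g l else 0))] (mod int p)"
  proof (intro cong_sum)
    fix k l
    show "[(lookup f k * lookup g l when k + l = M + N) =
      (if k = M \<and> l = N then lookup f k * lookup g l else 0)] (mod int p)"
    proof (cases "k = M \<and> l = N")
      case False
      show ?thesis
      proof (cases "k + l = M + N \<and> ?P f k \<and> ?P g l")
        case True
        then have "k \<le> M" "l \<le> N" using top_ge * unfolding M_def N_def by blast+
        moreover have "k < M \<or> l < N" using False calculation by auto
        ultimately have "k + l < M + N" by (meson add_less_le_mono add_le_less_mono)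
        then show ?thesis using True by simp
      next
        case f: False
        then show ?thesis using False by (auto simp: when_def cong_0_iff)
      qed
    qed simp
  qed
  also have "(\<Sum>k\<in>keys f. \<Sum>l\<in>keys g. (if k = M \<and> l = N then lookup f k * lookup g l else 0)) = lookup f M * lookup g N"
  proof -
    have "(\<Sum>l\<in>keys g. (if k = M \<and> l = N then lookup f k * lookup g l else 0)) = (if k = M then lookup f k * lookup g N else 0)" for k
      by (cases "k = M") (simp_all add: in_keys_iff)
    then show ?thesis by (simp add: in_keys_iff)
  qed
  finally have "[lookup (f * g) (M + N) = lookup f M * lookup g N] (mod int p)" .
  moreover have "int p dvd lookup (f * g) (M + N)" using d by (simp add: of_nat_dvd_zpoly_iff)
  ultimately have "int p dvd lookup f M * lookup g N" by (simp add: cong_dvd_iff)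
  then have "int p dvd lookup f M \<or> int p dvd lookup g N"
    using p by (simp add: prime_dvd_mult_iff)
  then show False using top * unfolding M_def N_def by blast
qed

section \<open>The generic trilinear form and its quadratic radical map\<close>

text \<open>
  The coefficients are paired with the \<open>3 \<times> 3\<close> minors of \<open>x, y, z\<close>. In this way the form is alternating
  over every commutative ring, and the coefficients can be independent variables.
\<close>

definition tri_form :: "(8 \<Rightarrow> 8 \<Rightarrow> 8 \<Rightarrow> 'a::comm_ring_1) \<Rightarrow> 'a^8 \<Rightarrow> 'a^8 \<Rightarrow> 'a^8 \<Rightarrow> 'a" where
  "tri_form b x y z = (\<Sum>i\<in>UNIV. \<Sum>j\<in>UNIV. \<Sum>k\<in>UNIV. b i j k *
     (x $ i * (y $ j * z $ k - y $ k * z $ j) - x $ j * (y $ i * z $ k - y $ k * z $ i)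
       + x $ k * (y $ i * z $ j - y $ j * z $ i)))"

lemma tri_form_add1: "tri_form b (x + x') y z = tri_form b x y z + tri_form b x' y z"
  and tri_form_add2: "tri_form b x (y + y') z = tri_form b x y z + tri_form b x y' z"
  and tri_form_add3: "tri_form b x y (z + z') = tri_form b x y z + tri_form b x y z'"
  by (simp_all add: tri_form_def sum.distrib[symmetric] algebra_simps)

lemma tri_form_scale1: "tri_form b (c *s x) y z = c * tri_form b x y z"
  and tri_form_scale2: "tri_form b x (c *s y) z = c * tri_form b x y z"
  and tri_form_scale3: "tri_form b x y (c *s z) = c * tri_form b x y z"
  by (simp_all add: tri_form_def sum_distrib_left algebra_simps)

lemma tri_form_swap12: "tri_form b y x z = - tri_form b x y z"
  and tri_form_swap23: "tri_form b x z y = - tri_form b x y z"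
  by (simp_all add: tri_form_def sum_negf[symmetric] algebra_simps)

lemma tri_form_same12 [simp]: "tri_form b x x z = 0"
  and tri_form_same23 [simp]: "tri_form b x z z = 0"
  and tri_form_same13 [simp]: "tri_form b x z x = 0"
  by (simp_all add: tri_form_def algebra_simps)

lemma tri_form_diff1: "tri_form b (x - x') y z = tri_form b x y z - tri_form b x' y z"
  using tri_form_add1[of b "x - x'" x'] by simp
lemma tri_form_diff2: "tri_form b x (y - y') z = tri_form b x y z - tri_form b x y' z"
  using tri_form_add2[of b x "y - y'" y'] by simp
lemma tri_form_diff3: "tri_form b x y (z - z') = tri_form b x y z - tri_form b x y z'"
  using tri_form_add3[of b x y "z - z'" z'] by simp

lemmas tri_form_linear = tri_form_add1 tri_form_add2 tri_form_add3 tri_form_scale1 tri_form_scale2 tri_form_scale3 tri_form_diff1 tri_form_diff2 tri_form_diff3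

lemma linear_expand:
  fixes l :: "'a::comm_ring_1^'n \<Rightarrow> 'a"
  assumes "\<And>x y. l (x + y) = l x + l y" "\<And>c x. l (c *s x) = c * l x"
  shows "l y = (\<Sum>j\<in>UNIV. y $ j * l (axis j 1))"
proof -
  have z: "l 0 = 0" using assms(2)[of 0 0] by simp
  have "l (\<Sum>j\<in>A. f j) = (\<Sum>j\<in>A. l (f j))" if "finite A" for A :: "'n set" and f
    using that by induction (simp_all add: z assms(1))
  from this[of UNIV "\<lambda>j. y $ j *s axis j 1"] show ?thesis
    by (simp add: basis_expansion assms(2))
qed

lemma tri_form_expand2: "tri_form b x y z = (\<Sum>j\<in>UNIV. y $ j * tri_form b x (axis j 1) z)"
  by (rule linear_expand) (simp_all add: tri_form_linear)

lemma tri_form_expand1: "tri_form b x y z = (\<Sum>j\<in>UNIV. x $ j * tri_form b (axis j 1) y z)"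
  by (rule linear_expand[of "\<lambda>x. tri_form b x y z"]) (simp_all add: tri_form_linear)

lemma tri_form_expand3: "tri_form b x y z = (\<Sum>j\<in>UNIV. z $ j * tri_form b x y (axis j 1))"
  by (rule linear_expand) (simp_all add: tri_form_linear)

lemma tri_form_axis:
  "tri_form b (axis p 1) (axis q 1) (axis r 1) =
     b p q r + b q r p + b r p q - b p r q - b q p r - b r q p"
proof -
  have d: "(\<Sum>i\<in>UNIV. \<Sum>j\<in>UNIV. \<Sum>k\<in>UNIV. b i j k * (axis p 1 $ i * (axis q 1 $ j * axis r 1 $ k))) = b p q r"
    for p q r :: 8
    by (simp add: axis_def if_distrib[of "\<lambda>x. _ * x"] if_distrib[of "\<lambda>x. x * _"] cong: if_cong)
  show ?thesis
    unfolding tri_form_def using d[of p q r] d[of q r p] d[of r p q] d[of p r q] d[of q p r] d[of r q p]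
    by (simp add: algebra_simps sum.distrib sum_subtractf)
qed

definition form_matrix :: "(8 \<Rightarrow> 8 \<Rightarrow> 8 \<Rightarrow> 'a::comm_ring_1) \<Rightarrow> 'a^8 \<Rightarrow> 8 \<Rightarrow> 8 \<Rightarrow> 'a" where
  "form_matrix b u i j = tri_form b u (axis i 1) (axis j 1)"

lemma alternating_form_matrix: "alternating_matrix (form_matrix b u)"
  unfolding alternating_matrix_def form_matrix_def using tri_form_swap23 by auto

lemma form_matrix_kernel: "(\<Sum>j\<in>UNIV. form_matrix b u j i * u $ j) = 0"
  using tri_form_expand2[of b u u "axis i 1"] by (simp add: form_matrix_def mult.commute)

lemma evalp_tri: "evalp x (tri_form b p q r) = tri_form (\<lambda>i j k. evalp x (b i j k)) (\<chi> i. evalp x (p $ i)) (\<chi> i. evalp x (q $ i)) (\<chi> i. evalp x (r $ i))"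
  by (simp add: tri_form_def)

text \<open>
  Lists of other lengths name no coordinate or coefficient and get the value 0.
\<close>

definition assign :: "(8 \<Rightarrow> 8 \<Rightarrow> 8 \<Rightarrow> 'a::comm_ring_1) \<Rightarrow> 'a^8 \<Rightarrow> 8 list \<Rightarrow> 'a" where
  "assign b u n = (case n of [i] \<Rightarrow> u $ i | [i, j, k] \<Rightarrow> b i j k | _ \<Rightarrow> 0)"

lemma assign_simps [simp]: "assign b u [i] = u $ i" "assign b u [i, j, k] = b i j k"
  by (simp_all add: assign_def)

definition gen_coeff :: "8 \<Rightarrow> 8 \<Rightarrow> 8 \<Rightarrow> zpoly" where "gen_coeff i j k = Var [i, j, k]"
definition gen_vec :: "zpoly^8" where "gen_vec = (\<chi> i. Var [i])"

lemma gen_vec_nth [simp]: "gen_vec $ i = Var [i]" by (simp add: gen_vec_def)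

lemma evalp_gen_form_matrix: "evalp (assign b u) (form_matrix gen_coeff gen_vec i j) = form_matrix b u i j"
proof -
  have "(\<chi> k. evalp (assign b u) (axis i 1 $ k)) = axis i 1" for i :: 8
    by (simp add: vec_eq_iff axis_def)
  moreover have "(\<chi> i. evalp (assign b u) (gen_vec $ i)) = u" by (simp add: gen_vec_def vec_eq_iff)
  ultimately show ?thesis by (simp add: form_matrix_def evalp_tri gen_coeff_def)
qed

lemma evalp_gen_cofactor: "evalp (assign b u) (pf_cofactor (form_matrix gen_coeff gen_vec) i j) = pf_cofactor (form_matrix b u) i j"
  using pf_cofactor_hom[of "evalp (assign b u)" "form_matrix gen_coeff gen_vec" i j] by (simp add: evalp_gen_form_matrix)

lemma homogeneous_gen_form_matrix: "homogeneous 1 (form_matrix gen_coeff gen_vec i j)"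
proof -
  have c: "homogeneous 0 (axis i 1 $ k)" for i k :: 8 using homogeneous_of_int[of 1] by (simp add: axis_def)
  have v: "homogeneous 1 (gen_vec $ i)" for i by (simp add: gen_vec_def)
  have "homogeneous 1 (gen_coeff p q r * (gen_vec $ p' * (axis i 1 $ q' * axis j 1 $ r' - axis i 1 $ r'' * axis j 1 $ q'')
     - gen_vec $ q''' * (axis i 1 $ s * axis j 1 $ s' - axis i 1 $ t * axis j 1 $ t')
     + gen_vec $ p''' * (axis i 1 $ s'' * axis j 1 $ s''' - axis i 1 $ t'' * axis j 1 $ t''')))"
    for p q r p' q' r' r'' q'' q''' s s' t t' p''' s'' s''' t'' t'''
    by (rule homogeneous_mult[of 0 _ 1], simp add: gen_coeff_def,
      intro homogeneous_add homogeneous_diff homogeneous_mult[of 1 _ 0 _ 1] homogeneous_mult[of 0 _ 0 _ 0] v c) auto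
  then show ?thesis unfolding form_matrix_def tri_form_def by (intro homogeneous_sum) blast
qed

lemma homogeneous_pf6:
  assumes "\<And>a c. homogeneous 1 (m a c)" shows "homogeneous 3 (pf6 m)"
  unfolding pf6_def
  by (intro homogeneous_add homogeneous_diff homogeneous_mult[of 1 _ 2 _ 3] homogeneous_mult[of 1 _ 1 _ 2] assms) simp_all

lemma homogeneous_cofactor: "homogeneous 3 (pf_cofactor (form_matrix gen_coeff gen_vec) i j)"
  unfolding pf_cofactor_def Let_def by (auto intro!: homogeneous_const_mult homogeneous_pf6 homogeneous_gen_form_matrix)

text \<open>
  Put the variable \<open>v\<^sub>0\<close> to zero. The relation for the indices \<open>0, i, j\<close> becomes
  \<open>v\<^sub>i P\<^sub>0\<^sub>j = v\<^sub>j P\<^sub>0\<^sub>i\<close>, whence \<open>P\<^sub>0\<^sub>j = v\<^sub>j g\<close> modulo \<open>v\<^sub>0\<close> with the same \<open>g\<close> for all \<open>j\<close>. So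
  \<open>w\<^sub>0 = - g\<close>, and \<open>w\<^sub>j\<close> is the quotient of \<open>P\<^sub>0\<^sub>j - v\<^sub>j g\<close> by \<open>v\<^sub>0\<close>. The relation gives the other \<open>P\<^sub>i\<^sub>j\<close>.
\<close>

lemma koszul_division:
  fixes P :: "8 \<Rightarrow> 8 \<Rightarrow> zpoly"
  assumes anti: "\<And>i j. P j i = - P i j" and same: "\<And>i. P i i = 0"
    and rel: "\<And>i j l. Var [l] * P i j + Var [i] * P j l + Var [j] * P l i = 0"
    and hom: "\<And>i j. homogeneous (Suc d) (P i j)"
  shows "\<exists>w. (\<forall>j. homogeneous d (w j)) \<and> (\<forall>i j. P i j = Var [i] * w j - Var [j] * w i)"
proof -
  let ?s = "set_zero [0]"
  have s_mult: "set_zero n (x * y) = set_zero n x * set_zero n y" and s_0: "set_zero n 0 = 0" for n x y by (simp_all add: set_zero_def)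
  have s_Var: "set_zero n (Var k) = (if k = n then 0 else Var k)" for n k by (simp add: set_zero_def)
  have rel0: "Var [i] * P 0 j - Var [j] * P 0 i = Var [0] * P i j" for i j
  proof -
    have "Var [0] * P i j + Var [i] * (- P 0 j) + Var [j] * P 0 i = 0"
      using rel[where l = 0 and i = i and j = j] unfolding anti[where i = 0 and j = j] .
    then show ?thesis by Groebner_Basis.algebra
  qed
  have cross: "Var [i] * ?s (P 0 j) = Var [j] * ?s (P 0 i)" if "i \<noteq> 0" "j \<noteq> 0" for i j
  proof -
    have "Var [i] * P 0 j = Var [j] * P 0 i + Var [0] * P i j"
      using rel0[of i j] by (simp add: algebra_simps)
    then have "?s (Var [i] * P 0 j) = ?s (Var [j] * P 0 i + Var [0] * P i j)" by simp
    then show ?thesis using that by (simp add: set_zero_def)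
  qed
  have "\<exists>g. ?s (P 0 j) = Var [j] * g" if j: "j \<noteq> 0" for j
  proof -
    obtain i :: 8 where i: "i \<noteq> 0" "i \<noteq> j"
    proof (cases "j = 1")
      case True then show ?thesis using that[of 2] by simp
    next
      case False then show ?thesis using that[of 1] by simp
    qed
    have "set_zero [j] (Var [i] * ?s (P 0 j)) = set_zero [j] (Var [j] * ?s (P 0 i))"
      by (simp only: cross[OF i(1) j])
    then have "Var [i] * set_zero [j] (?s (P 0 j)) = 0" using i by (simp add: s_mult s_Var)
    then have "set_zero [j] (?s (P 0 j)) = 0" by simp
    then have "Var [j] dvd ?s (P 0 j)" using Var_dvd_diff_set_zero[of "[j]" "?s (P 0 j)"] by simp
    then show ?thesis by (elim dvdE) blast
  qed
  then obtain g where g: "\<And>j. j \<noteq> 0 \<Longrightarrow> ?s (P 0 j) = Var [j] * g j" by metis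
  have g_eq: "g j = g 1" if j: "j \<noteq> 0" for j
  proof -
    have "(Var [1] * Var [j]) * g j = (Var [1] * Var [j]) * g 1"
      using cross[of 1 j] g[of 1] g[OF j] j by (simp add: algebra_simps)
    then show ?thesis by (simp only: mult_cancel_left) simp
  qed
  have "\<exists>h. P 0 j - ?s (P 0 j) = Var [0] * h" for j
    using Var_dvd_diff_set_zero[of "[0]" "P 0 j"] by (elim dvdE) blast
  then obtain h where h: "\<And>j. P 0 j - ?s (P 0 j) = Var [0] * h j" by metis
  define w where "w j = (if j = 0 then - g 1 else h j)" for j
  have P0: "P 0 j = Var [0] * w j - Var [j] * w 0" for j
  proof (cases "j = 0")
    case False
    then show ?thesis using h[of j] g[OF False] g_eq[OF False] by (simp add: w_def algebra_simps)
  qed (simp add: same)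
  have "P i j = Var [i] * w j - Var [j] * w i" for i j
  proof -
    have "Var [0] * P i j = Var [i] * P 0 j - Var [j] * P 0 i"
      by (rule rel0[symmetric])
    also have "\<dots> = Var [0] * (Var [i] * w j - Var [j] * w i)"
      unfolding P0 by (simp add: algebra_simps)
    finally show ?thesis by (simp only: mult_cancel_left) simp
  qed
  moreover have "homogeneous d (w j)" for j
  proof (cases "j = 0")
    case True
    have "homogeneous (Suc d) (Var [1] * g 1)" using homogeneous_set_zero[OF hom, of "[0]" 0 1] g[of 1] by simp
    then show ?thesis using homogeneous_Var_mult_cancel True by (auto simp: w_def)
  next
    case False
    have "homogeneous (Suc d) (Var [0] * h j)" using homogeneous_diff[OF hom homogeneous_set_zero[OF hom], of 0 j "[0]" 0 j] h[of j] by simp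
    then show ?thesis using homogeneous_Var_mult_cancel False by (auto simp: w_def)
  qed
  ultimately show ?thesis by blast
qed

lemma gen_radical_exists:
  "\<exists>w. (\<forall>j. homogeneous 2 (w j)) \<and> (\<forall>i j. pf_cofactor (form_matrix gen_coeff gen_vec) i j = Var [i] * w j - Var [j] * w i)"
proof (rule koszul_division)
  show "Var [l] * pf_cofactor (form_matrix gen_coeff gen_vec) i j + Var [i] * pf_cofactor (form_matrix gen_coeff gen_vec) j l +
      Var [j] * pf_cofactor (form_matrix gen_coeff gen_vec) l i = 0" for i j l
    using pf_cofactor_wedge[OF alternating_form_matrix form_matrix_kernel, of gen_vec l gen_coeff i j] by (simp add: gen_vec_def)
  show "homogeneous (Suc 2) (pf_cofactor (form_matrix gen_coeff gen_vec) i j)" for i j using homogeneous_cofactor[of i j] by (simp add: numeral_3_eq_3 numeral_2_eq_2)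
  show "pf_cofactor (form_matrix gen_coeff gen_vec) j i = - pf_cofactor (form_matrix gen_coeff gen_vec) i j" for i j
    by (rule pf_cofactor_antisym[OF alternating_form_matrix])
qed simp

definition gen_radical :: "8 \<Rightarrow> zpoly" where
  "gen_radical = (SOME w. (\<forall>j. homogeneous 2 (w j)) \<and> (\<forall>i j. pf_cofactor (form_matrix gen_coeff gen_vec) i j = Var [i] * w j - Var [j] * w i))"

lemma gen_radical: "homogeneous 2 (gen_radical j)" "pf_cofactor (form_matrix gen_coeff gen_vec) i j = Var [i] * gen_radical j - Var [j] * gen_radical i"
  using someI_ex[OF gen_radical_exists] unfolding gen_radical_def by blast+

text \<open>
  This is the quadratic map \<open>w\<close> with \<open>P(u) = u \<and> w(u)\<close>, for the form with coefficients \<open>b\<close>.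
\<close>

definition radical_vec :: "(8 \<Rightarrow> 8 \<Rightarrow> 8 \<Rightarrow> 'a::comm_ring_1) \<Rightarrow> 'a^8 \<Rightarrow> 'a^8" where
  "radical_vec b u = (\<chi> j. evalp (assign b u) (gen_radical j))"

lemma cofactor_radical_vec: "pf_cofactor (form_matrix b u) i j = u $ i * radical_vec b u $ j - u $ j * radical_vec b u $ i"
  using evalp_gen_cofactor[of b u i j] by (simp add: gen_radical(2) radical_vec_def)

text \<open>
  For the matrix \<open>M\<close> of the form, \<open>M P\<close> vanishes off the diagonal and \<open>M v = 0\<close>. With
  \<open>P\<^sub>i\<^sub>j = v\<^sub>i w\<^sub>j - v\<^sub>j w\<^sub>i\<close> this leaves \<open>v\<^sub>i (M w)\<^sub>k = 0\<close> for any \<open>i \<noteq> k\<close>, and the variable \<open>v\<^sub>i\<close> can be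
  cancelled.
\<close>

lemma gen_form_matrix_radical: "(\<Sum>j\<in>UNIV. form_matrix gen_coeff gen_vec k j * gen_radical j) = 0"
proof -
  obtain i :: 8 where i: "i \<noteq> k" by (metis zero_neq_one)
  have "(\<Sum>j\<in>UNIV. form_matrix gen_coeff gen_vec k j * pf_cofactor (form_matrix gen_coeff gen_vec) i j) = 0"
    by (rule pf_cofactor_mult[OF alternating_form_matrix]) (use i in simp)
  moreover have "(\<Sum>j\<in>UNIV. form_matrix gen_coeff gen_vec k j * pf_cofactor (form_matrix gen_coeff gen_vec) i j) =
      Var [i] * (\<Sum>j\<in>UNIV. form_matrix gen_coeff gen_vec k j * gen_radical j) - gen_radical i * (\<Sum>j\<in>UNIV. form_matrix gen_coeff gen_vec k j * gen_vec $ j)"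
    by (simp add: gen_radical(2) algebra_simps sum_subtractf sum_distrib_left)
  moreover have "(\<Sum>j\<in>UNIV. form_matrix gen_coeff gen_vec k j * gen_vec $ j) = 0"
    using tri_form_expand3[of gen_coeff gen_vec "axis k 1" gen_vec] by (simp add: form_matrix_def mult.commute)
  ultimately show ?thesis by simp
qed

lemma tri_form_radical_vec: "tri_form b u (radical_vec b u) y = 0"
proof -
  have "tri_form b u (axis k 1) (radical_vec b u) = 0" for k
  proof -
    have "evalp (assign b u) (\<Sum>j\<in>UNIV. form_matrix gen_coeff gen_vec k j * gen_radical j) = 0" by (simp only: gen_form_matrix_radical evalp_0)
    then have "(\<Sum>j\<in>UNIV. form_matrix b u k j * radical_vec b u $ j) = 0"
      by (simp add: evalp_gen_form_matrix radical_vec_def)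
    then show ?thesis
      by (subst tri_form_expand3) (simp add: form_matrix_def mult.commute)
  qed
  then have "tri_form b u y (radical_vec b u) = 0" by (subst tri_form_expand2) simp
  then show ?thesis using tri_form_swap23[of b u "radical_vec b u" y] by simp
qed

lemma evalp_homogeneous_0: "homogeneous 0 f \<Longrightarrow> evalp (assign b u) f = evalp (assign b u') f"
proof (rule evalp_cong_keys)
  fix m n assume f: "homogeneous 0 f" "m \<in> keys f" "n \<in> keys m"
  then have "vec_degree m = 0" by (simp add: homogeneous_def)
  then have "lookup m [i] = 0" for i by (simp add: vec_degree_def)
  then have "n \<noteq> [i]" for i using f(3) by (metis in_keys_iff)
  then show "assign b u n = assign b u' n" by (auto simp: assign_def split: list.splits)
qed

lemma homogeneous_quadratic_form:
  assumes "homogeneous 2 f"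
  shows "\<exists>C. (\<forall>k l. homogeneous 0 (C k l)) \<and> f = (\<Sum>k\<in>UNIV. \<Sum>l\<in>UNIV. C k l * Var [k] * Var [l])"
proof -
  obtain g where g: "\<forall>i. homogeneous 1 (g i)" "f = (\<Sum>i\<in>UNIV. Var [i] * g i)"
    using homogeneous_Suc_splits[of 1 f] assms by (auto simp: splits_def numeral_2_eq_2)
  have "\<forall>i. \<exists>h. (\<forall>j. homogeneous 0 (h j)) \<and> g i = (\<Sum>j\<in>UNIV. Var [j] * h j)"
    using homogeneous_Suc_splits[of 0] g(1) by (auto simp: splits_def)
  from choice[OF this] obtain h
    where h: "\<forall>i. (\<forall>j. homogeneous 0 (h i j)) \<and> g i = (\<Sum>j\<in>UNIV. Var [j] * h i j)" by (elim exE)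
  show ?thesis by (rule exI[of _ h]) (use h g(2) in \<open>simp add: sum_distrib_left algebra_simps\<close>)
qed

lemma homogeneous_cubic_form:
  assumes "homogeneous 3 f"
  shows "\<exists>C. (\<forall>i k l. homogeneous 0 (C i k l)) \<and> f = (\<Sum>i\<in>UNIV. \<Sum>k\<in>UNIV. \<Sum>l\<in>UNIV. C i k l * Var [i] * Var [k] * Var [l])"
proof -
  obtain g where g: "\<forall>i. homogeneous 2 (g i)" "f = (\<Sum>i\<in>UNIV. Var [i] * g i)"
    using homogeneous_Suc_splits[of 2 f] assms by (auto simp: splits_def)
  have "\<forall>i. \<exists>C. (\<forall>k l. homogeneous 0 (C k l)) \<and> g i = (\<Sum>k\<in>UNIV. \<Sum>l\<in>UNIV. C k l * Var [k] * Var [l])"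
    using homogeneous_quadratic_form g(1) by blast
  from choice[OF this] obtain h
    where h: "\<forall>i. (\<forall>k l. homogeneous 0 (h i k l)) \<and> g i = (\<Sum>k\<in>UNIV. \<Sum>l\<in>UNIV. h i k l * Var [k] * Var [l])"
    by (elim exE)
  show ?thesis by (rule exI[of _ h]) (use h g(2) in \<open>simp add: sum_distrib_left algebra_simps\<close>)
qed

text \<open>
  Contracting this form with the first basis vector gives the standard symplectic form on the
  coordinates \<open>2, \<dots>, 7\<close>.
\<close>

definition split_coeff :: "8 \<Rightarrow> 8 \<Rightarrow> 8 \<Rightarrow> int" where
  "split_coeff i j k = (if i = 0 \<and> ((j = 2 \<and> k = 3) \<or> (j = 4 \<and> k = 5) \<or> (j = 6 \<and> k = 7)) then 1 else 0)"

lemma example_cofactor: "pf_cofactor (form_matrix split_coeff (axis 0 1)) 0 1 = 1"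
  using pf_cofactor_perm[OF alternating_form_matrix permutes_id, of split_coeff "axis 0 1"]
  by (simp add: pf6_def form_matrix_def tri_form_axis split_coeff_def)

text \<open>
  Some integral specialisation has the value 1.
\<close>

lemma gen_cofactor_primitive:
  assumes "Factorial_Ring.prime (p::nat)" shows "\<not> of_nat p dvd pf_cofactor (form_matrix gen_coeff gen_vec) 0 1"
proof
  assume "of_nat p dvd pf_cofactor (form_matrix gen_coeff gen_vec) 0 1"
  then obtain g where "pf_cofactor (form_matrix gen_coeff gen_vec) 0 1 = of_nat p * g" by blast
  then have "evalp (assign split_coeff (axis 0 1)) (pf_cofactor (form_matrix gen_coeff gen_vec) 0 1) = int p * evalp (assign split_coeff (axis 0 1)) g" by simp
  then have "int p * evalp (assign split_coeff (axis 0 1)) g = 1" by (simp add: evalp_gen_cofactor example_cofactor)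
  then have "int p dvd 1" by (metis dvd_triv_left)
  then show False using assms by simp
qed

section \<open>Polarisation and pencils of alternating matrices\<close>

text \<open>
  The derivative at \<open>u\<close> in direction \<open>x\<close> of the quadratic map with coefficients \<open>C\<close>.
\<close>

definition polar :: "(8 \<Rightarrow> 8 \<Rightarrow> 8 \<Rightarrow> 'a::comm_ring_1) \<Rightarrow> 'a^8 \<Rightarrow> 'a^8 \<Rightarrow> 'a^8" where
  "polar C u x = (\<chi> j. \<Sum>k\<in>UNIV. \<Sum>l\<in>UNIV. C j k l * (u $ k * x $ l + x $ k * u $ l))"

definition polar_mat :: "(8 \<Rightarrow> 8 \<Rightarrow> 8 \<Rightarrow> 'a::comm_ring_1) \<Rightarrow> 'a^8 \<Rightarrow> 8 \<Rightarrow> 8 \<Rightarrow> 'a" where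
  "polar_mat C u j k = (\<Sum>l\<in>UNIV. (C j k l + C j l k) * u $ l)"

lemma polar_add1: "polar C (u + u') x = polar C u x + polar C u' x"
  and polar_add2: "polar C u (x + x') = polar C u x + polar C u x'"
  by (simp_all add: polar_def vec_eq_iff sum.distrib[symmetric] algebra_simps)

lemma polar_scale1: "polar C (c *s u) x = c *s polar C u x"
  and polar_scale2: "polar C u (c *s x) = c *s polar C u x"
  by (simp_all add: polar_def vec_eq_iff sum_distrib_left algebra_simps)

lemma polar_sym: "polar C u x = polar C x u"
  by (simp add: polar_def vec_eq_iff algebra_simps)

lemma polar_diff2: "polar C u (x - x') = polar C u x - polar C u x'"
  using polar_add2[of C u "x - x'" x'] by simp

lemmas polar_linear = polar_add1 polar_add2 polar_scale1 polar_scale2 polar_diff2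

lemma polar_axis: "polar C u (axis k 1) $ j = polar_mat C u j k"
proof -
  have "(\<Sum>a\<in>UNIV. \<Sum>l\<in>UNIV. C j a l * (u $ a * axis k 1 $ l + axis k 1 $ a * u $ l)) =
     (\<Sum>a\<in>UNIV. C j a k * u $ a) + (\<Sum>l\<in>UNIV. C j k l * u $ l)"
    by (simp add: axis_def distrib_left sum.distrib if_distrib[of "\<lambda>x. _ * x"] if_distrib[of "\<lambda>x. x * _"]
      sum.swap[of "\<lambda>a l. if a = k then _ a l else _"] cong: if_cong)
  then show ?thesis by (simp add: polar_def polar_mat_def sum.distrib[symmetric] algebra_simps)
qed

definition row_replace :: "8 \<Rightarrow> (8 \<Rightarrow> 'a::comm_ring_1) \<Rightarrow> (8 \<Rightarrow> 8 \<Rightarrow> 'a) \<Rightarrow> 8 \<Rightarrow> 8 \<Rightarrow> 'a" where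
  "row_replace s r m a c = (if a = s then r c else if c = s then - r a else m a c)"

text \<open>
  Cramer's rule for Pfaffians: replacing row \<open>s\<close> by a combination of all rows multiplies the Pfaffian by
  the coefficient of row \<open>s\<close>.
\<close>

lemma pf6_row_comb:
  assumes m: "alternating_matrix m" and s: "s \<in> slots"
    and r: "\<And>c. c \<in> slots \<Longrightarrow> r c = (\<Sum>j\<in>slots. y j * m j c)"
  shows "pf6 (row_replace s r m) = y s * pf6 m"
proof -
  have sk: "m 3 2 = - m 2 3" "m 4 2 = - m 2 4" "m 5 2 = - m 2 5" "m 6 2 = - m 2 6" "m 7 2 = - m 2 7"
    "m 4 3 = - m 3 4" "m 5 3 = - m 3 5" "m 6 3 = - m 3 6" "m 7 3 = - m 3 7"
    "m 5 4 = - m 4 5" "m 6 4 = - m 4 6" "m 7 4 = - m 4 7" "m 6 5 = - m 5 6" "m 7 5 = - m 5 7" "m 7 6 = - m 6 7"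
    "m 2 2 = 0" "m 3 3 = 0" "m 4 4 = 0" "m 5 5 = 0" "m 6 6 = 0" "m 7 7 = 0"
    using m unfolding alternating_matrix_def by blast+
  show ?thesis using s
    by (elim insertE emptyE; simp add: pf6_def row_replace_def r sk algebra_simps)
qed

text \<open>
  Twice the derivative of the Pfaffian at \<open>m\<close> in direction \<open>x\<close>: each entry of \<open>x\<close> is counted once for
  its row and once for its column.
\<close>

definition pf6_first :: "(8 \<Rightarrow> 8 \<Rightarrow> 'a::comm_ring_1) \<Rightarrow> (8 \<Rightarrow> 8 \<Rightarrow> 'a) \<Rightarrow> 'a" where
  "pf6_first m x = (\<Sum>s\<in>slots. pf6 (row_replace s (x s) m))"

lemma pf6_pencil:
  assumes x: "alternating_matrix x"  "alternating_matrix m"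
  shows "2 * pf6 (\<lambda>a c. m a c + t * x a c) =
     2 * pf6 m + t * pf6_first m x + t^2 * pf6_first x m + t^3 * (2 * pf6 x)"
proof -
  have skx: "x 3 2 = - x 2 3" "x 4 2 = - x 2 4" "x 5 2 = - x 2 5" "x 6 2 = - x 2 6" "x 7 2 = - x 2 7"
    "x 4 3 = - x 3 4" "x 5 3 = - x 3 5" "x 6 3 = - x 3 6" "x 7 3 = - x 3 7"
    "x 5 4 = - x 4 5" "x 6 4 = - x 4 6" "x 7 4 = - x 4 7" "x 6 5 = - x 5 6" "x 7 5 = - x 5 7" "x 7 6 = - x 6 7"
    using x unfolding alternating_matrix_def by blast+
  have skm: "m 3 2 = - m 2 3" "m 4 2 = - m 2 4" "m 5 2 = - m 2 5" "m 6 2 = - m 2 6" "m 7 2 = - m 2 7"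
    "m 4 3 = - m 3 4" "m 5 3 = - m 3 5" "m 6 3 = - m 3 6" "m 7 3 = - m 3 7"
    "m 5 4 = - m 4 5" "m 6 4 = - m 4 6" "m 7 4 = - m 4 7" "m 6 5 = - m 5 6" "m 7 5 = - m 5 7" "m 7 6 = - m 6 7"
    using x unfolding alternating_matrix_def by blast+
  have first: "pf6_first m x = 2 * (
     x 2 3 * (m 4 5 * m 6 7 - m 4 6 * m 5 7 + m 4 7 * m 5 6)
   - x 2 4 * (m 3 5 * m 6 7 - m 3 6 * m 5 7 + m 3 7 * m 5 6)
   + x 2 5 * (m 3 4 * m 6 7 - m 3 6 * m 4 7 + m 3 7 * m 4 6)
   - x 2 6 * (m 3 4 * m 5 7 - m 3 5 * m 4 7 + m 3 7 * m 4 5)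
   + x 2 7 * (m 3 4 * m 5 6 - m 3 5 * m 4 6 + m 3 6 * m 4 5)
   + x 4 5 * (m 2 3 * m 6 7 - m 2 6 * m 3 7 + m 2 7 * m 3 6)
   - x 4 6 * (m 2 3 * m 5 7 - m 2 5 * m 3 7 + m 2 7 * m 3 5)
   + x 4 7 * (m 2 3 * m 5 6 - m 2 5 * m 3 6 + m 2 6 * m 3 5)
   + x 5 6 * (m 2 3 * m 4 7 - m 2 4 * m 3 7 + m 2 7 * m 3 4)
   - x 5 7 * (m 2 3 * m 4 6 - m 2 4 * m 3 6 + m 2 6 * m 3 4)
   + x 6 7 * (m 2 3 * m 4 5 - m 2 4 * m 3 5 + m 2 5 * m 3 4)
   - x 3 5 * (m 2 4 * m 6 7 - m 2 6 * m 4 7 + m 2 7 * m 4 6)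
   + x 3 6 * (m 2 4 * m 5 7 - m 2 5 * m 4 7 + m 2 7 * m 4 5)
   - x 3 7 * (m 2 4 * m 5 6 - m 2 5 * m 4 6 + m 2 6 * m 4 5)
   + x 3 4 * (m 2 5 * m 6 7 - m 2 6 * m 5 7 + m 2 7 * m 5 6))"
    if "x 3 2 = - x 2 3" "x 4 2 = - x 2 4" "x 5 2 = - x 2 5" "x 6 2 = - x 2 6" "x 7 2 = - x 2 7"
    "x 4 3 = - x 3 4" "x 5 3 = - x 3 5" "x 6 3 = - x 3 6" "x 7 3 = - x 3 7"
    "x 5 4 = - x 4 5" "x 6 4 = - x 4 6" "x 7 4 = - x 4 7" "x 6 5 = - x 5 6" "x 7 5 = - x 5 7" "x 7 6 = - x 6 7"
    for m x :: "8 \<Rightarrow> 8 \<Rightarrow> 'a"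
    using that by (simp add: pf6_first_def pf6_def row_replace_def algebra_simps)
  show ?thesis unfolding first[OF skx] first[OF skm] pf6_def
    by (simp add: algebra_simps power2_eq_square power3_eq_cube)
qed

section \<open>The cubic covariant over a field\<close>

text \<open>
  The pointwise part of the argument over a field. The vector \<open>w u\<close> lies in the radical of the
  contraction with \<open>u\<close>, and the cofactor with indices 0 and 1 is the corresponding entry of \<open>u \<and> w u\<close>.
\<close>

locale quadratic_radical =
  fixes b :: "8 \<Rightarrow> 8 \<Rightarrow> 8 \<Rightarrow> 'f::field" and C :: "8 \<Rightarrow> 8 \<Rightarrow> 8 \<Rightarrow> 'f" and w :: "'f^8 \<Rightarrow> 'f^8"
  assumes w_coord: "\<And>u j. w u $ j = (\<Sum>k\<in>UNIV. \<Sum>l\<in>UNIV. C j k l * u $ k * u $ l)"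
    and w_rad: "\<And>u y. tri_form b u (w u) y = 0"
    and w_pf: "\<And>u. pf6 (form_matrix b u) = u $ 0 * w u $ 1 - u $ 1 * w u $ 0"
    and two: "(2 :: 'f) \<noteq> 0" and three: "(3 :: 'f) \<noteq> 0"
begin

abbreviation B :: "'f^8 \<Rightarrow> 'f^8 \<Rightarrow> 'f^8" where "B \<equiv> polar C"

definition \<Delta> :: "'f^8 \<Rightarrow> 'f" where "\<Delta> u = u $ 0 * w u $ 1 - u $ 1 * w u $ 0"

lemma w_add: "w (u + x) = w u + B u x + w x"
  by (simp add: vec_eq_iff w_coord polar_def sum.distrib[symmetric] algebra_simps)

lemma w_scale: "w (c *s u) = c^2 *s w u"
  by (simp add: vec_eq_iff w_coord sum_distrib_left algebra_simps power2_eq_square)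

lemma polar_self: "B u u = 2 *s w u"
  by (simp add: vec_eq_iff w_coord polar_def sum_distrib_left algebra_simps)

text \<open>
  The terms of degree one and two in \<open>t\<close> of the identity \<open>w_rad\<close> at the vector \<open>u + t x\<close>.
\<close>

lemma rad_polar: "tri_form b x (w u) y + tri_form b u (B u x) y = 0"
  and rad_polar': "tri_form b u (w x) y + tri_form b x (B u x) y = 0"
proof -
  let ?a = "tri_form b x (w u) y + tri_form b u (B u x) y" and ?c = "tri_form b u (w x) y + tri_form b x (B u x) y"
  have eq: "t * ?a + t^2 * ?c = 0" for t
  proof -
    have "tri_form b (u + t *s x) (w (u + t *s x)) y =
        tri_form b u (w u) y + t * ?a + t^2 * ?c + t^3 * tri_form b x (w x) y"
      by (simp add: w_add w_scale tri_form_linear polar_linear algebra_simps power2_eq_square power3_eq_cube)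
    then show ?thesis by (simp add: w_rad)
  qed
  have "?a + ?c = 0" "- ?a + ?c = 0" using eq[of 1] eq[of "-1"] by simp_all
  then have "2 * ?c = 0" by Groebner_Basis.algebra
  then show c: "?c = 0" using two by (metis mult_eq_0_iff)
  show "?a = 0" using eq[of 1] c by simp
qed

text \<open>
  Modulo the radical of the contraction with \<open>u\<close>, the operator \<open>B u\<close> is the quotient of the contractions
  with \<open>w u\<close> and with \<open>u\<close>. All traces below are computed from this.
\<close>

lemma tri_form_w: "tri_form b (w u) x y = tri_form b u (B u x) y"
  using rad_polar[of x u y] tri_form_swap12[of b x "w u" y] by (simp add: add_eq_0_iff)

text \<open>
  The second derivative of \<open>w_rad\<close>.
\<close>

lemma rad_polar2: "tri_form b x (B u z) y + tri_form b z (B u x) y + tri_form b u (B z x) y = 0"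
proof -
  have "tri_form b x (w (u + z)) y + tri_form b (u + z) (B (u + z) x) y = 0" by (rule rad_polar)
  then have "(tri_form b x (w u) y + tri_form b u (B u x) y) + (tri_form b x (w z) y + tri_form b z (B z x) y) +
      (tri_form b x (B u z) y + tri_form b z (B u x) y + tri_form b u (B z x) y) = 0"
    by (simp add: w_add tri_form_linear polar_linear algebra_simps)
  then show ?thesis by (simp add: rad_polar)
qed

text \<open>
  If \<open>\<Delta> u \<noteq> 0\<close>, the space is the direct sum of \<open>\<langle>u, w u\<rangle>\<close> and the vectors whose components 0 and 1 are
  zero. The two coordinates in the first summand are given by Cramer's rule.
\<close>

definition coord1 :: "'f^8 \<Rightarrow> 'f^8 \<Rightarrow> 'f" where "coord1 u y = (y $ 0 * w u $ 1 - y $ 1 * w u $ 0) / \<Delta> u"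
definition coord2 :: "'f^8 \<Rightarrow> 'f^8 \<Rightarrow> 'f" where "coord2 u y = (u $ 0 * y $ 1 - u $ 1 * y $ 0) / \<Delta> u"
definition remainder :: "'f^8 \<Rightarrow> 'f^8 \<Rightarrow> 'f^8" where "remainder u y = y - coord1 u y *s u - coord2 u y *s w u"

lemma coord_add: "coord1 u (x + y) = coord1 u x + coord1 u y" "coord2 u (x + y) = coord2 u x + coord2 u y"
  and coord_scale: "coord1 u (s *s y) = s * coord1 u y" "coord2 u (s *s y) = s * coord2 u y"
  by (simp_all add: coord1_def coord2_def field_simps add_divide_distrib[symmetric])

lemma coord_diff: "coord1 u (x - y) = coord1 u x - coord1 u y" "coord2 u (x - y) = coord2 u x - coord2 u y"
  by (simp_all add: coord1_def coord2_def diff_divide_distrib[symmetric] algebra_simps)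

lemma coord_basis:
  assumes "\<Delta> u \<noteq> 0"
  shows "coord1 u u = 1" "coord2 u u = 0" "coord1 u (w u) = 0" "coord2 u (w u) = 1"
  using assms by (simp_all add: coord1_def coord2_def \<Delta>_def)

lemma remainder_01:
  assumes "\<Delta> u \<noteq> 0" shows "remainder u y $ 0 = 0" "remainder u y $ 1 = 0"
proof -
  have "\<Delta> u * remainder u y $ 0 = \<Delta> u * y $ 0 - (\<Delta> u * coord1 u y) * u $ 0 - (\<Delta> u * coord2 u y) * w u $ 0"
    by (simp add: remainder_def algebra_simps)
  also have "\<dots> = 0" using assms by (simp add: coord1_def coord2_def) (simp add: \<Delta>_def algebra_simps)
  finally show "remainder u y $ 0 = 0" using assms by simp
  have "\<Delta> u * remainder u y $ 1 = \<Delta> u * y $ 1 - (\<Delta> u * coord1 u y) * u $ 1 - (\<Delta> u * coord2 u y) * w u $ 1"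
    by (simp add: remainder_def algebra_simps)
  also have "\<dots> = 0" using assms by (simp add: coord1_def coord2_def) (simp add: \<Delta>_def algebra_simps)
  finally show "remainder u y $ 1 = 0" using assms by simp
qed

lemma tri_form_remainder: "tri_form b u (remainder u y) z = tri_form b u y z"
  by (simp add: remainder_def tri_form_linear w_rad)

lemma remainder_form_matrix:
  assumes "\<Delta> u \<noteq> 0" shows "tri_form b u y (axis c 1) = (\<Sum>j\<in>slots. remainder u y $ j * form_matrix b u j c)"
proof -
  have "tri_form b u y (axis c 1) = (\<Sum>j\<in>UNIV. remainder u y $ j * form_matrix b u j c)"
    unfolding form_matrix_def tri_form_remainder[of u y, symmetric] by (rule tri_form_expand2)
  also have "\<dots> = (\<Sum>j\<in>slots. remainder u y $ j * form_matrix b u j c)"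
    by (simp add: sum_8 remainder_01[OF assms])
  finally show ?thesis .
qed

lemma remainder_eq_0:
  assumes u: "\<Delta> u \<noteq> 0" and y: "\<And>z. tri_form b u y z = 0" shows "remainder u y = 0"
proof -
  have "remainder u y $ s = 0" if s: "s \<in> slots" for s
  proof -
    have "pf6 (row_replace s (\<lambda>_. 0) (form_matrix b u)) = remainder u y $ s * pf6 (form_matrix b u)"
      by (rule pf6_row_comb[OF alternating_form_matrix s]) (simp add: remainder_form_matrix[OF u, symmetric] y)
    moreover have "pf6 (row_replace s (\<lambda>_. 0) (form_matrix b u)) = 0"
      using s by (elim insertE emptyE; simp add: pf6_def row_replace_def)
    ultimately show ?thesis using u by (simp add: w_pf \<Delta>_def)
  qed
  moreover have "s \<in> slots \<or> s = 0 \<or> s = 1" for s :: 8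
    using UNIV_I[of s] unfolding UNIV_8 by blast
  ultimately have "remainder u y $ s = 0" for s using remainder_01[OF u] by metis
  then show ?thesis by (simp add: vec_eq_iff)
qed

lemma radical_span:
  assumes "\<Delta> u \<noteq> 0" "\<And>z. tri_form b u y z = 0" shows "y = coord1 u y *s u + coord2 u y *s w u"
  using remainder_eq_0[OF assms] by (simp add: remainder_def algebra_simps)

text \<open>
  The trace in a basis adapted to the decomposition: a block on \<open>\<langle>u, w u\<rangle>\<close> and a block on the complement.
\<close>

lemma trace_split:
  fixes T :: "'f^8 \<Rightarrow> 'f^8"
  assumes u: "\<Delta> u \<noteq> 0" and T: "\<And>x y. T (x + y) = T x + T y" "\<And>c x. T (c *s x) = c *s T x"
  shows "(\<Sum>j\<in>UNIV. T (axis j 1) $ j) = coord1 u (T u) + coord2 u (T (w u)) + (\<Sum>s\<in>slots. remainder u (T (axis s 1)) $ s)"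
proof -
  have "T (axis j 1) $ j = u $ j * coord1 u (T (axis j 1)) + w u $ j * coord2 u (T (axis j 1)) + remainder u (T (axis j 1)) $ j" for j
    by (simp add: remainder_def algebra_simps)
  then have "(\<Sum>j\<in>UNIV. T (axis j 1) $ j) = (\<Sum>j\<in>UNIV. u $ j * coord1 u (T (axis j 1))) +
     (\<Sum>j\<in>UNIV. w u $ j * coord2 u (T (axis j 1))) + (\<Sum>j\<in>UNIV. remainder u (T (axis j 1)) $ j)"
    by (simp add: sum.distrib)
  also have "(\<Sum>j\<in>UNIV. u $ j * coord1 u (T (axis j 1))) = coord1 u (T u)"
    by (rule linear_expand[of "\<lambda>x. coord1 u (T x)", symmetric]) (simp_all add: T coord_add coord_scale)
  also have "(\<Sum>j\<in>UNIV. w u $ j * coord2 u (T (axis j 1))) = coord2 u (T (w u))"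
    by (rule linear_expand[of "\<lambda>x. coord2 u (T x)", symmetric]) (simp_all add: T coord_add coord_scale)
  also have "(\<Sum>j\<in>UNIV. remainder u (T (axis j 1)) $ j) = (\<Sum>s\<in>slots. remainder u (T (axis s 1)) $ s)"
    by (simp add: sum_8 remainder_01[OF u])
  finally show ?thesis .
qed

definition \<tau> :: "'f^8 \<Rightarrow> 'f" where "\<tau> u = (\<Sum>j\<in>UNIV. polar_mat C u j j)"

lemma \<tau>_linear: "\<tau> (u + x) = \<tau> u + \<tau> x" "\<tau> (c *s u) = c * \<tau> u"
  by (simp_all add: \<tau>_def polar_mat_def sum.distrib[symmetric] sum_distrib_left algebra_simps)

lemma \<tau>_polar: "\<tau> u = (\<Sum>j\<in>UNIV. B u (axis j 1) $ j)" by (simp add: \<tau>_def polar_axis)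

text \<open>
  The restriction of \<open>w\<close> to the plane \<open>\<langle>u, w u\<rangle>\<close> is determined by the four scalars \<open>q, r, \<alpha>, \<beta>\<close>.
\<close>

definition q where "q u = coord1 u (B u (w u))"
definition r where "r u = coord2 u (B u (w u))"
definition \<alpha> where "\<alpha> u = coord1 u (w (w u))"
definition \<beta> where "\<beta> u = coord2 u (w (w u))"

lemma polar_w: assumes "\<Delta> u \<noteq> 0" shows "B u (w u) = q u *s u + r u *s w u"
  unfolding q_def r_def by (rule radical_span[OF assms]) (simp add: tri_form_w[symmetric])

lemma w_w: assumes "\<Delta> u \<noteq> 0" shows "w (w u) = \<alpha> u *s u + \<beta> u *s w u"
  unfolding \<alpha>_def \<beta>_def
proof (rule radical_span[OF assms])
  fix z
  have "tri_form b (w u) u z = 0" using w_rad[of u z] tri_form_swap12[of b u "w u" z] by simp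
  then show "tri_form b u (w (w u)) z = 0"
    using rad_polar'[of u "w u" z] by (simp add: polar_w[OF assms] tri_form_linear)
qed

lemma w_pencil:
  assumes "\<Delta> u \<noteq> 0"
  shows "w (u + t *s w u) = (t * q u + t^2 * \<alpha> u) *s u + (1 + t * r u + t^2 * \<beta> u) *s w u"
  by (simp add: w_add w_scale polar_linear polar_w[OF assms] w_w[OF assms] vec_eq_iff algebra_simps)

lemma \<Delta>_pencil:
  assumes "\<Delta> u \<noteq> 0"
  shows "\<Delta> (u + t *s w u) = \<Delta> u * (1 + t * r u + t^2 * (\<beta> u - q u) - t^3 * \<alpha> u)"
  unfolding \<Delta>_def[of "u + _"] w_pencil[OF assms]
  by (simp add: \<Delta>_def algebra_simps power2_eq_square power3_eq_cube)

text \<open>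
  Along the pencil \<open>u + t w u\<close>, the Pfaffian of the rows \<open>2, \<dots>, 7\<close> is a cubic polynomial in \<open>t\<close> with linear
  coefficient \<open>\<Delta> u * r u\<close> (lemma \<open>\<Delta>_pencil\<close>). By Jacobi's formula this coefficient is \<open>\<Delta> u\<close> times half
  the trace of \<open>B u\<close> on the complement of \<open>\<langle>u, w u\<rangle>\<close>, because \<open>B u\<close> is the quotient of the two
  contractions. As \<open>B u\<close> has trace \<open>r u\<close> on the plane, the total trace is \<open>2 r u + r u\<close>.
\<close>

lemma trace_polar:
  assumes u: "\<Delta> u \<noteq> 0" shows "\<tau> u = 3 * r u"
proof -
  let ?m = "form_matrix b u" and ?x = "form_matrix b (w u)"
  have pencil: "form_matrix b (u + t *s w u) = (\<lambda>a c. ?m a c + t * ?x a c)" for t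
    by (simp add: form_matrix_def tri_form_linear fun_eq_iff)
  let ?K1 = "pf6_first ?m ?x" and ?K2 = "pf6_first ?x ?m" and ?K3 = "2 * pf6 ?x"
  have pf: "pf6 (form_matrix b x) = \<Delta> x" for x by (simp add: w_pf \<Delta>_def)
  have E: "t * ?K1 + t^2 * ?K2 + t^3 * ?K3 = 2 * \<Delta> u * (t * r u + t^2 * (\<beta> u - q u) - t^3 * \<alpha> u)" for t
  proof -
    have "2 * \<Delta> (u + t *s w u) = 2 * \<Delta> u + t * ?K1 + t^2 * ?K2 + t^3 * ?K3"
      using pf6_pencil[OF alternating_form_matrix[of b "w u"] alternating_form_matrix[of b u], of t] pf[of "u + t *s w u"]
      unfolding pencil pf by simp
    then show ?thesis unfolding \<Delta>_pencil[OF u] by Groebner_Basis.algebra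
  qed
  \<comment> \<open>The values at \<open>1, -1, 2, -2\<close> isolate the linear coefficient.\<close>
  have "12 * ?K1 = 12 * (2 * \<Delta> u * r u)"
  proof -
    have "?K1 + ?K2 + ?K3 = 2 * \<Delta> u * (r u + (\<beta> u - q u) - \<alpha> u)" using E[of 1] by simp
    moreover have "- ?K1 + ?K2 - ?K3 = 2 * \<Delta> u * (- r u + (\<beta> u - q u) + \<alpha> u)" using E[of "-1"] by simp
    moreover have "2 * ?K1 + 4 * ?K2 + 8 * ?K3 = 2 * \<Delta> u * (2 * r u + 4 * (\<beta> u - q u) - 8 * \<alpha> u)" using E[of 2] by simp
    moreover have "- (2 * ?K1) + 4 * ?K2 - 8 * ?K3 = 2 * \<Delta> u * (- (2 * r u) + 4 * (\<beta> u - q u) + 8 * \<alpha> u)" using E[of "-2"] by simp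
    ultimately show ?thesis by Groebner_Basis.algebra
  qed
  then have "2 * (2 * (3 * (?K1 - 2 * \<Delta> u * r u))) = 0" by (simp add: algebra_simps)
  then have "?K1 - 2 * \<Delta> u * r u = 0" using two three by (metis mult_eq_0_iff)
  then have K1: "?K1 = 2 * \<Delta> u * r u" by simp
  have "pf6 (row_replace s (?x s) ?m) = remainder u (B u (axis s 1)) $ s * \<Delta> u" if s: "s \<in> slots" for s
    unfolding pf[of u, symmetric]
    by (rule pf6_row_comb[OF alternating_form_matrix s]) (simp add: form_matrix_def[of b "w u"] tri_form_w remainder_form_matrix[OF u])
  then have "?K1 = (\<Sum>s\<in>slots. remainder u (B u (axis s 1)) $ s) * \<Delta> u"
    unfolding pf6_first_def sum_distrib_right by (intro sum.cong) auto
  moreover have "\<tau> u = coord1 u (B u u) + coord2 u (B u (w u)) + (\<Sum>s\<in>slots. remainder u (B u (axis s 1)) $ s)"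
    unfolding \<tau>_polar by (rule trace_split[OF u]) (simp_all add: polar_linear)
  moreover have "coord1 u (B u u) = 0" by (simp add: polar_self coord_scale coord_basis[OF u])
  moreover have "(\<Sum>s\<in>slots. remainder u (B u (axis s 1)) $ s) = 2 * r u"
  proof -
    have "(\<Sum>s\<in>slots. remainder u (B u (axis s 1)) $ s) * \<Delta> u = (2 * r u) * \<Delta> u"
      using calculation(1) K1 by (simp only: mult_ac)
    then show ?thesis by (rule mult_right_cancel[OF u, THEN iffD1])
  qed
  ultimately show ?thesis by (simp only: r_def[symmetric]) (simp add: algebra_simps)
qed

text \<open>
  A polynomial of degree at most 3 with constant term 1 cannot vanish at \<open>1, -1, 2\<close> and \<open>-2\<close> if 6 is
  non-zero.
\<close>

lemma nonvanishing_pencil: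
  assumes u: "\<Delta> u \<noteq> 0" shows "\<exists>t. t \<noteq> 0 \<and> \<Delta> (u + t *s w u) \<noteq> 0"
proof (rule ccontr)
  assume "\<not> ?thesis"
  then have z: "1 + t * r u + t^2 * (\<beta> u - q u) - t^3 * \<alpha> u = 0" if "t \<noteq> 0" for t
    using that \<Delta>_pencil[OF u, of t] u by auto
  then have eqs: "1 + r u + (\<beta> u - q u) - \<alpha> u = 0" "1 - r u + (\<beta> u - q u) + \<alpha> u = 0"
    "1 + 2 * r u + 4 * (\<beta> u - q u) - 8 * \<alpha> u = 0" "1 - 2 * r u + 4 * (\<beta> u - q u) + 8 * \<alpha> u = 0"
    using z[of 1] z[of "-1"] z[of 2] z[of "-2"] two by simp_all
  have "(6::'f) = 4 * ((1 + r u + (\<beta> u - q u) - \<alpha> u) + (1 - r u + (\<beta> u - q u) + \<alpha> u))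
     - ((1 + 2 * r u + 4 * (\<beta> u - q u) - 8 * \<alpha> u) + (1 - 2 * r u + 4 * (\<beta> u - q u) + 8 * \<alpha> u))"
    by (simp add: algebra_simps)
  then have "(6::'f) = 0" unfolding eqs by simp
  then have "(2::'f) * 3 = 0" by simp
  then show False using two three by (simp only: mult_eq_0_iff) blast
qed

text \<open>
  By \<open>trace_polar\<close> the trace of \<open>B u\<close> is three times its trace on the plane \<open>\<langle>u, w u\<rangle>\<close>. The plane is the
  same for all non-degenerate vectors of the pencil, and both traces are linear in the vector.
  So the statement holds in the direction of \<open>w u\<close>, too, where the trace on the plane is \<open>q + 2 \<beta>\<close>.
\<close>

lemma trace_polar_w:
  assumes u: "\<Delta> u \<noteq> 0" shows "\<tau> (w u) = 3 * (q u + 2 * \<beta> u)"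
proof -
  obtain t where t: "t \<noteq> 0" "\<Delta> (u + t *s w u) \<noteq> 0" using nonvanishing_pencil[OF u] by blast
  let ?u = "u + t *s w u"
  define y1 where "y1 = t * q u + t^2 * \<alpha> u"
  define y2 where "y2 = 1 + t * r u + t^2 * \<beta> u"
  have wu: "w ?u = y1 *s u + y2 *s w u" unfolding y1_def y2_def by (rule w_pencil[OF u])
  have ne: "y2 - t * y1 \<noteq> 0"
  proof
    assume "y2 - t * y1 = 0"
    moreover have "\<Delta> ?u = \<Delta> u * (y2 - t * y1)"
      unfolding \<Delta>_pencil[OF u] y1_def y2_def by (simp add: algebra_simps power2_eq_square power3_eq_cube)
    ultimately show False using t by simp
  qed
  have "B ?u (w ?u) = (y1 * (t * q u) + y2 * (q u + 2 * t * \<alpha> u)) *s u + (y1 * (2 + t * r u) + y2 * (r u + 2 * t * \<beta> u)) *s w u"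
    unfolding wu by (simp add: polar_linear polar_self polar_sym[of C "w u" u] polar_w[OF u] w_w[OF u] vec_eq_iff algebra_simps)
  moreover have "B ?u (w ?u) = (q ?u + r ?u * y1) *s u + (q ?u * t + r ?u * y2) *s w u"
    unfolding polar_w[OF t(2)] unfolding wu by (simp add: vec_eq_iff algebra_simps)
  ultimately have eq: "(y1 * (t * q u) + y2 * (q u + 2 * t * \<alpha> u)) *s u + (y1 * (2 + t * r u) + y2 * (r u + 2 * t * \<beta> u)) *s w u
     = (q ?u + r ?u * y1) *s u + (q ?u * t + r ?u * y2) *s w u" by simp
  have 1: "y1 * (t * q u) + y2 * (q u + 2 * t * \<alpha> u) = q ?u + r ?u * y1"
    using arg_cong[OF eq, of "coord1 u"] by (simp add: coord_add coord_diff coord_scale coord_basis[OF u])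
  have 2: "y1 * (2 + t * r u) + y2 * (r u + 2 * t * \<beta> u) = q ?u * t + r ?u * y2"
    using arg_cong[OF eq, of "coord2 u"] by (simp add: coord_add coord_diff coord_scale coord_basis[OF u])
  have "r ?u * (y2 - t * y1) = (t * q u + r u + 2 * t * \<beta> u) * (y2 - t * y1)"
    using 1 2 y1_def y2_def by Groebner_Basis.algebra
  then have "r ?u = t * q u + r u + 2 * t * \<beta> u" using ne by simp
  then have "\<tau> u + t * \<tau> (w u) = 3 * r u + t * (3 * (q u + 2 * \<beta> u))"
    using trace_polar[OF t(2)] by (simp add: \<tau>_linear algebra_simps)
  then show ?thesis using trace_polar[OF u] t(1) by simp
qed

definition \<delta> :: "'f^8 \<Rightarrow> 'f" where "\<delta> u = (\<Sum>j\<in>UNIV. \<Sum>k\<in>UNIV. polar_mat C u j k * polar_mat C u k j)"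
definition \<theta> :: "'f^8 \<Rightarrow> 'f" where "\<theta> u = (\<Sum>j\<in>UNIV. \<Sum>k\<in>UNIV. polar_mat C u j k * polar_mat C (w u) k j)"

lemma trace_comp: "(\<Sum>j\<in>UNIV. B u (B x (axis j 1)) $ j) = (\<Sum>j\<in>UNIV. \<Sum>k\<in>UNIV. polar_mat C u j k * polar_mat C x k j)"
proof -
  have "B u y $ j = (\<Sum>k\<in>UNIV. y $ k * polar_mat C u j k)" for y j
    using linear_expand[of "\<lambda>y. B u y $ j" y] by (simp add: polar_linear polar_axis)
  then show ?thesis by (simp add: polar_axis mult.commute)
qed

text \<open>
  Modulo the plane, \<open>B u \<circ> B (w u) = \<alpha> + \<beta> B u\<close>, because \<open>w (w u) = \<alpha> u + \<beta> w u\<close>. The difference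
  \<open>E\<close> of the two sides maps into the plane, so its trace is that of its restriction to the plane.
\<close>

lemma trace_\<theta>:
  assumes u: "\<Delta> u \<noteq> 0" shows "\<theta> u = 10 * \<alpha> u + 4 * \<beta> u * r u + r u * q u"
proof -
  define E where "E x = B u (B (w u) x) - \<alpha> u *s x - \<beta> u *s B u x" for x
  have lin: "E (x + y) = E x + E y" "E (c *s x) = c *s E x" for x y c
    by (simp_all add: E_def polar_linear vec_eq_iff algebra_simps)
  have "tri_form b u (E x) z = 0" for x z
  proof -
    have "tri_form b u (B u (B (w u) x)) z = tri_form b (w u) (B (w u) x) z" by (simp add: tri_form_w)
    also have "\<dots> = tri_form b (w (w u)) x z" by (simp add: tri_form_w)
    also have "\<dots> = \<alpha> u * tri_form b u x z + \<beta> u * tri_form b u (B u x) z"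
      unfolding w_w[OF u] by (simp add: tri_form_linear tri_form_w)
    finally show ?thesis by (simp add: E_def tri_form_linear)
  qed
  then have remainder: "remainder u (E x) = 0" for x by (intro remainder_eq_0[OF u])
  have "(\<Sum>j\<in>UNIV. E (axis j 1) $ j) = coord1 u (E u) + coord2 u (E (w u))"
    by (subst trace_split[OF u]) (simp_all add: lin remainder)
  moreover have "(\<Sum>j\<in>UNIV. E (axis j 1) $ j) = \<theta> u - 8 * \<alpha> u - \<beta> u * \<tau> u"
    by (simp add: E_def sum_subtractf trace_comp \<theta>_def \<tau>_polar sum_distrib_left)
  moreover have "E u = (r u * q u - \<alpha> u) *s u + (2 * q u + r u * r u - 2 * \<beta> u) *s w u"
    by (simp add: E_def polar_self polar_sym[of C "w u" u] polar_w[OF u] polar_linear vec_eq_iff algebra_simps)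
  moreover have "E (w u) = (2 * \<beta> u * q u - \<beta> u * q u) *s u + (4 * \<alpha> u + 2 * \<beta> u * r u - \<alpha> u - \<beta> u * r u) *s w u"
    by (simp add: E_def polar_self polar_w[OF u] w_w[OF u] polar_linear vec_eq_iff algebra_simps)
  ultimately have "\<theta> u - 8 * \<alpha> u - \<beta> u * \<tau> u = (r u * q u - \<alpha> u) + (4 * \<alpha> u + 2 * \<beta> u * r u - \<alpha> u - \<beta> u * r u)"
    by (simp add: coord_add coord_diff coord_scale coord_basis[OF u])
  then show ?thesis by (simp add: trace_polar[OF u] algebra_simps)
qed

text \<open>
  The second derivative of \<open>w_rad\<close> gives \<open>B (w u) + (B u)\<^sup>2 = q + r B u\<close> modulo the plane; again the
  difference of the two sides has the trace of its restriction to the plane.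
\<close>

lemma trace_\<delta>:
  assumes u: "\<Delta> u \<noteq> 0" shows "\<tau> (w u) + \<delta> u - 8 * q u - 3 * r u ^ 2 = 3 * q u + 2 * \<beta> u"
proof -
  define E where "E x = B (w u) x + B u (B u x) - q u *s x - r u *s B u x" for x
  have lin: "E (x + y) = E x + E y" "E (c *s x) = c *s E x" for x y c
    by (simp_all add: E_def polar_linear vec_eq_iff algebra_simps)
  have "tri_form b u (E x) z = 0" for x z
  proof -
    have 1: "tri_form b (w u) (B u x) z = tri_form b u (B u (B u x)) z" by (simp add: tri_form_w)
    have 2: "tri_form b x (B u (w u)) z = - (q u * tri_form b u x z + r u * tri_form b u (B u x) z)"
      unfolding polar_w[OF u] using tri_form_swap12[of b u x z] tri_form_swap12[of b "w u" x z]
      by (simp add: tri_form_linear tri_form_w algebra_simps)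
    show ?thesis using rad_polar2[of x u "w u" z] unfolding 1 2 by (simp add: E_def tri_form_linear algebra_simps)
  qed
  then have remainder: "remainder u (E x) = 0" for x by (intro remainder_eq_0[OF u])
  have "(\<Sum>j\<in>UNIV. E (axis j 1) $ j) = coord1 u (E u) + coord2 u (E (w u))"
    by (subst trace_split[OF u]) (simp_all add: lin remainder)
  moreover have "(\<Sum>j\<in>UNIV. E (axis j 1) $ j) = \<tau> (w u) + \<delta> u - 8 * q u - r u * \<tau> u"
    by (simp add: E_def sum_subtractf sum.distrib trace_comp \<delta>_def \<tau>_polar sum_distrib_left)
  moreover have "E u = (2 * q u) *s u + r u *s w u"
    by (simp add: E_def polar_self polar_sym[of C "w u" u] polar_w[OF u] polar_linear vec_eq_iff algebra_simps)
  moreover have "E (w u) = (2 * \<alpha> u + r u * q u - r u * q u) *s u + (2 * \<beta> u + 2 * q u + r u * r u - q u - r u * r u) *s w u"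
    by (simp add: E_def polar_self polar_w[OF u] w_w[OF u] polar_linear vec_eq_iff algebra_simps)
  ultimately have "\<tau> (w u) + \<delta> u - 8 * q u - r u * \<tau> u = 2 * q u + (2 * \<beta> u + 2 * q u + r u * r u - q u - r u * r u)"
    by (simp add: coord_add coord_diff coord_scale coord_basis[OF u])
  then show ?thesis by (simp add: trace_polar[OF u] algebra_simps power2_eq_square)
qed

text \<open>
  The trace formulas are linear equations for \<open>\<alpha>, \<beta>, q\<close> with \<open>r = \<tau> u / 3\<close>; eliminating \<open>\<beta>\<close> and \<open>q\<close>
  leaves \<open>900 \<alpha>\<close>.
\<close>

theorem cubic_covariant:
  assumes u: "\<Delta> u \<noteq> 0"
  shows "900 * (w u $ k * w (w u) $ l - w u $ l * w (w u) $ k) =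
    - (90 * \<theta> u - 18 * \<tau> u * \<tau> (w u) + 3 * \<tau> u * \<delta> u - \<tau> u ^ 3) * (u $ k * w u $ l - u $ l * w u $ k)"
proof -
  have d: "\<delta> u = 8 * q u - 4 * \<beta> u + 3 * r u ^ 2"
    using trace_\<delta>[OF u] trace_polar_w[OF u] by (simp add: algebra_simps)
  have "90 * \<theta> u - 18 * \<tau> u * \<tau> (w u) + 3 * \<tau> u * \<delta> u - \<tau> u ^ 3 = 900 * \<alpha> u"
    unfolding d trace_polar[OF u] trace_polar_w[OF u] trace_\<theta>[OF u]
    by (simp add: algebra_simps power2_eq_square power3_eq_cube)
  moreover have "w u $ k * w (w u) $ l - w u $ l * w (w u) $ k = - \<alpha> u * (u $ k * w u $ l - u $ l * w u $ k)"
    unfolding w_w[OF u] by (simp add: algebra_simps)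
  ultimately show ?thesis by simp
qed

end

section \<open>The cubic covariant over the integers\<close>

lemma evalp_hom:
  assumes "\<And>x y. h (x + y) = h x + h y" "\<And>x y. h (x * y) = h x * h y" "\<And>x. h (- x) = - h x" "h 0 = 0" "h 1 = 1"
  shows "h (evalp x f) = evalp (\<lambda>n. h (x n)) f"
proof -
  have s: "h (sum g A) = (\<Sum>a\<in>A. h (g a))" for g :: "monomial \<Rightarrow> 'a" and A
    by (induction A rule: infinite_finite_induct) (simp_all add: assms)
  have p: "h (prod g A) = (\<Prod>a\<in>A. h (g a))" for g :: "8 list \<Rightarrow> 'a" and A
    by (induction A rule: infinite_finite_induct) (simp_all add: assms)
  have e: "h (z ^ n) = h z ^ n" for z n by (induction n) (simp_all add: assms)
  have n: "h (of_nat n) = of_nat n" for n by (induction n) (simp_all add: assms)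
  have i: "h (of_int c) = of_int c" for c by (cases c) (simp_all add: n assms del: of_nat_Suc)
  show ?thesis by (simp add: evalp_def eval_monomial_def s p e i assms)
qed

lemma homogeneous_of_nat_cancel: "homogeneous d (of_nat N * f) \<Longrightarrow> N \<noteq> 0 \<Longrightarrow> homogeneous d f"
  by (auto simp: homogeneous_def in_keys_iff lookup_of_nat_mult)

lemma homogeneous_prod_0: "(\<And>a. a \<in> A \<Longrightarrow> homogeneous 0 (f a)) \<Longrightarrow> homogeneous 0 (prod f A)"
  using homogeneous_of_int[of 1]
  by (induction A rule: infinite_finite_induct) (auto intro: homogeneous_mult[of 0 _ 0])

lemma homogeneous_power_0: "homogeneous 0 f \<Longrightarrow> homogeneous 0 (f ^ n)"
  using homogeneous_of_int[of 1] by (induction n) (auto intro: homogeneous_mult[of 0 _ 0])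

text \<open>
  Used for the coefficients of \<open>w\<close>: they do not involve the coordinates of the vector.
\<close>

lemma homogeneous_0_evalp: "(\<And>n. homogeneous 0 (x n)) \<Longrightarrow> homogeneous 0 (evalp x f)"
  unfolding evalp_def eval_monomial_def by (intro homogeneous_sum homogeneous_const_mult homogeneous_prod_0 homogeneous_power_0)

text \<open>
  Remove the prime factors of \<open>N\<close> one by one.
\<close>

lemma of_nat_dvd_cancel_zpoly:
  assumes "\<And>p. Factorial_Ring.prime p \<Longrightarrow> \<not> of_nat p dvd (P :: zpoly)"
  shows "N > 0 \<Longrightarrow> of_nat N dvd G * P \<Longrightarrow> of_nat N dvd G"
proof (induction N arbitrary: G rule: less_induct)
  case (less N)
  show ?case
  proof (cases "N = 1")
    case False
    then obtain p where p: "Factorial_Ring.prime p" "p dvd N" using prime_factor_nat by blast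
    then obtain n where n: "N = p * n" by blast
    have p1: "p > 1" using p(1) prime_gt_1_nat by blast
    have "(of_nat p :: zpoly) dvd of_nat N" by (simp add: n)
    then have "of_nat p dvd G * P" using less.prems(2) dvd_trans by blast
    then have "of_nat p dvd G" using prime_dvd_mult_zpoly[OF p(1)] assms[OF p(1)] by blast
    then obtain G' where G': "G = of_nat p * G'" by blast
    have "of_nat p * of_nat n dvd of_nat p * (G' * P)" using less.prems(2) by (simp add: n G' mult.assoc)
    moreover have "(of_nat p :: zpoly) \<noteq> 0" using p1 by simp
    ultimately have "of_nat n dvd G' * P" by (simp only: dvd_mult_cancel_left) blast
    then have "of_nat n dvd G'" using less.IH[of n G'] n p1 less.prems(1) by auto
    then show ?thesis by (simp add: n G' mult_dvd_mono)
  qed simp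
qed

text \<open>
  Substituting a polynomial vector and specialising afterwards is the same as specialising the
  vector first. This is what lets the iterate \<open>w (w u)\<close> be specialised.
\<close>

lemma evalp_assign_gen: "evalp (assign b u) (evalp (assign gen_coeff x) f) = evalp (assign b (\<chi> i. evalp (assign b u) (x $ i))) f"
proof -
  have "evalp (assign b u) (assign gen_coeff x n) = assign b (\<chi> i. evalp (assign b u) (x $ i)) n" for n
    by (auto simp: assign_def gen_coeff_def split: list.split)
  then show ?thesis by (simp add: evalp_evalp)
qed

text \<open>
  Over the fraction field of the polynomial ring, \<open>cubic_covariant\<close> applies to the generic form and the
  generic vector. It gives \<open>900 (w \<and> w(w)) = - G P\<close> with a polynomial \<open>G\<close> of degree 3 in the vector.
  Since \<open>P\<^sub>0\<^sub>1\<close> is not divisible by a prime, \<open>G = 900 a\<close>.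
\<close>

theorem ex_cubic_covariant:
  "\<exists>a. homogeneous 3 a \<and> (\<forall>k l. radical_vec gen_coeff gen_vec $ k * radical_vec gen_coeff (radical_vec gen_coeff gen_vec) $ l - radical_vec gen_coeff gen_vec $ l * radical_vec gen_coeff (radical_vec gen_coeff gen_vec) $ k =
      - a * (gen_vec $ k * radical_vec gen_coeff gen_vec $ l - gen_vec $ l * radical_vec gen_coeff gen_vec $ k))"
proof -
  have "\<forall>j. \<exists>C. (\<forall>k l. homogeneous 0 (C k l)) \<and> gen_radical j = (\<Sum>k\<in>UNIV. \<Sum>l\<in>UNIV. C k l * Var [k] * Var [l])"
    using homogeneous_quadratic_form[OF gen_radical(1)] by blast
  from choice[OF this] obtain Cz where Cz: "\<forall>j. (\<forall>k l. homogeneous 0 (Cz j k l)) \<and>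
    gen_radical j = (\<Sum>k\<in>UNIV. \<Sum>l\<in>UNIV. Cz j k l * Var [k] * Var [l])" by (elim exE)
  define CA where "CA j k l = evalp (assign gen_coeff 0) (Cz j k l)" for j k l
  have CA: "homogeneous 0 (CA j k l)" for j k l
  proof -
    have "homogeneous 0 (assign gen_coeff 0 n)" for n by (auto simp: assign_def gen_coeff_def split: list.split)
    then show ?thesis unfolding CA_def by (rule homogeneous_0_evalp)
  qed
  let ?h = "to_fract :: zpoly \<Rightarrow> zpoly fract"
  define fb where "fb i j k = ?h (gen_coeff i j k)" for i j k
  define emb where "emb x = (\<chi> i. ?h (x $ i))" for x :: "zpoly^8"
  define C where "C j k l = ?h (CA j k l)" for j k l
  have h_ev: "?h (evalp x f) = evalp (\<lambda>n. ?h (x n)) f" for x f by (rule evalp_hom) simp_all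
  have assign_h: "(\<lambda>n. ?h (assign gen_coeff x n)) = assign fb (emb x)" for x
    by (auto simp: assign_def fb_def emb_def split: list.split)
  have radical_vec_emb: "radical_vec fb (emb x) = emb (radical_vec gen_coeff x)" for x
    by (simp add: radical_vec_def vec_eq_iff emb_def[of "\<chi> j. _ j"] h_ev assign_h)
  have C0: "C j k l = evalp (assign fb u) (Cz j k l)" for j k l u
    using evalp_homogeneous_0[of "Cz j k l" fb u "emb 0"] Cz by (simp add: C_def CA_def h_ev assign_h)
  interpret quadratic_radical fb C "radical_vec fb"
  proof
    show "radical_vec fb u $ j = (\<Sum>k\<in>UNIV. \<Sum>l\<in>UNIV. C j k l * u $ k * u $ l)" for u j
      using Cz by (simp add: radical_vec_def C0[of _ _ _ u])
    show "tri_form fb u (radical_vec fb u) y = 0" for u y by (rule tri_form_radical_vec)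
    show "pf6 (form_matrix fb u) = u $ 0 * radical_vec fb u $ 1 - u $ 1 * radical_vec fb u $ 0" for u
      using pf_cofactor_perm[OF alternating_form_matrix permutes_id, of fb u] cofactor_radical_vec[of fb u 0 1] by simp
    have "?h 2 \<noteq> 0" "?h 3 \<noteq> 0" by (simp_all only: to_fract_eq_0_iff) simp_all
    moreover have "?h 2 = 2" "?h 3 = 3"
      using to_fract_add[of "1::zpoly" 1] to_fract_add[of "2::zpoly" 1] by simp_all
    ultimately show "(2 :: zpoly fract) \<noteq> 0" "(3 :: zpoly fract) \<noteq> 0" by auto
  qed
  \<comment> \<open>The vectors \<open>w(v)\<close> and \<open>w(w(v))\<close> for the generic vector \<open>v\<close>, and the numerator \<open>G\<close> of \<open>\<alpha>\<close>.\<close>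
  define w1 where "w1 = radical_vec gen_coeff gen_vec"
  define w2 where "w2 = radical_vec gen_coeff w1"
  define G where "G = 90 * (\<Sum>j\<in>UNIV. \<Sum>k\<in>UNIV. polar_mat CA gen_vec j k * polar_mat CA w1 k j)
     - 18 * ((\<Sum>j\<in>UNIV. polar_mat CA gen_vec j j) * (\<Sum>j\<in>UNIV. polar_mat CA w1 j j))
     + 3 * ((\<Sum>j\<in>UNIV. polar_mat CA gen_vec j j) * (\<Sum>j\<in>UNIV. \<Sum>k\<in>UNIV. polar_mat CA gen_vec j k * polar_mat CA gen_vec k j))
     - (\<Sum>j\<in>UNIV. polar_mat CA gen_vec j j) * ((\<Sum>j\<in>UNIV. polar_mat CA gen_vec j j) * (\<Sum>j\<in>UNIV. polar_mat CA gen_vec j j))"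
  let ?P = "\<lambda>k l. gen_vec $ k * w1 $ l - gen_vec $ l * w1 $ k"
  have P01: "?P 0 1 = pf_cofactor (form_matrix gen_coeff gen_vec) 0 1"
    using cofactor_radical_vec[of gen_coeff gen_vec 0 1] by (simp add: w1_def)
  have e12: "radical_vec fb (emb gen_vec) = emb w1" "radical_vec fb (emb w1) = emb w2" by (simp_all add: radical_vec_emb w1_def w2_def)
  have pm: "polar_mat C (emb x) j k = ?h (polar_mat CA x j k)" for x j k
    by (simp add: polar_mat_def C_def emb_def)
  have num: "?h (numeral n) = numeral n" for n
  proof -
    have "?h (of_nat m) = of_nat m" for m by (induction m) simp_all
    from this[of "numeral n"] show ?thesis by simp
  qed
  have ne: "?P 0 1 \<noteq> 0" using gen_cofactor_primitive[of 2] unfolding P01 by auto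
  have "\<Delta> (emb gen_vec) = ?h (?P 0 1)"
    unfolding \<Delta>_def e12 by (simp add: emb_def)
  then have "\<Delta> (emb gen_vec) \<noteq> 0" using ne by (simp only: to_fract_eq_0_iff) simp
  note cov = cubic_covariant[OF this, unfolded e12]
  have id: "900 * (w1 $ k * w2 $ l - w1 $ l * w2 $ k) = - G * ?P k l" for k l
  proof -
    have "?h (900 * (w1 $ k * w2 $ l - w1 $ l * w2 $ k)) = ?h (- G * ?P k l)"
      using cov[of k l] unfolding \<theta>_def \<delta>_def \<tau>_def pm e12
      by (simp add: G_def num emb_def power3_eq_cube mult.assoc)
    then show ?thesis by (simp only: to_fract_eq_iff)
  qed
  have "of_nat 900 dvd G * ?P 0 1"
  proof (rule dvdI)
    show "G * ?P 0 1 = of_nat 900 * (- (w1 $ 0 * w2 $ 1 - w1 $ 1 * w2 $ 0))"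
      by (simp only: of_nat_numeral mult_minus_right id mult_minus_left minus_minus)
  qed
  moreover have "\<not> of_nat p dvd ?P 0 1" if "Factorial_Ring.prime p" for p
    unfolding P01 by (rule gen_cofactor_primitive[OF that])
  ultimately have "of_nat 900 dvd G" using of_nat_dvd_cancel_zpoly[of "?P 0 1" 900 G] by simp
  then obtain a where a: "G = of_nat 900 * a" by blast
  have v1: "homogeneous 1 (gen_vec $ i)" for i by simp
  have w1h: "homogeneous 2 (w1 $ j)" for j
  proof -
    have "evalp (assign gen_coeff gen_vec) (Cz j k l) = CA j k l" for k l
      unfolding CA_def using Cz by (intro evalp_homogeneous_0) blast
    then have "w1 $ j = (\<Sum>k\<in>UNIV. \<Sum>l\<in>UNIV. CA j k l * gen_vec $ k * gen_vec $ l)"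
      using Cz by (simp add: w1_def radical_vec_def)
    then show ?thesis
      by (simp only:) (intro homogeneous_sum homogeneous_mult[of 1 _ 1 _ 2] homogeneous_mult[of 0 _ 1 _ 1] CA v1; simp)
  qed
  have pmv: "homogeneous 1 (polar_mat CA gen_vec j k)" and pmw: "homogeneous 2 (polar_mat CA w1 j k)" for j k
    unfolding polar_mat_def
    by (intro homogeneous_sum homogeneous_mult[of 0 _ 1 _ 1] homogeneous_mult[of 0 _ 2 _ 2] homogeneous_add CA v1 w1h; simp)+
  have "homogeneous 3 G"
    unfolding G_def
    by (intro homogeneous_add homogeneous_diff homogeneous_numeral_mult homogeneous_sum homogeneous_mult[of 1 _ 2 _ 3] homogeneous_mult[of 1 _ 1 _ 2] pmv pmw; simp)
  then have "homogeneous 3 a" using homogeneous_of_nat_cancel[of 3 900 a] unfolding a by simp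
  moreover have "w1 $ k * w2 $ l - w1 $ l * w2 $ k = - a * ?P k l" for k l
  proof -
    have "900 * (w1 $ k * w2 $ l - w1 $ l * w2 $ k) = 900 * (- a * ?P k l)"
      using id[of k l] unfolding a by (simp add: mult.assoc)
    then show ?thesis by (simp only: mult_cancel_left) simp
  qed
  ultimately show ?thesis unfolding w1_def w2_def by blast
qed

theorem ex_cubic_covariant_specialised:
  fixes b :: "8 \<Rightarrow> 8 \<Rightarrow> 8 \<Rightarrow> 'a::comm_ring_1"
  shows "\<exists>c. \<forall>u k l. radical_vec b u $ k * radical_vec b (radical_vec b u) $ l - radical_vec b u $ l * radical_vec b (radical_vec b u) $ k =
      - (\<Sum>i\<in>UNIV. \<Sum>j\<in>UNIV. \<Sum>k\<in>UNIV. c i j k * u $ i * u $ j * u $ k) * (u $ k * radical_vec b u $ l - u $ l * radical_vec b u $ k)"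
proof -
  obtain a where a: "homogeneous 3 a" "\<And>k l. radical_vec gen_coeff gen_vec $ k * radical_vec gen_coeff (radical_vec gen_coeff gen_vec) $ l - radical_vec gen_coeff gen_vec $ l * radical_vec gen_coeff (radical_vec gen_coeff gen_vec) $ k =
      - a * (gen_vec $ k * radical_vec gen_coeff gen_vec $ l - gen_vec $ l * radical_vec gen_coeff gen_vec $ k)" using ex_cubic_covariant by blast
  obtain Ca where Ca: "\<forall>i k l. homogeneous 0 (Ca i k l)"
    "a = (\<Sum>i\<in>UNIV. \<Sum>k\<in>UNIV. \<Sum>l\<in>UNIV. Ca i k l * Var [i] * Var [k] * Var [l])"
    using homogeneous_cubic_form[OF a(1)] by blast
  have g: "(\<chi> i. evalp (assign b u) (gen_vec $ i)) = u" for u by (simp add: vec_eq_iff)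
  have w1: "evalp (assign b u) (radical_vec gen_coeff gen_vec $ j) = radical_vec b u $ j" for u j
    by (simp add: radical_vec_def evalp_assign_gen g[simplified])
  have w2: "evalp (assign b u) (radical_vec gen_coeff (radical_vec gen_coeff gen_vec) $ j) = radical_vec b (radical_vec b u) $ j" for u j
  proof -
    have "(\<chi> i. evalp (assign b u) (radical_vec gen_coeff gen_vec $ i)) = radical_vec b u" by (simp add: vec_eq_iff w1)
    then show ?thesis unfolding radical_vec_def[of gen_coeff "radical_vec gen_coeff gen_vec"] radical_vec_def[of b "radical_vec b u"] by (simp add: evalp_assign_gen)
  qed
  have ea: "evalp (assign b u) a = (\<Sum>i\<in>UNIV. \<Sum>j\<in>UNIV. \<Sum>k\<in>UNIV. evalp (assign b 0) (Ca i j k) * u $ i * u $ j * u $ k)" for u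
    unfolding Ca(2) using evalp_homogeneous_0[of "Ca _ _ _" b u 0] Ca(1) by simp
  show ?thesis
  proof (intro exI allI)
    fix u :: "'a^8" and k l
    have "evalp (assign b u) (radical_vec gen_coeff gen_vec $ k * radical_vec gen_coeff (radical_vec gen_coeff gen_vec) $ l - radical_vec gen_coeff gen_vec $ l * radical_vec gen_coeff (radical_vec gen_coeff gen_vec) $ k) =
       evalp (assign b u) (- a * (gen_vec $ k * radical_vec gen_coeff gen_vec $ l - gen_vec $ l * radical_vec gen_coeff gen_vec $ k))" by (simp only: a(2))
    then show "radical_vec b u $ k * radical_vec b (radical_vec b u) $ l - radical_vec b u $ l * radical_vec b (radical_vec b u) $ k =
      - (\<Sum>i\<in>UNIV. \<Sum>j\<in>UNIV. \<Sum>k\<in>UNIV. evalp (assign b 0) (Ca i j k) * u $ i * u $ j * u $ k) * (u $ k * radical_vec b u $ l - u $ l * radical_vec b u $ k)"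
      by (simp add: w1 w2 ea)
  qed
qed

section \<open>Forms of maximal rank and the theorem\<close>

definition pf_vectors :: "(8 \<Rightarrow> 8 \<Rightarrow> 8 \<Rightarrow> 'a::comm_ring_1) \<Rightarrow> 'a^8 \<Rightarrow> (8 \<Rightarrow> 'a^8) \<Rightarrow> 'a" where
  "pf_vectors b x y = pf6 (\<lambda>a c. tri_form b x (y a) (y c))"

lemma pf6_equal_rows:
  assumes m: "alternating_matrix m" and s: "s \<in> slots" "t \<in> slots" "s \<noteq> t"
    and eq: "\<And>c. m s c = m t c"
  shows "pf6 m = 0"
proof -
  have "row_replace s (m s) m = m"
  proof (intro ext)
    fix a c
    have sk: "m a s = - m s a" using m unfolding alternating_matrix_def by blast
    show "row_replace s (m s) m a c = m a c"
    proof (cases "a = s")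
      case False
      then show ?thesis using sk by (cases "c = s") (simp_all add: row_replace_def)
    qed (simp add: row_replace_def)
  qed
  moreover have "pf6 (row_replace s (m s) m) = (if s = t then 1 else 0) * pf6 m"
    by (rule pf6_row_comb[OF m s(1), of _ "\<lambda>j. if j = t then 1 else 0"]) (use s eq in auto)
  ultimately show ?thesis using s by simp
qed

lemma pf_vectors_linear:
  fixes b :: "8 \<Rightarrow> 8 \<Rightarrow> 8 \<Rightarrow> 'a::comm_ring_1"
  assumes "s \<in> slots"
  shows "pf_vectors b x (y(s := u + v)) = pf_vectors b x (y(s := u)) + pf_vectors b x (y(s := v))"
    and "pf_vectors b x (y(s := c *s u)) = c * pf_vectors b x (y(s := u))"
  using assms by (elim insertE emptyE; simp add: pf_vectors_def pf6_def tri_form_linear algebra_simps)+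

text \<open>
  The Pfaffian is linear in each of the six vectors, so it suffices to consider basis vectors. For six
  different ones it is a cofactor up to sign, and it vanishes if a vector is repeated.
\<close>

lemma pf_vectors_eq_0:
  fixes b :: "8 \<Rightarrow> 8 \<Rightarrow> 8 \<Rightarrow> 'a::comm_ring_1"
  assumes zero: "\<And>i j. pf_cofactor (form_matrix b x) i j = 0"
  shows "pf_vectors b x y = 0"
proof -
  have base: "pf_vectors b x (\<lambda>a. axis (f a) 1) = 0" for f
  proof (cases "inj_on f slots")
    case True
    have "card (UNIV - f ` slots) = 2"
      using card_image[OF True] by (subst card_Diff_subset) simp_all
    then obtain p q where pq: "UNIV - f ` slots = {p, q}" "p \<noteq> q" by (auto simp: card_2_iff)
    define \<pi> where "\<pi> a = (if a = 0 then p else if a = 1 then q else f a)" for a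
    have eq: "\<pi> a = f a" if "a \<in> slots" for a using that by (auto simp: \<pi>_def)
    have U: "UNIV = insert 0 (insert 1 slots)" unfolding UNIV_8 by simp
    have "\<pi> ` UNIV = insert p (insert q (f ` slots))"
      unfolding U using eq by (simp add: \<pi>_def[of 0] \<pi>_def[of 1])
    then have "surj \<pi>" using pq by auto
    then have "\<pi> permutes UNIV"
      using finite_UNIV_surj_inj[of \<pi>] by (intro bij_imp_permutes) (auto simp: bij_def)
    from pf_cofactor_perm[OF alternating_form_matrix this, of b x] zero
    have "of_int (sign \<pi>) * pf6 (\<lambda>a c. form_matrix b x (\<pi> a) (\<pi> c)) = 0" by simp
    then have "pf6 (\<lambda>a c. form_matrix b x (\<pi> a) (\<pi> c)) = 0"
      by (cases \<pi> rule: sign_cases) simp_all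
    then show ?thesis by (simp add: pf_vectors_def pf6_def form_matrix_def \<pi>_def)
  next
    case False
    then obtain s t where st: "s \<in> slots" "t \<in> slots" "s \<noteq> t" "f s = f t" by (meson inj_onI)
    have "pf6 (\<lambda>a c. form_matrix b x (f a) (f c)) = 0"
      by (rule pf6_equal_rows[OF alternating_matrix_comp[OF alternating_form_matrix] st(1-3)]) (simp add: st(4))
    then show ?thesis by (simp add: pf_vectors_def form_matrix_def)
  qed
  have "pf_vectors b x y = 0" if "finite S" "S \<subseteq> slots" "\<forall>a. a \<notin> S \<longrightarrow> (\<exists>i. y a = axis i 1)" for S y
    using that
  proof (induction S arbitrary: y)
    case empty
    then have "\<forall>a. \<exists>i. y a = axis i 1" by blast
    from choice[OF this] obtain f where "\<forall>a. y a = axis (f a) 1" by (elim exE)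
    then have "y = (\<lambda>a. axis (f a) 1)" by blast
    then show ?case using base[of f] by simp
  next
    case (insert s S)
    have s: "s \<in> slots" using insert by blast
    have "pf_vectors b x (y(s := y s)) = (\<Sum>j\<in>UNIV. y s $ j * pf_vectors b x (y(s := axis j 1)))"
      by (rule linear_expand) (use pf_vectors_linear[OF s] in blast)+
    moreover have "pf_vectors b x (y(s := axis j 1)) = 0" for j
      by (rule insert.IH) (use insert in auto)
    ultimately show ?case by simp
  qed
  note step = this
  \<comment> \<open>Only the positions \<open>2, \<dots>, 7\<close> enter the Pfaffian; the other two are filled with a basis vector.\<close>
  obtain y' where y': "y' = (\<lambda>a. if a \<in> slots then y a else axis 0 1)" by blast
  have "pf_vectors b x y' = 0" by (rule step[of slots]) (auto simp: y')
  moreover have "pf_vectors b x y' = pf_vectors b x y" by (simp add: pf_vectors_def pf6_def y')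
  ultimately show ?thesis by simp
qed

text \<open>
  One step of the symplectic Gram-Schmidt process. If the form vanished on the orthogonal complement
  of \<open>T\<close>, the complement would lie in the radical, and the space would be spanned by \<open>T\<close>, \<open>x\<close> and \<open>y0\<close>,
  that is by at most six vectors.
\<close>

lemma hyperbolic_pair:
  fixes b :: "8 \<Rightarrow> 8 \<Rightarrow> 8 \<Rightarrow> 'k::field"
  assumes rad: "\<And>y. (\<And>z. tri_form b x y z = 0) \<Longrightarrow> y \<in> vec.span {x, y0}"
    and T: "finite T" "card T \<le> 4"
    and proj: "\<And>z. \<exists>z'. z - z' \<in> vec.span T \<and> (\<forall>t\<in>T. tri_form b x z' t = 0)"
  shows "\<exists>p q. (\<forall>t\<in>T. tri_form b x p t = 0) \<and> (\<forall>t\<in>T. tri_form b x q t = 0) \<and> tri_form b x p q = 1 \<and>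
     (\<forall>z. \<exists>z'. z - z' \<in> vec.span (insert p (insert q T)) \<and> (\<forall>t\<in>insert p (insert q T). tri_form b x z' t = 0))"
proof -
  have span0: "tri_form b x p z = 0" if "\<forall>t\<in>T. tri_form b x p t = 0" "z \<in> vec.span T" for p z
    using that(2) by (induction rule: vec.span_induct_alt) (use that(1) in \<open>auto simp: tri_form_linear tri_form_expand3[of b x p 0]\<close>)
  have "\<exists>p q. (\<forall>t\<in>T. tri_form b x p t = 0) \<and> (\<forall>t\<in>T. tri_form b x q t = 0) \<and> tri_form b x p q \<noteq> 0"
  proof (rule ccontr)
    assume no: "\<not> ?thesis"
    have "p \<in> vec.span {x, y0}" if p: "\<forall>t\<in>T. tri_form b x p t = 0" for p
    proof (rule rad)
      fix z
      obtain z' where z': "z - z' \<in> vec.span T" "\<forall>t\<in>T. tri_form b x z' t = 0" using proj by blast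
      have "tri_form b x p z = tri_form b x p (z - z') + tri_form b x p z'" by (simp add: tri_form_linear)
      then show "tri_form b x p z = 0" using span0[OF p z'(1)] no p z'(2) by auto
    qed
    then have "z \<in> vec.span (T \<union> {x, y0})" for z
    proof -
      obtain z' where z': "z - z' \<in> vec.span T" "\<forall>t\<in>T. tri_form b x z' t = 0" using proj by blast
      have "z' \<in> vec.span {x, y0}" using \<open>\<And>p. \<forall>t\<in>T. tri_form b x p t = 0 \<Longrightarrow> p \<in> vec.span {x, y0}\<close> z'(2) by blast
      then have "(z - z') + z' \<in> vec.span (T \<union> {x, y0})"
        using z'(1) vec.span_mono[of T "T \<union> {x, y0}"] vec.span_mono[of "{x, y0}" "T \<union> {x, y0}"]
        by (intro vec.span_add) auto
      then show ?thesis by simp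
    qed
    then have "UNIV \<subseteq> vec.span (T \<union> {x, y0})" by blast
    then have "vec.dim (UNIV :: ('k^8) set) \<le> card (T \<union> {x, y0})"
      by (rule vec.dim_le_card) (use T in simp)
    also have "\<dots> \<le> card T + card {x, y0}" by (rule card_Un_le)
    also have "\<dots> \<le> 6" using T(2) card_insert_le_m1[of 2 "{y0}" x] by simp
    finally show False by (simp add: vec.dim_UNIV card_cart_basis)
  qed
  then obtain p q0 where pq0: "\<forall>t\<in>T. tri_form b x p t = 0" "\<forall>t\<in>T. tri_form b x q0 t = 0" "tri_form b x p q0 \<noteq> 0" by blast
  define q where "q = inverse (tri_form b x p q0) *s q0"
  have q: "\<forall>t\<in>T. tri_form b x q t = 0" "tri_form b x p q = 1" using pq0 by (simp_all add: q_def tri_form_linear)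
  have qp: "tri_form b x q p = - 1" using q(2) tri_form_swap23[of b x q p] by simp
  have "\<exists>z'. z - z' \<in> vec.span (insert p (insert q T)) \<and> (\<forall>t\<in>insert p (insert q T). tri_form b x z' t = 0)" for z
  proof -
    obtain z' where z': "z - z' \<in> vec.span T" "\<forall>t\<in>T. tri_form b x z' t = 0" using proj by blast
    define z2 where "z2 = z' - tri_form b x z' q *s p + tri_form b x z' p *s q"
    have "z - z2 = (z - z') + tri_form b x z' q *s p - tri_form b x z' p *s q" by (simp add: z2_def)
    also have "\<dots> \<in> vec.span (insert p (insert q T))"
    proof -
      have "z - z' \<in> vec.span (insert p (insert q T))"
        by (rule vec.span_mono[THEN subsetD, OF _ z'(1)]) auto
      moreover have "p \<in> vec.span (insert p (insert q T))" "q \<in> vec.span (insert p (insert q T))"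
        by (auto intro: vec.span_base)
      ultimately show ?thesis by (blast intro: vec.span_add vec.span_diff vec.span_scale)
    qed
    finally show ?thesis using z'(2) pq0(1) q qp by (intro exI[of _ z2]) (simp add: z2_def tri_form_linear)
  qed
  then show ?thesis using pq0(1) q by blast
qed

text \<open>
  If the radical has dimension at most two, three hyperbolic pairs can be found, and their Pfaffian
  is 1.
\<close>

lemma cofactor_nonzero:
  fixes b :: "8 \<Rightarrow> 8 \<Rightarrow> 8 \<Rightarrow> 'k::field"
  assumes rad: "\<And>y. (\<And>z. tri_form b x y z = 0) \<Longrightarrow> y \<in> vec.span {x, y0}"
  shows "\<exists>i j. pf_cofactor (form_matrix b x) i j \<noteq> 0"
proof (rule ccontr)
  assume "\<not> ?thesis"
  then have zero: "pf_vectors b x y = 0" for y by (intro pf_vectors_eq_0) blast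
  have T0: "\<exists>z'. z - z' \<in> vec.span {} \<and> (\<forall>t\<in>{}. tri_form b x z' t = 0)" for z by (intro exI[of _ z]) simp
  obtain p1 q1 where 1: "tri_form b x p1 q1 = 1"
    "\<And>z. \<exists>z'. z - z' \<in> vec.span {p1, q1} \<and> (\<forall>t\<in>{p1, q1}. tri_form b x z' t = 0)"
    using hyperbolic_pair[OF rad _ _ T0] by auto
  obtain p2 q2 where 2: "\<forall>t\<in>{p1, q1}. tri_form b x p2 t = 0" "\<forall>t\<in>{p1, q1}. tri_form b x q2 t = 0" "tri_form b x p2 q2 = 1"
    "\<And>z. \<exists>z'. z - z' \<in> vec.span {p2, q2, p1, q1} \<and> (\<forall>t\<in>{p2, q2, p1, q1}. tri_form b x z' t = 0)"
    using hyperbolic_pair[OF rad _ _ 1(2)] card_insert_le_m1[of 2 "{q1}" p1] by auto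
  have "card {p2, q2, p1, q1} \<le> 4" using card_length[of "[p2, q2, p1, q1]"] by simp
  then obtain p3 q3 where 3: "\<forall>t\<in>{p2, q2, p1, q1}. tri_form b x p3 t = 0" "\<forall>t\<in>{p2, q2, p1, q1}. tri_form b x q3 t = 0" "tri_form b x p3 q3 = 1"
    using hyperbolic_pair[OF rad _ _ 2(4)] by auto
  define y :: "8 \<Rightarrow> 'k^8" where
    "y a = (if a = 2 then p1 else if a = 3 then q1 else if a = 4 then p2 else if a = 5 then q2 else if a = 6 then p3 else q3)" for a
  have sw: "tri_form b x u v = 0" if "tri_form b x v u = 0" for u v using tri_form_swap23[of b x v u] that by simp
  have z: "tri_form b x p1 p2 = 0" "tri_form b x p1 q2 = 0" "tri_form b x p1 p3 = 0" "tri_form b x p1 q3 = 0"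
    "tri_form b x q1 p2 = 0" "tri_form b x q1 q2 = 0" "tri_form b x q1 p3 = 0" "tri_form b x q1 q3 = 0"
    "tri_form b x p2 p3 = 0" "tri_form b x p2 q3 = 0" "tri_form b x q2 p3 = 0" "tri_form b x q2 q3 = 0"
    using 2 3 by (auto intro: sw)
  have "pf_vectors b x y = 1" by (simp add: pf_vectors_def pf6_def y_def z 1(1) 2(3) 3(3))
  then show False using zero by simp
qed

text \<open>
  The coefficients are the values of the form at the increasing triples of basis vectors.
\<close>

lemma tri_form_represents:
  fixes \<phi> :: "'k::field^8 \<Rightarrow> 'k^8 \<Rightarrow> 'k^8 \<Rightarrow> 'k"
  assumes l1: "\<And>x x' y z. \<phi> (x + x') y z = \<phi> x y z + \<phi> x' y z" "\<And>c x y z. \<phi> (c *s x) y z = c * \<phi> x y z"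
    and l2: "\<And>x y y' z. \<phi> x (y + y') z = \<phi> x y z + \<phi> x y' z" "\<And>c x y z. \<phi> x (c *s y) z = c * \<phi> x y z"
    and l3: "\<And>x y z z'. \<phi> x y (z + z') = \<phi> x y z + \<phi> x y z'" "\<And>c x y z. \<phi> x y (c *s z) = c * \<phi> x y z"
    and a12: "\<And>x z. \<phi> x x z = 0" and a23: "\<And>x y. \<phi> x y y = 0"
  shows "\<exists>b. \<forall>x y z. \<phi> x y z = tri_form b x y z"
proof -
  define e where "e i = (axis i 1 :: 'k^8)" for i :: 8
  define b where "b i j k = (if i < j \<and> j < k then \<phi> (e i) (e j) (e k) else 0)" for i j k
  have s12: "\<phi> y x z = - \<phi> x y z" for x y z 
  proof -
    have "\<phi> x y z + \<phi> y x z = 0" using a12[of "x + y" z] unfolding l1 l2 by (simp add: a12 add.commute)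
    then show ?thesis by (simp add: eq_neg_iff_add_eq_0 add.commute)
  qed
  have s23: "\<phi> x z y = - \<phi> x y z" for x y z 
  proof -
    have "\<phi> x y z + \<phi> x z y = 0" using a23[of x "y + z"] unfolding l2 l3 by (simp add: a23 add.commute)
    then show ?thesis by (simp add: eq_neg_iff_add_eq_0 add.commute)
  qed
  have a13: "\<phi> x y x = 0" for x y using s23[of x y x] a12 by simp
  have basis: "\<phi> (e i) (e j) (e k) = tri_form b (e i) (e j) (e k)" for i j k
  proof -
    have repeated: "\<phi> (e i) (e j) (e k) = tri_form b (e i) (e j) (e k)" if "i = j \<or> j = k \<or> i = k"
      using that by (auto simp: a12 a23 a13)
    have r1: "\<phi> (e j) (e i) (e k) = - \<phi> (e i) (e j) (e k)" by (rule s12)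
    have r2: "\<phi> (e i) (e k) (e j) = - \<phi> (e i) (e j) (e k)" by (rule s23)
    have r3: "\<phi> (e j) (e k) (e i) = \<phi> (e i) (e j) (e k)" using s23[of "e j" "e k" "e i"] r1 by simp
    have r4: "\<phi> (e k) (e i) (e j) = \<phi> (e i) (e j) (e k)" using s12[of "e k" "e i" "e j"] r2 by simp
    have r5: "\<phi> (e k) (e j) (e i) = - \<phi> (e i) (e j) (e k)" using s12[of "e k" "e j" "e i"] r3 by simp
    show ?thesis
    proof (cases "i = j \<or> j = k \<or> i = k")
      case False
      then consider "i < j" "j < k" | "i < k" "k < j" | "j < i" "i < k" | "j < k" "k < i" | "k < i" "i < j" | "k < j" "j < i"
        by (meson linorder_less_linear)
      then show ?thesis
        unfolding tri_form_axis[of b i j k, folded e_def] by cases (auto simp: b_def r1 r2 r3 r4 r5)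
    qed (rule repeated)
  qed
  have "\<phi> x y z = tri_form b x y z" for x y z
  proof -
    have 1: "\<phi> x y z = (\<Sum>i\<in>UNIV. x $ i * \<phi> (e i) y z)" for x y z
      unfolding e_def by (rule linear_expand[of "\<lambda>x. \<phi> x y z"]) (simp_all add: l1)
    have 2: "\<phi> x y z = (\<Sum>i\<in>UNIV. y $ i * \<phi> x (e i) z)" for x y z
      unfolding e_def by (rule linear_expand[of "\<lambda>y. \<phi> x y z"]) (simp_all add: l2)
    have 3: "\<phi> x y z = (\<Sum>i\<in>UNIV. z $ i * \<phi> x y (e i))" for x y z
      unfolding e_def by (rule linear_expand[of "\<lambda>z. \<phi> x y z"]) (simp_all add: l3)
    have "\<phi> x y z = (\<Sum>i\<in>UNIV. x $ i * (\<Sum>j\<in>UNIV. y $ j * (\<Sum>k\<in>UNIV. z $ k * \<phi> (e i) (e j) (e k))))"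
      by (subst 1, subst 2, subst 3) (rule refl)
    also have "\<dots> = tri_form b x y z" unfolding basis unfolding e_def
      by (simp only: tri_form_expand3[of b _ _ z, symmetric] tri_form_expand2[of b _ y z, symmetric] tri_form_expand1[of b x y z, symmetric])
    finally show ?thesis .
  qed
  then show ?thesis by blast
qed

text \<open>
  If no such \<open>x\<close> exists, \<open>u \<and> w(u)\<close> is non-zero for all \<open>u \<noteq> 0\<close>. At a zero \<open>u\<close> of the cubic form, the
  vector \<open>w(u)\<close> contradicts this.
\<close>

theorem no_regular_form:
  fixes b :: "8 \<Rightarrow> 8 \<Rightarrow> 8 \<Rightarrow> 'k::field"
  assumes cubic: "\<forall>c :: 8 \<Rightarrow> 8 \<Rightarrow> 8 \<Rightarrow> 'k. \<exists>x :: 'k ^ 8. x \<noteq> 0 \<and> cubic_form c x = 0"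
  shows "\<exists>x. x \<noteq> 0 \<and> (\<forall>y0. \<exists>y. (\<forall>z. tri_form b x y z = 0) \<and> y \<notin> vec.span {x, y0})"
proof (rule ccontr)
  assume "\<not> ?thesis"
  then have "\<exists>i j. pf_cofactor (form_matrix b x) i j \<noteq> 0" if "x \<noteq> 0" for x
    using that cofactor_nonzero[of b x] by blast
  then have reg: "\<exists>i j. x $ i * radical_vec b x $ j - x $ j * radical_vec b x $ i \<noteq> 0" if "x \<noteq> 0" for x
    using that by (simp add: cofactor_radical_vec)
  obtain c where c: "\<And>u k l. radical_vec b u $ k * radical_vec b (radical_vec b u) $ l - radical_vec b u $ l * radical_vec b (radical_vec b u) $ k =
      - cubic_form c u * (u $ k * radical_vec b u $ l - u $ l * radical_vec b u $ k)"
    using ex_cubic_covariant_specialised[of b] unfolding cubic_form_def by blast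
  obtain u where u: "u \<noteq> 0" "cubic_form c u = 0" using cubic by blast
  have "radical_vec b u \<noteq> 0" using reg[OF u(1)] by auto
  then show False using reg[of "radical_vec b u"] c[of u] u(2) by auto
qed

context hyperplane_of_G3 begin

text \<open>
  A vector \<open>y\<close> outside \<open>\<langle>v\<rangle>\<close> in the radical of the contraction with \<open>v\<close> spans with \<open>v\<close> a member of the
  upper radical, and there is only one member through \<open>v\<close>.
\<close>

lemma radical_in_spread_line:
  assumes \<phi>: "\<And>x y z. vanishes x y z \<longleftrightarrow> \<phi> x y z = 0"
    and spread: "line_spread smul (upper_radical smul H)" and v: "v \<noteq> 0"
  shows "\<exists>a. \<forall>y. (\<forall>z. \<phi> v y z = 0) \<longrightarrow> y \<in> span {v, a}"
proof -
  have "dim {v} = 1" using dim_insert[of v "{}"] v by simp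
  then have "span {v} \<in> k_subspaces smul 1" by (simp add: span_in_k_subspaces)
  then have ex1: "\<exists>!A. A \<in> upper_radical smul H \<and> span {v} \<subseteq> A"
    using spread unfolding line_spread_def by (elim conjE bspec)
  then obtain A where A0: "A \<in> upper_radical smul H \<and> span {v} \<subseteq> A"
    and uniq0: "\<forall>A'. A' \<in> upper_radical smul H \<and> span {v} \<subseteq> A' \<longrightarrow> A' = A" by (rule ex1E)
  note A = A0[THEN conjunct1] A0[THEN conjunct2]
  have uniq: "A' = A" if "A' \<in> upper_radical smul H" "span {v} \<subseteq> A'" for A'
    by (rule uniq0[THEN spec, THEN mp, OF conjI[OF that]])
  have sub: "subspace A" and dA: "dim A = 2" using A(1) by (auto simp: upper_radical_def k_subspaces_iff)
  have vA: "v \<in> A" using A(2) span_base[of v "{v}"] by auto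
  have "\<not> A \<subseteq> span {v}"
  proof
    assume "A \<subseteq> span {v}"
    then have "dim A \<le> 1" using dim_subset[of A "span {v}"] \<open>dim {v} = 1\<close> by simp
    then show False using dA by simp
  qed
  then obtain a where a: "a \<in> A" "a \<notin> span {v}" by blast
  have "{v, a} = insert a {v}" by auto
  then have "dim {v, a} = 2" using dim_insert[of a "{v}"] a(2) \<open>dim {v} = 1\<close> by simp
  moreover have "span {v, a} \<subseteq> A" using vA a(1) sub by (intro span_minimal) auto
  ultimately have sA: "span {v, a} = A" using subspace_dim_equal[OF subspace_span sub] dA by simp
  have "y \<in> A" if y: "\<forall>z. \<phi> v y z = 0" for y
  proof (cases "y \<in> span {v}")
    case True then show ?thesis using A(2) by blast
  next
    case False
    have "{v, y} = insert y {v}" by auto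
    then have d2: "dim {v, y} = 2" using dim_insert[of y "{v}"] False \<open>dim {v} = 1\<close> by simp
    have "U \<in> H" if U: "U \<in> k_subspaces smul 3" "span {v, y} \<subseteq> U" for U
    proof -
      have sU: "subspace U" "dim U = 3" using U(1) by (auto simp: k_subspaces_iff)
      have "\<not> U \<subseteq> span {v, y}"
      proof
        assume "U \<subseteq> span {v, y}"
        then have "dim U \<le> 2" using dim_subset[of U "span {v, y}"] d2 by simp
        then show False using sU by simp
      qed
      then obtain z where z: "z \<in> U" "z \<notin> span {v, y}" by blast
      have "{v, y, z} = insert z {v, y}" by auto
      then have d3: "dim {v, y, z} = 3" using dim_insert[of z "{v, y}"] z(2) d2 by simp
      have "v \<in> U" "y \<in> U" using U(2) span_base[of v "{v,y}"] span_base[of y "{v,y}"] by auto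
      then have "span {v, y, z} \<subseteq> U" using z sU(1) by (intro span_minimal) auto
      then have "span {v, y, z} = U" using subspace_dim_equal[OF subspace_span sU(1)] d3 sU(2) by simp
      moreover have "vanishes v y z" using y \<phi> by blast
      ultimately show ?thesis using U(1) by (simp add: vanishes_def)
    qed
    then have "span {v, y} \<in> upper_radical smul H"
      using d2 by (auto simp: upper_radical_def span_in_k_subspaces)
    moreover have "span {v} \<subseteq> span {v, y}" by (rule span_mono) auto
    ultimately have "span {v, y} = A" by (rule uniq)
    then show ?thesis using span_base[of y "{v, y}"] by auto
  qed
  then show ?thesis using sA by blast
qed

end

theorem theorem1p6:
  fixes smul :: "'k::field \<Rightarrow> 'v::ab_group_add \<Rightarrow> 'v"
    and H :: "'v set set"
  assumes "vector_space smul"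
    and "vector_space.dim smul (UNIV :: 'v set) = 8"
    and "perfect_field TYPE('k)"
    and "cohomological_dim TYPE('k) \<le> 1"
    and "\<forall>c :: 8 \<Rightarrow> 8 \<Rightarrow> 8 \<Rightarrow> 'k. \<exists>x :: 'k ^ 8. x \<noteq> 0 \<and> cubic_form c x = 0"
    and "grassmann_hyperplane smul 3 H"
  shows "\<not> line_spread smul (upper_radical smul H)"
proof
  assume spread: "line_spread smul (upper_radical smul H)"
  obtain Bs where Bs: "finite_dimensional_vector_space smul Bs" "card Bs = 8"
    using finite_dimensional_vector_space_of_dim[OF assms(1,2)] by auto
  interpret finite_dimensional_vector_space smul Bs by (rule Bs(1))
  interpret hyperplane_of_G3 smul Bs H by unfold_locales (rule assms(6))
  obtain \<phi> where \<phi>1: "\<And>y z. functional (\<lambda>x. \<phi> x y z)" and \<phi>2: "\<And>x z. functional (\<lambda>y. \<phi> x y z)"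
    and \<phi>3: "\<And>x y. functional (\<phi> x y)" and \<phi>a: "\<And>x z. \<phi> x x z = 0" "\<And>x y. \<phi> x y y = 0"
    and \<phi>: "\<And>x y z. vanishes x y z \<longleftrightarrow> \<phi> x y z = 0" using trilinear_form_of_H by blast
  obtain e :: "8 \<Rightarrow> 'v" where e: "bij_betw e UNIV Bs"
    using finite_same_card_bij[of "UNIV :: 8 set" Bs] finite_Basis Bs(2) by auto
  define T where "T x = (\<Sum>i\<in>UNIV. smul (x $ i) (e i))" for x :: "'k^8"
  have T_add: "T (x + y) = T x + T y" for x y by (simp add: T_def scale_left_distrib sum.distrib)
  have T_scale: "T (c *s x) = smul c (T x)" for c x by (simp add: T_def scale_sum_right)
  have T_sum: "T x = (\<Sum>v\<in>Bs. smul (x $ inv_into UNIV e v) v)" for x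
  proof -
    have "(\<Sum>v\<in>Bs. smul (x $ inv_into UNIV e v) v) =
        (\<Sum>v\<in>Bs. smul (x $ inv_into UNIV e v) (e (inv_into UNIV e v)))"
      by (intro sum.cong) (simp_all add: bij_betw_inv_into_right[OF e])
    also have "\<dots> = T x"
      unfolding T_def by (rule sum.reindex_bij_betw[OF bij_betw_inv_into[OF e]])
    finally show ?thesis by simp
  qed
  have T_0: "x = 0" if "T x = 0" for x
  proof -
    have "x $ inv_into UNIV e v = 0" if "v \<in> Bs" for v
      using independentD[OF independent_Basis finite_Basis subset_refl T_sum[of x, symmetric, unfolded \<open>T x = 0\<close>] that] .
    then have "x $ i = 0" for i using bij_betw_inv_into_left[OF e] bij_betwE[OF e] by (metis UNIV_I)
    then show ?thesis by (simp add: vec_eq_iff)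
  qed
  have T_surj: "\<exists>x. T x = v" for v
  proof -
    have "v \<in> span Bs" by (simp add: span_Basis)
    then obtain g where "v = (\<Sum>a\<in>Bs. smul (g a) a)" using span_finite[OF finite_Basis] by auto
    then have "T (\<chi> i. g (e i)) = v"
      unfolding T_sum using bij_betw_inv_into_right[OF e] by (auto intro!: sum.cong)
    then show ?thesis by blast
  qed
  obtain b where b: "\<And>x y z. \<phi> (T x) (T y) (T z) = tri_form b x y z"
    using tri_form_represents[of "\<lambda>x y z. \<phi> (T x) (T y) (T z)"]
    by (simp add: T_add T_scale functional_simps[OF \<phi>1] functional_simps[OF \<phi>2] functional_simps[OF \<phi>3] \<phi>a) blast
  obtain x where x: "x \<noteq> 0" "\<And>y0. \<exists>y. (\<forall>z. tri_form b x y z = 0) \<and> y \<notin> vec.span {x, y0}"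
    using no_regular_form[OF assms(5), of b] by blast
  have "T x \<noteq> 0" using x(1) T_0 by blast
  then obtain a where a: "\<And>y. \<forall>z. \<phi> (T x) y z = 0 \<Longrightarrow> y \<in> span {T x, a}"
    using radical_in_spread_line[OF \<phi> spread] by blast
  obtain y0 where y0: "T y0 = a" using T_surj by blast
  obtain y where y: "\<forall>z. tri_form b x y z = 0" "y \<notin> vec.span {x, y0}" using x(2) by blast
  have "\<phi> (T x) (T y) z = 0" for z using T_surj[of z] b y(1) by metis
  then have "T y \<in> span {T x, T y0}" using a y0 by blast
  then obtain s t where "T y - smul s (T x) - smul t (T y0) = 0"
    unfolding span_insert by auto
  then have "T (y - s *s x - t *s y0) = 0"
    using T_add[of "y - s *s x - t *s y0" "s *s x + t *s y0"] by (simp add: T_add T_scale algebra_simps)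
  then have "y = s *s x + t *s y0" using T_0 by (metis add.commute diff_diff_eq eq_iff_diff_eq_0)
  then have "y \<in> vec.span {x, y0}"
    by (auto intro!: vec.span_add vec.span_scale intro: vec.span_base)
  then show False using y(2) by blast
qed

end
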